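(* Let $E$ and $F$ be Polish spaces with Borel $\sigma$-fields $\mathcal{B}(E)$, $\mathcal{B}(F)$. For each $x\in F$ let $P_x$ be a Markov kernel on $E$ such that for every $A\in\mathcal{B}(E)$ the map $(x,y)\mapsto P_x(y,A)$ is measurable on $F\times E$. Let $X=(X_t)_{t\in\mathbb{Z}}$ be an $F$-valued stochastic process on a probability space $(\Omega,\mathcal{A},\mathbb{P})$. Assume: (A1) $X$ is stationary. (A2) There exist a measurable $V:E\to(0,\infty)$ and two measurable maps $\lambda,b:F\to\mathbb{R}_+$ with $\mathbb{E}[\log^+\lambda(X_0)]<\infty$ and $\mathbb{E}[\log^+ b(X_0)]<\infty$, such that for all $x\in F$ and $y\in E$, $P_xV(y)\le \lambda(x)V(y)+b(x)$, and $$\limsup_{n\to\infty}\Big(\prod_{i=1}^n\lambda(X_{-i})\Big)^{1/n}<1\quad\text{a.s.}$$ (A3) There exists a measurable map $\eta:(0,\infty)\times F\to(0,1)$ such that for every $R>0$ there is a probability kernel $\nu_R$ from $F$ to $E$ with $$P_x(y,A)\ge \eta(R,x)\,\nu_R(x,A)\quad\text{for all } x\in F,\ y\in V^{-1}([0,R]),\ A\in\mathcal{B}(E).$$ Then there exists a stationary process $((Y_t,X_t))_{t\in\mathbb{Z}}$ (with $(X_t)_{t\in\mathbb{Z}}$ distributed as the given environment) satisfying $$\mathbb{P}\left(Y_t\in A\mid X,Y_{t-1},Y_{t-2},\ldots\right)=P_{X_{t-1}}(Y_{t-1},A),\qquad t\in\mathbb{Z},\ A\in\mathcal{B}(E),$$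 and the distribution of such a process is unique. If in addition $(X_t)_{t\in\mathbb{Z}}$ is ergodic, then $((Y_t,X_t))_{t\in\mathbb{Z}}$ is also ergodic.
   Context: $\log^+(u)=\log(\max(u,1))$ for $u\ge 0$. For a Markov kernel $P$ and a measurable $V\ge0$, $PV(y)=\int P(y,dy')V(y')$. A process $((Y_t,X_t))_{t\in\mathbb{Z}}$ satisfying the displayed conditional-distribution identity is called a Markov chain in the random environment $X$; in the identity, $X$ denotes the whole sequence $(X_s)_{s\in\mathbb{Z}}$. *)

theory Defs
  imports "HOL-Probability.Probability"
begin

definition logplus :: "real \<Rightarrow> real" where
  "logplus u = ln (max u 1)"

definition law :: "'w measure \<Rightarrow> 'a measure \<Rightarrow> (int \<Rightarrow> 'w \<Rightarrow> 'a) \<Rightarrow> (int \<Rightarrow> 'a) measure" where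
  "law N S Z = distr N (PiM UNIV (\<lambda>_. S)) (\<lambda>\<omega> t. Z t \<omega>)"

definition stationary :: "'w measure \<Rightarrow> 'a measure \<Rightarrow> (int \<Rightarrow> 'w \<Rightarrow> 'a) \<Rightarrow> bool" where
  "stationary N S Z \<longleftrightarrow> law N S (\<lambda>t. Z (t + 1)) = law N S Z"

definition path_shift :: "(int \<Rightarrow> 'a) \<Rightarrow> (int \<Rightarrow> 'a)" where
  "path_shift \<omega> = (\<lambda>t. \<omega> (t + 1))"

definition ergodic_law :: "(int \<Rightarrow> 'a) measure \<Rightarrow> bool" where
  "ergodic_law Q \<longleftrightarrow>
     (\<forall>A\<in>sets Q. path_shift -` A \<inter> space Q = A \<longrightarrow> measure Q A = 0 \<or> measure Q A = 1)"

definition past_sigma :: "'w measure \<Rightarrow> (int \<Rightarrow> 'w \<Rightarrow> 'e::topological_space) \<Rightarrow> (int \<Rightarrow> 'w \<Rightarrow> 'f::topological_space) \<Rightarrow> int \<Rightarrow> 'w measure" where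
  "past_sigma N Y X t = sigma (space N)
     ({X s -` B \<inter> space N | s B. B \<in> sets borel} \<union>
      {Y s -` B \<inter> space N | s B. s < t \<and> B \<in> sets borel})"

definition MCRE :: "('f::topological_space \<Rightarrow> 'e::topological_space \<Rightarrow> 'e measure) \<Rightarrow> (int \<Rightarrow> 'f) measure
    \<Rightarrow> 'w measure \<Rightarrow> (int \<Rightarrow> 'w \<Rightarrow> 'e) \<Rightarrow> (int \<Rightarrow> 'w \<Rightarrow> 'f) \<Rightarrow> bool" where
  "MCRE P L N Y X \<longleftrightarrow>
     prob_space N \<and>
     (\<forall>t. Y t \<in> N \<rightarrow>\<^sub>M borel \<and> X t \<in> N \<rightarrow>\<^sub>M borel) \<and>
     stationary N (borel \<Otimes>\<^sub>M borel) (\<lambda>t \<omega>. (Y t \<omega>, X t \<omega>)) \<and>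
     law N borel X = L \<and>
     (\<forall>t. \<forall>A\<in>sets borel.
        AE \<omega> in N. real_cond_exp N (past_sigma N Y X t) (indicator {\<omega>\<in>space N. Y t \<omega> \<in> A}) \<omega>
                    = measure (P (X (t - 1) \<omega>) (Y (t - 1) \<omega>)) A)"

end

theory Submission
  imports Defs
begin

text \<open>
  Write \<open>\<theta>\<close> for the shift and consider the chain \<open>(Y\<^sub>t, \<theta>\<^sup>t X)\<close> on \<open>E \<times> F\<^sup>\<int>\<close> with transition
  operator \<open>T f (y, x) = \<integral> f (y', \<theta> x) P\<^bsub>x 0\<^esub> (y, dy')\<close>. Enlarging \<open>b\<close> by the constant \<open>V y0\<close>, the series
  \<open>M x = (\<Sum>j. b (x (-1-j)) * (\<Prod>i=1..j. lam (x (-i))))\<close> is almost surely finite and solves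
  \<open>M (\<theta> x) = lam (x 0) * M x + b (x 0)\<close>, so that \<open>V (Y\<^sub>t)\<close>, started below a multiple of \<open>M\<close>, stays
  below that multiple of \<open>M (\<theta>\<^sup>t X)\<close> in conditional mean.

  Fix large levels \<open>c\<close> and \<open>R\<close>. At every time with \<open>M (\<theta>\<^sup>t X) \<le> c\<close> the minorization at level \<open>R\<close>
  contracts the oscillation of \<open>T\<^sup>n f (\<cdot>, x)\<close> on \<open>{V \<le> R}\<close> by the factor \<open>1 - eta R\<close>. The points with
  \<open>V > R\<close> cost an error that is linear in \<open>V\<close>, and over the whole time span these errors sum up to
  at most a multiple of \<open>c / R\<close>. The product of the contraction factors vanishes in the limit, up to
  the probability of \<open>{M > c}\<close>, because with \<open>h = eta R\<close> on \<open>{M \<le> c}\<close> and \<open>h = 0\<close> elsewhere its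
  expectations telescope: \<open>E r\<^bsub>n+1\<^esub> = E r\<^sub>n - E (h * (r\<^sub>n \<circ> \<theta>))\<close>.

  Hence \<open>T\<^sup>n f (y, x)\<close> forgets \<open>y\<close> in mean, uniformly in \<open>f\<close>. The laws started at \<open>y0\<close> are therefore
  Cauchy in total variation and converge to an invariant law, from which the extension theorem of
  Kolmogorov builds the process. The same estimate shows that a measure on path space with the Markov
  property and tight \<open>V (Y\<^sub>t)\<close> is determined by its environment marginal; this gives stationarity
  and uniqueness. For ergodicity, an invariant event \<open>A\<close> is approximated by events of the
  remote past, so the process restricted to \<open>A\<close> is still Markov. Its environment marginal is invariant
  and dominated by the ergodic law of \<open>X\<close>, hence a multiple of it, and therefore the restriction is a
  multiple of the whole process.
\<close>

section \<open>The transition kernel of the chain seen from the environment\<close>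

text \<open>Existence and uniqueness are proved for an environment that may fail to be ergodic, and
  \<open>eta R\<close> has no positive lower bound. So neither return times nor a geometric rate are
  at hand, and an account of errors takes their place. A minorization step shrinks the oscillation
  from r to (1 - e) * r and creates an error of slope e * r / R in \<open>V\<close>. Read off at V =
  M <= c, this error is at most c / R times the fall e * r of the oscillation, and these falls sum
  to at most 1 however many steps are made. The levels can therefore be fixed in the order c, R,
  number of steps. The estimate sees a starting law only through its environment marginal, which may
  be any part of the law of X, and through its tail of \<open>V\<close>. Hence it applies to a
  process restricted to an event as well as to a whole one. Tightness comes from the Lyapunov series
  only while an invariant law is being constructed. A stationary process has it for free, because
  the law of Y_t does not depend on t, so uniqueness ranges over all stationary solutions.\<close>

abbreviation path_space :: "'a measure \<Rightarrow> (int \<Rightarrow> 'a) measure" where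
  "path_space S \<equiv> PiM UNIV (\<lambda>_. S)"

abbreviation env_space :: "(int \<Rightarrow> 'f::polish_space) measure" where
  "env_space \<equiv> path_space borel"

abbreviation pair_env :: "('e::polish_space \<times> (int \<Rightarrow> 'f::polish_space)) measure" where
  "pair_env \<equiv> borel \<Otimes>\<^sub>M env_space"

lemma measurable_path_shift [measurable]: "path_shift \<in> path_space S \<rightarrow>\<^sub>M path_space S"
  unfolding path_shift_def
  by (rule measurable_PiM_single', rule measurable_component_singleton) (auto simp: space_PiM PiE_iff)

lemma space_env_space [simp]: "space env_space = UNIV"
  by (simp add: space_PiM)

lemma space_pair_env [simp]: "space pair_env = UNIV"
  by (simp add: space_pair_measure)

lemma measurable_env_const: "(\<lambda>_. c) \<in> M \<rightarrow>\<^sub>M env_space"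
  by (rule measurable_const) simp

lemma measurable_pair_const_env: "(\<lambda>y. (y, c)) \<in> borel \<rightarrow>\<^sub>M pair_env"
  by (intro measurable_Pair measurable_ident_sets measurable_env_const) simp

locale random_kernel =
  fixes P :: "'f::polish_space \<Rightarrow> 'e::polish_space \<Rightarrow> 'e measure"
  assumes prob_P: "\<And>x y. prob_space (P x y)"
    and sets_P [simp, measurable_cong]: "\<And>x y. sets (P x y) = sets borel"
    and P_meas: "\<And>A. A \<in> sets borel \<Longrightarrow>
      (\<lambda>(x, y). measure (P x y) A) \<in> borel_measurable (borel \<Otimes>\<^sub>M borel)"
begin

lemma space_P [simp]: "space (P x y) = UNIV"
  using sets_P[of x y] by (simp add: sets_eq_imp_space_eq[OF sets_P])

lemma emeasure_P: "emeasure (P x y) A = ennreal (measure (P x y) A)"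
  by (rule finite_measure.emeasure_eq_measure[OF prob_space.finite_measure[OF prob_P]])

lemma P_kernel [measurable]: "(\<lambda>z. P (snd z 0) (fst z)) \<in> pair_env \<rightarrow>\<^sub>M subprob_algebra borel"
proof (rule measurable_subprob_algebra)
  show "subprob_space (P (snd a 0) (fst a))" for a :: "'e \<times> (int \<Rightarrow> 'f)"
    using prob_P by (rule prob_space_imp_subprob_space)
  show "sets (P (snd a 0) (fst a)) = sets borel" for a :: "'e \<times> (int \<Rightarrow> 'f)" by simp
  fix A :: "'e set" assume A: "A \<in> sets borel"
  have "(\<lambda>a. case (snd a 0, fst a) of (x, y) \<Rightarrow> measure (P x y) A) \<in> borel_measurable pair_env"
    by (rule measurable_compose[OF _ P_meas[OF A]]) measurable
  then have "(\<lambda>a. ennreal (measure (P (snd a 0) (fst a)) A)) \<in> borel_measurable pair_env"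
    unfolding prod.case by (rule measurable_compose) simp
  then show "(\<lambda>a. emeasure (P (snd a 0) (fst a)) A) \<in> borel_measurable pair_env"
    unfolding emeasure_P .
qed

definition trans :: "'e \<times> (int \<Rightarrow> 'f) \<Rightarrow> ('e \<times> (int \<Rightarrow> 'f)) measure" where
  "trans z = distr (P (snd z 0) (fst z)) pair_env (\<lambda>y. (y, path_shift (snd z)))"

text \<open>Values in \<open>ennreal\<close>: the operator then acts on every measurable function,
  on \<open>V\<close> as well as on bounded ones, without an integrability side condition.\<close>

definition transop :: "('e \<times> (int \<Rightarrow> 'f) \<Rightarrow> ennreal) \<Rightarrow> 'e \<times> (int \<Rightarrow> 'f) \<Rightarrow> ennreal" where
  "transop f z = (\<integral>\<^sup>+y. f (y, path_shift (snd z)) \<partial>P (snd z 0) (fst z))"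

lemma trans_kernel [measurable]: "trans \<in> pair_env \<rightarrow>\<^sub>M subprob_algebra pair_env"
  unfolding trans_def
  by (rule measurable_distr2[OF _ P_kernel]) measurable

lemma sets_trans [simp]: "sets (trans z) = sets pair_env"
  by (simp add: trans_def)

lemma prob_trans: "prob_space (trans z)"
  unfolding trans_def by (rule prob_space.prob_space_distr[OF prob_P]) (simp add: measurable_pair_const_env cong: measurable_cong_sets)

lemma nn_integral_trans: "f \<in> borel_measurable pair_env \<Longrightarrow> (\<integral>\<^sup>+z'. f z' \<partial>trans z) = transop f z"
  unfolding trans_def transop_def
  by (subst nn_integral_distr) (simp_all add: measurable_pair_const_env cong: measurable_cong_sets)

lemma transop_measurable [measurable]:
  assumes [measurable]: "f \<in> borel_measurable pair_env"
  shows "transop f \<in> borel_measurable pair_env"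
proof -
  have "(\<lambda>z. \<integral>\<^sup>+z'. f z' \<partial>trans z) \<in> borel_measurable pair_env"
    by measurable
  then show ?thesis by (simp add: nn_integral_trans[OF assms])
qed

lemma transop_pow_measurable [measurable]:
  "f \<in> borel_measurable pair_env \<Longrightarrow> (transop ^^ n) f \<in> borel_measurable pair_env"
  by (induction n) auto

lemma transop_le_1:
  assumes "\<And>z. f z \<le> 1" shows "transop f z \<le> 1"
proof -
  have "transop f z \<le> (\<integral>\<^sup>+y. 1 \<partial>P (snd z 0) (fst z))"
    unfolding transop_def using assms by (intro nn_integral_mono)
  also have "\<dots> = 1" using prob_space.emeasure_space_1[OF prob_P] by simp
  finally show ?thesis .
qed

lemma transop_pow_le_1: "(\<And>z. f z \<le> 1) \<Longrightarrow> (transop ^^ n) f z \<le> 1"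
  by (induction n arbitrary: z) (auto intro!: transop_le_1)

lemma nn_integral_bind_trans:
  assumes "sets N = sets pair_env" and f: "f \<in> borel_measurable pair_env"
  shows "(\<integral>\<^sup>+z. f z \<partial>(N \<bind> trans)) = (\<integral>\<^sup>+z. transop f z \<partial>N)"
proof -
  have "trans \<in> N \<rightarrow>\<^sub>M subprob_algebra pair_env"
    using trans_kernel assms(1) by (simp cong: measurable_cong_sets)
  then show ?thesis
    by (simp add: nn_integral_bind[OF f] nn_integral_trans[OF f])
qed

end

section \<open>The Lyapunov series and the survival function\<close>

text \<open>The stationary solution of \<open>m (t + 1) = lam (x t) * m t + b (x t)\<close>, unrolled into the past.\<close>

definition lyap :: "('f \<Rightarrow> real) \<Rightarrow> ('f \<Rightarrow> real) \<Rightarrow> (int \<Rightarrow> 'f) \<Rightarrow> ennreal" where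
  "lyap lam b x = (\<Sum>j. ennreal (b (x (- 1 - int j)) * (\<Prod>i=1..j. lam (x (- int i)))))"

lemma lyap_measurable [measurable]:
  fixes lam :: "'f::polish_space \<Rightarrow> real"
  assumes [measurable]: "lam \<in> borel_measurable borel" "b \<in> borel_measurable borel"
  shows "lyap lam b \<in> borel_measurable env_space"
  unfolding lyap_def by measurable

text \<open>Seen from the next time, the summand j = 0 is \<open>b (x 0)\<close>, and the product in
  every later summand begins with \<open>lam (x 0)\<close>. The remaining factors are those of the
  original series.\<close>

lemma lyap_shift:
  assumes lam: "\<And>x. 0 \<le> lam x" and b: "\<And>x. 0 \<le> b x"
  shows "lyap lam b (path_shift x) = ennreal (lam (x 0)) * lyap lam b x + ennreal (b (x 0))"
proof -
  let ?g = "\<lambda>j. ennreal (b (path_shift x (- 1 - int j)) * (\<Prod>i=1..j. lam (path_shift x (- int i))))"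
  have *: "?g (Suc j) = ennreal (lam (x 0)) * ennreal (b (x (- 1 - int j)) * (\<Prod>i=1..j. lam (x (- int i))))" for j
  proof -
    have "(\<Prod>i=1..Suc j. lam (path_shift x (- int i))) = lam (x 0) * (\<Prod>i=1..j. lam (x (- int i)))"
      using prod.atLeast_Suc_atMost[of 1 "Suc j" "\<lambda>i. lam (path_shift x (- int i))"]
        prod.shift_bounds_cl_Suc_ivl[of "\<lambda>i. lam (path_shift x (- int i))" 1 j]
      by (simp add: path_shift_def del: prod.cl_ivl_Suc)
    then show ?thesis
      by (simp add: path_shift_def ennreal_mult[symmetric] lam b prod_nonneg algebra_simps)
  qed
  have "lyap lam b (path_shift x) = (\<Sum>j. ?g j)"
    by (simp add: lyap_def)
  also have "\<dots> = (\<Sum>j. ?g (Suc j)) + ?g 0"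
    using suminf_offset[of ?g 1] by (simp add: add.commute)
  also have "(\<Sum>j. ?g (Suc j)) = ennreal (lam (x 0)) * lyap lam b x"
    unfolding * lyap_def by simp
  finally show ?thesis by (simp add: path_shift_def)
qed

text \<open>The summand j = 0 alone. Together with a lower bound \<open>V y0\<close> for
  \<open>b\<close> it places \<open>V y0\<close> below the whole series.\<close>

lemma lyap_ge: "ennreal (b (x (- 1))) \<le> lyap lam b x"
proof -
  have "(\<Sum>j\<in>{0}. ennreal (b (x (- 1 - int j)) * (\<Prod>i=1..j. lam (x (- int i))))) \<le> lyap lam b x"
    unfolding lyap_def by (rule sum_le_suminf) auto
  then show ?thesis by simp
qed

text \<open>In closed form the product of 1 - h (\<theta>^i x) over i < n. The factor at the present
  environment is split off first, in step with one application of \<open>transop\<close>.\<close>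

primrec surv :: "((int \<Rightarrow> 'f) \<Rightarrow> real) \<Rightarrow> nat \<Rightarrow> (int \<Rightarrow> 'f) \<Rightarrow> real" where
  "surv h 0 x = 1"
| "surv h (Suc n) x = (1 - h x) * surv h n (path_shift x)"

lemma surv_bounds:
  assumes "\<And>x. 0 \<le> h x" "\<And>x. h x \<le> 1"
  shows "0 \<le> surv h n x \<and> surv h n x \<le> 1"
  by (induction n arbitrary: x) (auto intro!: mult_le_one simp: assms)

lemma surv_Suc_le:
  assumes "\<And>x. 0 \<le> h x" "\<And>x. h x \<le> 1"
  shows "surv h (Suc n) x \<le> surv h n x"
proof (induction n arbitrary: x)
  case 0 show ?case using assms by simp
next
  case (Suc n)
  show ?case
    using mult_left_mono[OF Suc[of "path_shift x"], of "1 - h x"] assms by simp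
qed

lemma surv_measurable [measurable]:
  "h \<in> borel_measurable env_space \<Longrightarrow> surv h n \<in> borel_measurable (env_space :: (int \<Rightarrow> 'f::polish_space) measure)"
proof (induction n)
  case 0
  have "surv h 0 = (\<lambda>_. 1)" by (rule ext) simp
  then show ?case by simp
next
  case (Suc n)
  note [measurable] = Suc.prems Suc.IH[OF Suc.prems]
  have "surv h (Suc n) = (\<lambda>x. (1 - h x) * surv h n (path_shift x))" by (rule ext) simp
  moreover have "\<dots> \<in> borel_measurable env_space" by measurable
  ultimately show ?case by simp
qed

lemma (in prob_space) integrable_bounded_by:
  fixes f :: "'a \<Rightarrow> real"
  assumes "f \<in> borel_measurable M" "\<And>x. 0 \<le> f x" "\<And>x. f x \<le> B"
  shows "integrable M f"
  using assms by (intro integrable_const_bound[of _ B]) (auto simp: abs_le_iff)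

text \<open>Telescoping only shows that \<open>h x * surv h n (path_shift x)\<close> vanishes in
  mean. Off {h < e} it may be divided by \<open>h\<close>, and invariance of \<open>L\<close>
  removes the shift. As e decreases, only the mass of {h <= 0} is left, where nothing
  contracts.\<close>

lemma expectation_surv:
  fixes L :: "(int \<Rightarrow> 'f::polish_space) measure"
  assumes "prob_space L" and sets_L: "sets L = sets env_space"
    and inv: "distr L env_space path_shift = L"
    and hm: "h \<in> borel_measurable env_space"
    and h0: "\<And>x. 0 \<le> h x" and h1: "\<And>x. h x \<le> 1"
    and "0 < \<gamma>"
  shows "\<exists>n0. \<forall>n\<ge>n0. (\<integral>x. surv h n x \<partial>L) \<le> measure L {x. h x \<le> 0} + \<gamma>"
proof -
  interpret prob_space L by fact
  note [measurable_cong] = sets_L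
  note [measurable] = hm
  have space_L [simp]: "space L = UNIV"
    using sets_eq_imp_space_eq[OF sets_L] by simp
  have sm [measurable]: "surv h n \<in> borel_measurable env_space" for n
    using hm by (rule surv_measurable)
  have sb: "0 \<le> surv h n x" "surv h n x \<le> 1" for n x
    using surv_bounds[of h n x] h0 h1 by auto
  have int_s: "integrable L (surv h n)" for n
    by (rule integrable_bounded_by[of _ 1]) (use sb in auto)
  have int_s': "integrable L (\<lambda>x. surv h n (path_shift x))" for n
    by (rule integrable_bounded_by[of _ 1]) (use sb in auto)
  have int_hs: "integrable L (\<lambda>x. h x * surv h n (path_shift x))" for n
    by (rule integrable_bounded_by[of _ 1]) (use sb h0 h1 in \<open>auto intro!: mult_le_one\<close>)
  have shift: "(\<integral>x. surv h n (path_shift x) \<partial>L) = (\<integral>x. surv h n x \<partial>L)" for n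
  proof -
    have "(\<integral>x. surv h n x \<partial>distr L env_space path_shift) = (\<integral>x. surv h n (path_shift x) \<partial>L)"
      by (rule integral_distr) measurable
    then show ?thesis by (simp add: inv)
  qed
  define s where "s n = (\<integral>x. surv h n x \<partial>L)" for n
  define A where "A n = (\<integral>x. h x * surv h n (path_shift x) \<partial>L)" for n
  have step: "s (Suc n) = s n - A n" for n
  proof -
    have "s (Suc n) = (\<integral>x. surv h n (path_shift x) - h x * surv h n (path_shift x) \<partial>L)"
      unfolding s_def by (intro Bochner_Integration.integral_cong) (simp_all add: algebra_simps)
    also have "\<dots> = s n - A n"
      by (subst Bochner_Integration.integral_diff[OF int_s' int_hs]) (simp add: shift s_def A_def)
    finally show ?thesis .
  qed
  have "decseq s"
    unfolding s_def
    by (intro decseq_SucI integral_mono int_s surv_Suc_le h0 h1)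
  moreover have "0 \<le> s n" for n
    unfolding s_def by (rule integral_nonneg_AE) (simp add: sb)
  ultimately obtain l where l: "s \<longlonglongrightarrow> l"
    using decseq_convergent[of s 0] by blast
  have "(\<lambda>n. s n - s (Suc n)) \<longlonglongrightarrow> l - l"
    by (intro tendsto_diff l LIMSEQ_Suc)
  then have A: "A \<longlonglongrightarrow> 0" by (simp add: step)
  have "(\<lambda>k. measure L {x. h x < 1 / real (Suc k)}) \<longlonglongrightarrow> measure L (\<Inter>k. {x. h x < 1 / real (Suc k)})"
  proof (rule finite_Lim_measure_decseq)
    have "{x\<in>space L. h x < 1 / real (Suc k)} \<in> events" for k by measurable
    then show "range (\<lambda>k. {x. h x < 1 / real (Suc k)}) \<subseteq> events" by auto
    show "decseq (\<lambda>k. {x. h x < 1 / real (Suc k)})"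
    proof (rule decseq_SucI, safe)
      fix k x assume "h x < 1 / real (Suc (Suc k))"
      also have "\<dots> \<le> 1 / real (Suc k)" by (simp add: frac_le)
      finally show "h x < 1 / real (Suc k)" .
    qed
  qed
  moreover have "(\<Inter>k. {x. h x < 1 / real (Suc k)}) = {x. h x \<le> 0}"
  proof (safe; rule ccontr)
    fix x assume x: "x \<in> (\<Inter>k. {x. h x < 1 / real (Suc k)})" and "\<not> h x \<le> 0"
    then obtain k where "inverse (real (Suc k)) < h x" using reals_Archimedean[of "h x"] by auto
    with x show False by (auto simp: inverse_eq_divide dest!: spec[of _ k])
  next
    fix x k assume "h x \<le> 0" "\<not> h x < 1 / real (Suc k)"
    then have "1 / real (Suc k) \<le> 0" by linarith
    moreover have "0 < 1 / real (Suc k)" by simp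
    ultimately show False by linarith
  qed
  ultimately have "(\<lambda>k. measure L {x. h x < 1 / real (Suc k)}) \<longlonglongrightarrow> measure L {x. h x \<le> 0}" by simp
  from order_tendstoD(2)[OF this, of "measure L {x. h x \<le> 0} + \<gamma> / 2"] \<open>0 < \<gamma>\<close>
  obtain k where k: "measure L {x. h x < 1 / real (Suc k)} < measure L {x. h x \<le> 0} + \<gamma> / 2"
    by (auto simp: eventually_sequentially)
  \<comment> \<open>Threshold below which \<open>h\<close> is treated as zero; the mass of {0 < h <
    e} is less than \<gamma> / 2.\<close>
  define e where "e = 1 / real (Suc k)"
  have "0 < e" by (simp add: e_def)
  have [measurable]: "{x. h x < e} \<in> events"
  proof -
    have "{x\<in>space L. h x < e} \<in> events" by measurable
    then show ?thesis by simp
  qed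
  have bound: "s n \<le> measure L {x. h x < e} + A n / e" for n
  proof -
    have "s n = (\<integral>x. surv h n (path_shift x) \<partial>L)" by (simp add: s_def shift)
    also have "\<dots> \<le> (\<integral>x. indicator {x. h x < e} x + h x * surv h n (path_shift x) / e \<partial>L)"
    proof (rule integral_mono[OF int_s'])
      show "integrable L (\<lambda>x. indicator {x. h x < e} x + h x * surv h n (path_shift x) / e)"
        by (intro Bochner_Integration.integrable_add integrable_divide_zero int_hs)
          (simp add: integrable_indicator_iff less_top[symmetric])
      fix x
      show "surv h n (path_shift x) \<le> indicator {x. h x < e} x + h x * surv h n (path_shift x) / e"
      proof (cases "h x < e")
        case True
        then show ?thesis using sb[of n "path_shift x"] h0[of x] \<open>0 < e\<close>
          by (simp add: indicator_def add_increasing2)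
      next
        case False
        then have "e * surv h n (path_shift x) \<le> h x * surv h n (path_shift x)"
          using sb[of n "path_shift x"] by (intro mult_right_mono) auto
        then show ?thesis using False \<open>0 < e\<close> by (simp add: indicator_def field_simps)
      qed
    qed
    also have "\<dots> = measure L {x. h x < e} + A n / e"
      by (subst Bochner_Integration.integral_add)
        (auto simp: A_def int_hs integrable_indicator_iff less_top[symmetric])
    finally show ?thesis .
  qed
  have "(\<lambda>n. A n / e) \<longlonglongrightarrow> 0 / e" using \<open>0 < e\<close> by (intro tendsto_divide A) auto
  then have "eventually (\<lambda>n. A n / e < \<gamma> / 2) sequentially"
    using order_tendstoD(2)[of "\<lambda>n. A n / e" 0 sequentially "\<gamma> / 2"] \<open>0 < \<gamma>\<close> by simp
  then obtain n0 where n0: "\<And>n. n \<ge> n0 \<Longrightarrow> A n / e < \<gamma> / 2"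
    by (auto simp: eventually_sequentially)
  show ?thesis
  proof (intro exI[of _ n0] allI impI)
    fix n assume "n \<ge> n0"
    from n0[OF this] bound[of n] k show "(\<integral>x. surv h n x \<partial>L) \<le> measure L {x. h x \<le> 0} + \<gamma>"
      by (simp add: s_def e_def)
  qed
qed

section \<open>One step of the transition operator\<close>

text \<open>The assumption \<open>V y0 \<le> b x\<close> costs nothing, since \<open>b\<close> may be enlarged by a constant. It puts \<open>V y0\<close>
  below the Lyapunov series, so that a chain started at \<open>y0\<close> is dominated by the series at all times.\<close>

locale drift_kernel = random_kernel P
  for P :: "'f::polish_space \<Rightarrow> 'e::polish_space \<Rightarrow> 'e measure" +
  fixes V :: "'e \<Rightarrow> real" and lam b :: "'f \<Rightarrow> real" and eta :: "real \<Rightarrow> 'f \<Rightarrow> real"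
    and L :: "(int \<Rightarrow> 'f) measure" and y0 :: 'e
  assumes V_meas [measurable]: "V \<in> borel_measurable borel" and V_pos: "\<And>y. 0 < V y"
    and lam_meas [measurable]: "lam \<in> borel_measurable borel" and lam_nn: "\<And>x. 0 \<le> lam x"
    and b_meas [measurable]: "b \<in> borel_measurable borel" and b_ge: "\<And>x. V y0 \<le> b x"
    and drift: "\<And>x y. (\<integral>\<^sup>+y'. ennreal (V y') \<partial>P x y) \<le> ennreal (lam x * V y + b x)"
    and eta_meas: "\<And>R. 0 < R \<Longrightarrow> eta R \<in> borel_measurable borel"
    and eta_range: "\<And>R x. 0 < R \<Longrightarrow> 0 < eta R x \<and> eta R x < 1"
    and minor: "\<And>R x. 0 < R \<Longrightarrow> \<exists>\<nu>. prob_space \<nu> \<and> sets \<nu> = sets borel \<and>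
      (\<forall>y A. V y \<le> R \<longrightarrow> A \<in> sets borel \<longrightarrow> eta R x * measure \<nu> A \<le> measure (P x y) A)"
    and prob_L: "prob_space L" and sets_L [simp, measurable_cong]: "sets L = sets env_space"
    and L_inv: "distr L env_space path_shift = L"
    and lyap_finite: "AE x in L. lyap lam b x < \<infinity>"
begin

sublocale L: prob_space L by (rule prob_L)

lemma space_L [simp]: "space L = UNIV"
  using sets_eq_imp_space_eq[OF sets_L] by simp

lemma measure_P_UNIV [simp]: "measure (P x y) UNIV = 1"
  using prob_space.prob_space[OF prob_P, of x y] by simp

lemma measure_L_UNIV [simp]: "measure L UNIV = 1"
  using L.prob_space by simp

lemma b_nn: "0 \<le> b x"
  using b_ge[of x] V_pos[of y0] by linarith

lemma integrable_V: "integrable (P x y) V" and integral_V_le: "(\<integral>y'. V y' \<partial>P x y) \<le> lam x * V y + b x"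
proof -
  have fin: "(\<integral>\<^sup>+y'. ennreal (V y') \<partial>P x y) < \<infinity>"
    using drift[of x y] by (rule order.strict_trans1) simp
  then show int: "integrable (P x y) V"
    using V_pos by (intro integrableI_nonneg) (auto simp: less_imp_le)
  have "ennreal (\<integral>y'. V y' \<partial>P x y) \<le> ennreal (lam x * V y + b x)"
    using drift[of x y] nn_integral_eq_integral[OF int] V_pos by (simp add: less_imp_le)
  moreover have "0 \<le> lam x * V y + b x"
    using lam_nn b_nn V_pos[of y] by (simp add: less_imp_le)
  ultimately show "(\<integral>y'. V y' \<partial>P x y) \<le> lam x * V y + b x"
    by simp
qed

lemma integrable_P_bounded:
  assumes "f \<in> borel_measurable borel" "\<And>y. 0 \<le> f y" "\<And>y. f y \<le> (B::real)"
  shows "integrable (P x y) f"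
proof -
  interpret prob_space "P x y" by (rule prob_P)
  show ?thesis using assms by (intro integrable_bounded_by[of _ B]) (simp_all cong: measurable_cong_sets)
qed

text \<open>The setwise inequality says \<open>scale_measure e \<nu> \<le> P x y\<close> in the
  order of measures, and integrals of nonnegative functions are monotone for this order.\<close>

lemma minor_integral:
  assumes "prob_space \<nu>" and sets_nu: "sets \<nu> = sets borel" and "0 \<le> e"
    and le: "\<And>A. A \<in> sets borel \<Longrightarrow> e * measure \<nu> A \<le> measure (P x y) A"
    and f: "f \<in> borel_measurable borel" "\<And>y. 0 \<le> f y" "\<And>y. f y \<le> (B::real)"
  shows "e * (\<integral>y. f y \<partial>\<nu>) \<le> (\<integral>y. f y \<partial>P x y)"
proof -
  interpret nu: prob_space \<nu> by fact
  interpret Pxy: prob_space "P x y" by (rule prob_P)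
  have fm: "f \<in> borel_measurable \<nu>" "f \<in> borel_measurable (P x y)"
    using f(1) sets_nu by (simp_all cong: measurable_cong_sets)
  have "scale_measure (ennreal e) \<nu> \<le> P x y"
    using sets_nu le \<open>0 \<le> e\<close>
    by (subst le_measure) (auto simp: nu.emeasure_eq_measure emeasure_P ennreal_mult[symmetric] intro!: ennreal_leI)
  then have "(\<integral>\<^sup>+y. ennreal (f y) \<partial>scale_measure (ennreal e) \<nu>) \<le> (\<integral>\<^sup>+y. ennreal (f y) \<partial>P x y)"
    by (intro nn_integral_mono_measure) (simp_all add: sets_nu)
  then have "ennreal e * (\<integral>\<^sup>+y. ennreal (f y) \<partial>\<nu>) \<le> (\<integral>\<^sup>+y. ennreal (f y) \<partial>P x y)"
    using fm by (subst (asm) nn_integral_scale_measure) simp_all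
  moreover have "(\<integral>\<^sup>+y. ennreal (f y) \<partial>\<nu>) = ennreal (\<integral>y. f y \<partial>\<nu>)"
    using fm f by (intro nn_integral_eq_integral nu.integrable_bounded_by[of _ B]) simp_all
  moreover have "(\<integral>\<^sup>+y. ennreal (f y) \<partial>P x y) = ennreal (\<integral>y. f y \<partial>P x y)"
    using fm f by (intro nn_integral_eq_integral Pxy.integrable_bounded_by[of _ B]) simp_all
  moreover have "0 \<le> (\<integral>y. f y \<partial>\<nu>)" "0 \<le> (\<integral>y. f y \<partial>P x y)"
    using f(2) by (simp_all add: integral_nonneg_AE)
  ultimately show ?thesis
    using \<open>0 \<le> e\<close> by (simp add: ennreal_mult[symmetric])
qed

text \<open>Up to an error that is affine in \<open>V\<close>, the function \<open>u\<close> takes values in an interval of length \<open>r\<close>.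
  By the drift condition one step of the kernel turns affine errors into affine errors.\<close>

definition almost_const :: "('e \<Rightarrow> real) \<Rightarrow> real \<Rightarrow> real \<Rightarrow> real \<Rightarrow> real \<Rightarrow> bool" where
  "almost_const u a r \<alpha> \<beta> \<longleftrightarrow>
     (\<forall>y. a - \<alpha> * V y - \<beta> \<le> u y \<and> u y \<le> a + r + \<alpha> * V y + \<beta>)"

context
  fixes u :: "'e \<Rightarrow> real" and a r \<alpha> \<beta> :: real and x :: 'f
  assumes u [measurable]: "u \<in> borel_measurable borel" and u0: "\<And>y. 0 \<le> u y" and u1: "\<And>y. u y \<le> 1"
    and "0 \<le> r" "0 \<le> \<alpha>" "0 \<le> \<beta>" and ac: "almost_const u a r \<alpha> \<beta>"
begin

text \<open>Truncation to [a, a + r] separates oscillation from error: the difference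
  \<open>u - clip\<close> is affine in \<open>V\<close> and goes through the drift condition, while
  \<open>clip\<close> varies by at most r everywhere and goes through the minorization.\<close>

definition clip :: "'e \<Rightarrow> real" where "clip y = max a (min (a + r) (u y))"

lemma clip_measurable [measurable]: "clip \<in> borel_measurable borel"
  unfolding clip_def by measurable

lemma clip_bounds: "a \<le> clip y" "clip y \<le> a + r"
  using \<open>0 \<le> r\<close> by (auto simp: clip_def)

lemma clip_abs: "\<bar>clip y\<bar> \<le> \<bar>a\<bar> + r"
  using clip_bounds[of y] \<open>0 \<le> r\<close> by (simp add: abs_le_iff) linarith

lemma clip_close: "\<bar>u y - clip y\<bar> \<le> \<alpha> * V y + \<beta>"
proof -
  have "0 \<le> \<alpha> * V y + \<beta>" using \<open>0 \<le> \<alpha>\<close> \<open>0 \<le> \<beta>\<close> V_pos[of y] by (simp add: less_imp_le)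
  with ac[unfolded almost_const_def, rule_format, of y] \<open>0 \<le> r\<close> show ?thesis
    by (auto simp: clip_def max_def min_def abs_le_iff)
qed

lemma integral_clip_close:
  "\<bar>(\<integral>y'. u y' \<partial>P x y) - (\<integral>y'. clip y' \<partial>P x y)\<bar> \<le> \<alpha> * (lam x * V y + b x) + \<beta>"
proof -
  interpret prob_space "P x y" by (rule prob_P)
  have int_u: "integrable (P x y) u" using u u0 u1 by (rule integrable_P_bounded)
  have int_c: "integrable (P x y) clip"
    by (rule integrable_const_bound[of _ "\<bar>a\<bar> + r"])
      (simp_all add: clip_abs)
  have "\<bar>(\<integral>y'. u y' \<partial>P x y) - (\<integral>y'. clip y' \<partial>P x y)\<bar> = \<bar>\<integral>y'. u y' - clip y' \<partial>P x y\<bar>"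
    by (subst Bochner_Integration.integral_diff[OF int_u int_c]) simp
  also have "\<dots> \<le> (\<integral>y'. \<bar>u y' - clip y'\<bar> \<partial>P x y)"
    by (rule integral_abs_bound)
  also have "\<dots> \<le> (\<integral>y'. \<alpha> * V y' + \<beta> \<partial>P x y)"
    by (intro integral_mono integrable_abs Bochner_Integration.integrable_diff Bochner_Integration.integrable_add
       integrable_mult_right integrable_V int_u int_c clip_close) simp
  also have "\<dots> = \<alpha> * (\<integral>y'. V y' \<partial>P x y) + \<beta>"
    by (subst Bochner_Integration.integral_add) (simp_all add: integrable_V prob_space del: sets_P)
  also have "\<dots> \<le> \<alpha> * (lam x * V y + b x) + \<beta>"
    using integral_V_le[of x y] \<open>0 \<le> \<alpha>\<close> by (intro add_right_mono mult_left_mono)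
  finally show ?thesis .
qed

lemma integral_clip_bounds: "a \<le> (\<integral>y'. clip y' \<partial>P x y)" "(\<integral>y'. clip y' \<partial>P x y) \<le> a + r"
proof -
  interpret prob_space "P x y" by (rule prob_P)
  have int_c: "integrable (P x y) clip"
    by (rule integrable_const_bound[of _ "\<bar>a\<bar> + r"])
      (simp_all add: clip_abs)
  show "a \<le> (\<integral>y'. clip y' \<partial>P x y)" "(\<integral>y'. clip y' \<partial>P x y) \<le> a + r"
    using integral_mono[OF _ int_c, of "\<lambda>_. a"] integral_mono[OF int_c, of "\<lambda>_. a + r"] clip_bounds
    by (simp_all add: prob_space)
qed

lemma almost_const_step:
  "almost_const (\<lambda>y. \<integral>y'. u y' \<partial>P x y) a r (\<alpha> * lam x) (\<alpha> * b x + \<beta>)"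
  unfolding almost_const_def
proof
  fix y
  show "a - \<alpha> * lam x * V y - (\<alpha> * b x + \<beta>) \<le> (\<integral>y'. u y' \<partial>P x y) \<and>
    (\<integral>y'. u y' \<partial>P x y) \<le> a + r + \<alpha> * lam x * V y + (\<alpha> * b x + \<beta>)"
    using integral_clip_close[of y] integral_clip_bounds[of y] by (simp add: algebra_simps abs_le_iff)
qed

text \<open>Where V <= R, the share e = \<open>eta R x\<close> of the kernel is the same for all
  starting points, so only the remaining share 1 - e can make a difference. Where V > R nothing
  contracts: the old interval sticks out of the new one by at most e * r at either end, and this is
  less than e * r / R * V. Hence the additional slope.\<close>

lemma almost_const_minor_step:
  assumes R: "0 < R"
  shows "\<exists>a'. almost_const (\<lambda>y. \<integral>y'. u y' \<partial>P x y) a' ((1 - eta R x) * r)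
    (\<alpha> * lam x + eta R x * r / R) (\<alpha> * b x + \<beta>)"
proof -
  let ?e = "eta R x"
  have e: "0 < ?e" "?e < 1" using eta_range[OF R] by auto
  obtain \<nu> where nu: "prob_space \<nu>" and sets_nu: "sets \<nu> = sets borel"
    and min: "\<And>y A. V y \<le> R \<Longrightarrow> A \<in> sets borel \<Longrightarrow> ?e * measure \<nu> A \<le> measure (P x y) A"
    using minor[OF R, of x] by blast
  interpret nu: prob_space \<nu> by (rule nu)
  have int_nu: "integrable \<nu> clip"
    by (rule nu.integrable_const_bound[of _ "\<bar>a\<bar> + r"])
      (simp_all add: clip_abs sets_nu cong: measurable_cong_sets)
  define g where "g = (\<integral>y. clip y \<partial>\<nu>)"
  have g: "a \<le> g" "g \<le> a + r"
    using integral_mono[OF _ int_nu, of "\<lambda>_. a"] integral_mono[OF int_nu, of "\<lambda>_. a + r"] clip_bounds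
    by (simp_all add: nu.prob_space g_def)
  \<comment> \<open>Lowest possible value: the common share contributes its exact mean g, the rest
    at least a.\<close>
  define a' where "a' = ?e * g + (1 - ?e) * a"
  have "a' - (\<alpha> * lam x + ?e * r / R) * V y - (\<alpha> * b x + \<beta>) \<le> (\<integral>y'. u y' \<partial>P x y) \<and>
    (\<integral>y'. u y' \<partial>P x y) \<le> a' + (1 - ?e) * r + (\<alpha> * lam x + ?e * r / R) * V y + (\<alpha> * b x + \<beta>)" for y
  proof (cases "V y \<le> R")
    case True
    interpret Pxy: prob_space "P x y" by (rule prob_P)
    have int_c: "integrable (P x y) clip"
      by (rule Pxy.integrable_const_bound[of _ "\<bar>a\<bar> + r"])
        (simp_all add: clip_abs)
    have "?e * (\<integral>y. clip y - a \<partial>\<nu>) \<le> (\<integral>y. clip y - a \<partial>P x y)"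
      using clip_bounds e
      by (intro minor_integral[OF nu sets_nu _ min[OF True], where B = r]) (auto simp: algebra_simps)
    then have 1: "a' \<le> (\<integral>y. clip y \<partial>P x y)"
      by (simp add: Bochner_Integration.integral_diff[OF int_nu] Bochner_Integration.integral_diff[OF int_c]
          nu.prob_space Pxy.prob_space a'_def g_def[symmetric] algebra_simps del: sets_P)
    have "?e * (\<integral>y. (a + r) - clip y \<partial>\<nu>) \<le> (\<integral>y. (a + r) - clip y \<partial>P x y)"
      using clip_bounds e
      by (intro minor_integral[OF nu sets_nu _ min[OF True], where B = r]) (auto simp: algebra_simps)
    then have 2: "(\<integral>y. clip y \<partial>P x y) \<le> a' + (1 - ?e) * r"
      by (simp add: Bochner_Integration.integral_diff[OF _ int_nu] Bochner_Integration.integral_diff[OF _ int_c]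
          nu.prob_space Pxy.prob_space a'_def g_def[symmetric] algebra_simps del: sets_P)
    have "0 \<le> ?e * r / R * V y"
      using e R \<open>0 \<le> r\<close> V_pos[of y] by simp
    with 1 2 integral_clip_close[of y] show ?thesis
      by (simp add: algebra_simps abs_le_iff)
  next
    case False
    have "?e * r * 1 \<le> ?e * r * (V y / R)"
      using False R e \<open>0 \<le> r\<close> by (intro mult_left_mono) auto
    moreover have "a' \<le> a + ?e * r" "a + r - ?e * r \<le> a' + (1 - ?e) * r"
      using mult_left_mono[OF g(2), of ?e] mult_left_mono[OF g(1), of ?e] e by (simp_all add: a'_def algebra_simps)
    ultimately show ?thesis
      using integral_clip_close[of y] integral_clip_bounds[of y] by (simp add: algebra_simps abs_le_iff)
  qed
  then show ?thesis unfolding almost_const_def by blast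
qed

end

end

section \<open>Quenched and annealed contraction\<close>

context drift_kernel
begin

text \<open>Real-valued copy of the iterates, because oscillation estimates subtract. No information
  is lost for functions bounded by 1.\<close>

definition transop_iter :: "('e \<times> (int \<Rightarrow> 'f) \<Rightarrow> ennreal) \<Rightarrow> nat \<Rightarrow> 'e \<times> (int \<Rightarrow> 'f) \<Rightarrow> real" where
  "transop_iter f n z = enn2real ((transop ^^ n) f z)"

lemma transop_iter_measurable [measurable]:
  assumes "f \<in> borel_measurable pair_env" shows "transop_iter f n \<in> borel_measurable pair_env"
proof -
  have "(\<lambda>z. enn2real ((transop ^^ n) f z)) \<in> borel_measurable pair_env"
    using transop_pow_measurable[OF assms, of n] by (rule borel_measurable_enn2real)
  then show ?thesis by (simp add: transop_iter_def[abs_def])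
qed

lemma transop_iter_nonneg: "0 \<le> transop_iter f n z"
  by (simp add: transop_iter_def)

lemma ennreal_transop_iter:
  assumes "\<And>z. f z \<le> 1" shows "ennreal (transop_iter f n z) = (transop ^^ n) f z"
  unfolding transop_iter_def using transop_pow_le_1[of f n z] assms
  by (intro ennreal_enn2real) (auto simp: less_top[symmetric] top_unique)

lemma transop_iter_le_1:
  assumes "\<And>z. f z \<le> 1" shows "transop_iter f n z \<le> 1"
proof -
  have "ennreal (transop_iter f n z) \<le> ennreal 1"
    using transop_pow_le_1[of f n z] assms by (simp add: ennreal_transop_iter[OF assms])
  then show ?thesis by (subst (asm) ennreal_le_iff) auto
qed

lemma transop_iter_section_measurable:
  assumes "f \<in> borel_measurable pair_env"
  shows "(\<lambda>y. transop_iter f n (y, x)) \<in> borel_measurable borel"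
  by (rule measurable_compose[OF measurable_pair_const_env transop_iter_measurable[OF assms]])

lemma transop_iter_Suc:
  assumes f: "f \<in> borel_measurable pair_env" and f1: "\<And>z. f z \<le> 1"
  shows "transop_iter f (Suc n) (y, x) = (\<integral>y'. transop_iter f n (y', path_shift x) \<partial>P (x 0) y)"
proof -
  have "(\<integral>y'. transop_iter f n (y', path_shift x) \<partial>P (x 0) y) = enn2real (\<integral>\<^sup>+y'. ennreal (transop_iter f n (y', path_shift x)) \<partial>P (x 0) y)"
    using transop_iter_section_measurable[OF f] transop_iter_nonneg
    by (intro integral_eq_nn_integral) (auto cong: measurable_cong_sets)
  moreover have "transop_iter f (Suc n) (y, x) = enn2real (\<integral>\<^sup>+y'. (transop ^^ n) f (y', path_shift x) \<partial>P (x 0) y)"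
    by (simp add: transop_iter_def transop_def)
  ultimately show ?thesis by (simp only: ennreal_transop_iter[OF f1])
qed

text \<open>The minorization is available at every environment, but the error that it creates is
  weighed by the Lyapunov series. It is used only where the series is at most c, so that this weight
  is bounded.\<close>

definition rate :: "real \<Rightarrow> real \<Rightarrow> (int \<Rightarrow> 'f) \<Rightarrow> real" where
  "rate c R x = (if lyap lam b x \<le> ennreal c then eta R (x 0) else 0)"

lemma rate_bounds: "0 < R \<Longrightarrow> 0 \<le> rate c R x" "0 < R \<Longrightarrow> rate c R x \<le> 1"
  using eta_range[of R "x 0"] by (auto simp: rate_def)

lemma rate_measurable:
  assumes "0 < R" shows "rate c R \<in> borel_measurable env_space"
proof -
  note [measurable] = eta_meas[OF assms]
  show ?thesis unfolding rate_def[abs_def] by measurable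
qed

text \<open>The error is controlled through its value at \<open>V = lyap lam b x\<close>: the recursion of the Lyapunov series
  transports this value from \<open>path_shift x\<close> to \<open>x\<close> unchanged.\<close>

lemma quenched:
  assumes f: "f \<in> borel_measurable pair_env" and f1: "\<And>z. f z \<le> 1"
    and R: "0 < R" and c: "0 \<le> c" and fin: "lyap lam b x < \<infinity>"
  shows "\<exists>a \<alpha> \<beta>. 0 \<le> \<alpha> \<and> 0 \<le> \<beta> \<and>
    \<alpha> * enn2real (lyap lam b x) + \<beta> \<le> c / R * (1 - surv (rate c R) n x) \<and>
    almost_const (\<lambda>y. transop_iter f n (y, x)) a (surv (rate c R) n x) \<alpha> \<beta>"
  using fin
proof (induction n arbitrary: x)
  case 0
  have "almost_const (\<lambda>y. transop_iter f 0 (y, x)) 0 1 0 0"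
    using transop_iter_le_1[OF f1] transop_iter_nonneg by (auto simp: almost_const_def)
  then show ?case by (intro exI[of _ 0]) simp
next
  case (Suc n)
  define r where "r = surv (rate c R) n (path_shift x)"
  define m where "m = enn2real (lyap lam b x)"
  have m: "lyap lam b x = ennreal m" "0 \<le> m"
    using Suc.prems by (simp_all add: m_def)
  have shift: "lyap lam b (path_shift x) = ennreal (lam (x 0) * m + b (x 0))"
    using m lam_nn b_nn by (simp add: lyap_shift ennreal_mult ennreal_plus)
  then have "lyap lam b (path_shift x) < \<infinity>" by simp
  from Suc.IH[OF this] obtain a \<alpha> \<beta> where nn: "0 \<le> \<alpha>" "0 \<le> \<beta>"
    and bnd: "\<alpha> * (lam (x 0) * m + b (x 0)) + \<beta> \<le> c / R * (1 - r)"
    and ac: "almost_const (\<lambda>y. transop_iter f n (y, path_shift x)) a r \<alpha> \<beta>"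
    using m lam_nn[of "x 0"] b_nn[of "x 0"] by (auto simp: shift r_def simp del: ennreal_plus)
  have r: "0 \<le> r" "r \<le> 1"
    using surv_bounds[of "rate c R" n "path_shift x"] rate_bounds[OF R] by (auto simp: r_def)
  note step = almost_const_step[OF transop_iter_section_measurable[OF f] transop_iter_nonneg transop_iter_le_1[OF f1] r(1) nn ac]
  note mstep = almost_const_minor_step[OF transop_iter_section_measurable[OF f] transop_iter_nonneg transop_iter_le_1[OF f1] r(1) nn ac R]
  show ?case
  proof (cases "m \<le> c")
    case True
    then have h: "rate c R x = eta R (x 0)" using m by (simp add: rate_def ennreal_leI)
    obtain a' where a': "almost_const (\<lambda>y. transop_iter f (Suc n) (y, x)) a' (surv (rate c R) (Suc n) x)
      (\<alpha> * lam (x 0) + eta R (x 0) * r / R) (\<alpha> * b (x 0) + \<beta>)"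
      using mstep[of "x 0"] by (auto simp: transop_iter_Suc[OF f f1] h r_def)
    \<comment> \<open>\<open>eta R (x 0) * r\<close> is exactly the amount by which
      \<open>surv\<close> falls in this step, so the new error fits into the growth of
      \<open>c / R * (1 - surv)\<close>.\<close>
    have "eta R (x 0) * r / R * m \<le> eta R (x 0) * r / R * c"
      using True r R eta_range[OF R, of "x 0"] by (intro mult_left_mono) auto
    then have "(\<alpha> * lam (x 0) + eta R (x 0) * r / R) * m + (\<alpha> * b (x 0) + \<beta>)
        \<le> c / R * (1 - r) + eta R (x 0) * r / R * c"
      using bnd by (simp add: algebra_simps)
    also have "\<dots> = c / R * (1 - surv (rate c R) (Suc n) x)"
      using R by (simp add: h r_def[symmetric] field_simps)
    finally show ?thesis
      using a' nn r R lam_nn[of "x 0"] b_nn[of "x 0"] eta_range[OF R, of "x 0"]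
      by (intro exI[of _ a'] exI[of _ "\<alpha> * lam (x 0) + eta R (x 0) * r / R"] exI[of _ "\<alpha> * b (x 0) + \<beta>"])
         (simp add: m_def)
  next
    case False
    then have h: "rate c R x = 0" using m c by (simp add: rate_def)
    have "almost_const (\<lambda>y. transop_iter f (Suc n) (y, x)) a (surv (rate c R) (Suc n) x) (\<alpha> * lam (x 0)) (\<alpha> * b (x 0) + \<beta>)"
      using step[of "x 0"] by (simp add: transop_iter_Suc[OF f f1] h r_def)
    then show ?thesis
      using bnd nn lam_nn[of "x 0"] b_nn[of "x 0"]
      by (intro exI[of _ a] exI[of _ "\<alpha> * lam (x 0)"] exI[of _ "\<alpha> * b (x 0) + \<beta>"])
         (simp add: m_def[symmetric] h r_def[symmetric] algebra_simps)
  qed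
qed

text \<open>For K >= 1 a nonnegative affine error is, at all points with V at most K times the
  series, no larger than K times its value at the series. Since \<open>V y0\<close> lies below the
  series, both \<open>y\<close> and \<open>y0\<close> are such points, and each contributes K * c /
  R.\<close>

lemma quenched_diff:
  assumes f: "f \<in> borel_measurable pair_env" and f1: "\<And>z. f z \<le> 1"
    and R: "0 < R" and c: "0 \<le> c" and K: "1 \<le> K" and fin: "lyap lam b x < \<infinity>"
    and Vy: "V y \<le> K * V y0"
  shows "\<bar>transop_iter f n (y, x) - transop_iter f n (y0, x)\<bar> \<le> surv (rate c R) n x + 2 * K * c / R"
proof -
  define m where "m = enn2real (lyap lam b x)"
  have m: "lyap lam b x = ennreal m" "0 \<le> m"
    using fin by (simp_all add: m_def)
  have "ennreal (V y0) \<le> ennreal m"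
    using order_trans[OF ennreal_leI[OF b_ge] lyap_ge[of b x lam]] m by simp
  then have y0m: "V y0 \<le> m" using m by simp
  obtain a \<alpha> \<beta> where nn: "0 \<le> \<alpha>" "0 \<le> \<beta>"
    and bnd: "\<alpha> * m + \<beta> \<le> c / R * (1 - surv (rate c R) n x)"
    and ac: "almost_const (\<lambda>y. transop_iter f n (y, x)) a (surv (rate c R) n x) \<alpha> \<beta>"
    using quenched[OF f f1 R c fin, of n] by (auto simp: m_def)
  have s: "0 \<le> surv (rate c R) n x"
    using surv_bounds[of "rate c R" n x] rate_bounds[OF R] by auto
  then have "c / R * (1 - surv (rate c R) n x) \<le> c / R * 1"
    using c R by (intro mult_left_mono) auto
  with bnd have mb: "\<alpha> * m + \<beta> \<le> c / R" by simp
  have bd: "\<alpha> * V y' + \<beta> \<le> K * c / R" if "V y' \<le> K * V y0" for y'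
  proof -
    have "V y' \<le> K * m" using that mult_left_mono[OF y0m, of K] K by linarith
    then have "\<alpha> * V y' + \<beta> \<le> \<alpha> * (K * m) + K * \<beta>"
      using nn K mult_right_mono[OF K, of \<beta>] by (intro add_mono mult_left_mono) auto
    also have "\<dots> \<le> K * (c / R)"
      using mult_left_mono[OF mb, of K] K by (simp add: algebra_simps)
    finally show ?thesis by simp
  qed
  have "V y0 \<le> K * V y0" using mult_right_mono[OF K, of "V y0"] V_pos[of y0] by simp
  from bd[OF this] bd[OF Vy] ac[unfolded almost_const_def, rule_format, of y]
    ac[unfolded almost_const_def, rule_format, of y0]
  show ?thesis by (simp add: abs_le_iff)
qed

text \<open>Domination in place of equality admits a chain restricted to an event, whose environment
  marginal is only a part of \<open>L\<close>. Such measures have mass at most 1.\<close>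

definition env_dominated :: "('e \<times> (int \<Rightarrow> 'f)) measure \<Rightarrow> bool" where
  "env_dominated \<rho> \<longleftrightarrow> sets \<rho> = sets pair_env \<and>
     (\<forall>B\<in>sets env_space. emeasure \<rho> (UNIV \<times> B) \<le> emeasure L B)"

lemma env_dominated_finite: assumes "env_dominated \<rho>" shows "finite_measure \<rho>" "measure \<rho> UNIV \<le> 1" "space \<rho> = UNIV"
proof -
  have s: "sets \<rho> = sets pair_env" using assms by (simp add: env_dominated_def)
  show sp: "space \<rho> = UNIV" using sets_eq_imp_space_eq[OF s] by simp
  have "emeasure \<rho> (UNIV \<times> UNIV) \<le> emeasure L UNIV"
    using assms sets.top[of L] by (simp add: env_dominated_def del: UNIV_Times_UNIV)
  then have *: "emeasure \<rho> UNIV \<le> 1" using L.emeasure_space_1 by simp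
  then show fm: "finite_measure \<rho>"
    by (intro finite_measureI) (auto simp: sp top_unique)
  show "measure \<rho> UNIV \<le> 1"
    using * finite_measure.emeasure_eq_measure[OF fm, of UNIV] by simp
qed

lemma env_dominated_nn_integral:
  assumes "env_dominated \<rho>" and g: "g \<in> borel_measurable env_space"
  shows "(\<integral>\<^sup>+z. g (snd z) \<partial>\<rho>) \<le> (\<integral>\<^sup>+x. g x \<partial>L)"
proof -
  have s: "sets \<rho> = sets pair_env" using assms by (simp add: env_dominated_def)
  note [measurable_cong] = s
  have sp: "space \<rho> = UNIV" by (rule env_dominated_finite[OF assms(1)])
  have "distr \<rho> env_space snd \<le> L"
  proof (subst le_measure, simp, safe)
    fix A assume "A \<in> sets (distr \<rho> env_space snd)"
    then have A: "A \<in> sets env_space" by simp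
    have "emeasure (distr \<rho> env_space snd) A = emeasure \<rho> (snd -` A \<inter> space \<rho>)"
      using A by (intro emeasure_distr) measurable
    also have "snd -` A \<inter> space \<rho> = UNIV \<times> A" by (auto simp: sp)
    finally show "emeasure (distr \<rho> env_space snd) A \<le> emeasure L A"
      using assms(1) A by (simp add: env_dominated_def)
  qed
  then have "(\<integral>\<^sup>+x. g x \<partial>distr \<rho> env_space snd) \<le> (\<integral>\<^sup>+x. g x \<partial>L)"
    by (intro nn_integral_mono_measure) simp_all
  moreover have "(\<integral>\<^sup>+x. g x \<partial>distr \<rho> env_space snd) = (\<integral>\<^sup>+z. g (snd z) \<partial>\<rho>)"
    using g by (intro nn_integral_distr) measurable
  ultimately show ?thesis by simp
qed

lemma level_measure_tendsto: "(\<lambda>k. measure L {x. \<not> lyap lam b x \<le> ennreal (real k)}) \<longlonglongrightarrow> 0"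
proof -
  have m: "{x. \<not> lyap lam b x \<le> ennreal (real k)} \<in> L.events" for k
  proof -
    have "{x\<in>space L. \<not> lyap lam b x \<le> ennreal (real k)} \<in> L.events" by measurable
    then show ?thesis by simp
  qed
  have "(\<lambda>k. measure L {x. \<not> lyap lam b x \<le> ennreal (real k)}) \<longlonglongrightarrow>
      measure L (\<Inter>k. {x. \<not> lyap lam b x \<le> ennreal (real k)})"
  proof (rule L.finite_Lim_measure_decseq)
    show "range (\<lambda>k. {x. \<not> lyap lam b x \<le> ennreal (real k)}) \<subseteq> L.events" using m by auto
    show "decseq (\<lambda>k. {x. \<not> lyap lam b x \<le> ennreal (real k)})"
    proof (intro decseq_SucI Collect_mono impI, erule contrapos_nn)
      fix k x assume "lyap lam b x \<le> ennreal (real k)"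
      moreover have "ennreal (real k) \<le> ennreal (real (Suc k))" by (intro ennreal_leI) simp
      ultimately show "lyap lam b x \<le> ennreal (real (Suc k))" by (rule order_trans)
    qed
  qed
  also have "(\<Inter>k. {x. \<not> lyap lam b x \<le> ennreal (real k)}) = {x. lyap lam b x = \<infinity>}"
  proof (safe; rule ccontr)
    fix x assume x: "x \<in> (\<Inter>k. {x. \<not> lyap lam b x \<le> ennreal (real k)})" and "lyap lam b x \<noteq> \<infinity>"
    then obtain m where "lyap lam b x = ennreal m" "0 \<le> m"
      by (cases "lyap lam b x") auto
    moreover obtain k where "m \<le> real k" using real_arch_simple by blast
    ultimately have "lyap lam b x \<le> ennreal (real k)" by (simp add: ennreal_leI)
    with x show False by auto
  next
    fix x k assume "lyap lam b x = \<infinity>" "lyap lam b x \<le> ennreal (real k)"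
    then show False by (simp add: top_unique)
  qed
  also have "measure L {x. lyap lam b x = \<infinity>} = 0"
  proof -
    have "AE x in L. x \<notin> {x. lyap lam b x = \<infinity>}" using lyap_finite by auto
    then show ?thesis using L.prob_eq_0[of "{x. lyap lam b x = \<infinity>}"]
      by (cases "{x. lyap lam b x = \<infinity>} \<in> L.events") (auto simp: measure_notin_sets)
  qed
  finally show ?thesis .
qed

text \<open>Two radii are at work: \<open>R\<close> cuts the tail of \<rho>, while the minorization
  is used at a much larger level \<open>R'\<close> that is chosen after \<open>K\<close> and
  \<open>c\<close>. One third of \<gamma> each covers the environments above level \<open>c\<close>,
  the product of contraction factors, and the accumulated error. None of these choices looks at
  \<rho> or \<open>f\<close>, so \<open>n0\<close> precedes both.\<close>

lemma contraction:
  assumes "0 < \<gamma>"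
  shows "\<exists>n0. \<forall>n\<ge>n0. \<forall>\<rho> f. env_dominated \<rho> \<longrightarrow> f \<in> borel_measurable pair_env \<longrightarrow> (\<forall>z. f z \<le> 1) \<longrightarrow>
    \<bar>(\<integral>z. transop_iter f n z \<partial>\<rho>) - (\<integral>z. transop_iter f n (y0, snd z) \<partial>\<rho>)\<bar> \<le> measure \<rho> {z. R < V (fst z)} + \<gamma>"
proof -
  \<comment> \<open>Expresses V y <= R as a multiple of \<open>V y0\<close>, the form that
    \<open>quenched_diff\<close> expects.\<close>
  define K where "K = max 1 (R / V y0)"
  have K: "1 \<le> K" "R \<le> K * V y0"
    using V_pos[of y0] by (auto simp: K_def max_def field_simps)
  have "eventually (\<lambda>k. measure L {x. \<not> lyap lam b x \<le> ennreal (real k)} < \<gamma> / 3) sequentially"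
    using order_tendstoD(2)[OF level_measure_tendsto, of "\<gamma> / 3"] assms by simp
  then obtain c where c: "measure L {x. \<not> lyap lam b x \<le> ennreal (real c)} < \<gamma> / 3"
    by (auto simp: eventually_sequentially)
  \<comment> \<open>Solves 2 * K * c / R' <= \<gamma> / 3; the \<open>+ 1\<close> keeps
    \<open>R'\<close> positive when c = 0.\<close>
  define R' where "R' = 6 * K * (real c + 1) / \<gamma>"
  have R': "0 < R'" using K assms by (simp add: R'_def)
  have "2 * K * real c / R' = (\<gamma> / 3) * (real c / (real c + 1))"
    using K assms by (simp add: R'_def divide_simps)
  also have "\<dots> \<le> (\<gamma> / 3) * 1" using assms by (intro mult_left_mono) auto
  finally have tail: "2 * K * real c / R' \<le> \<gamma> / 3" by simp
  let ?s = "surv (rate (real c) R')"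
  have sm: "?s n \<in> borel_measurable env_space" for n
    by (rule surv_measurable[OF rate_measurable[OF R']])
  have sb: "0 \<le> ?s n x" "?s n x \<le> 1" for n x
    using surv_bounds[of "rate (real c) R'" n x] rate_bounds[OF R'] by auto
  have le0: "{x. rate (real c) R' x \<le> 0} = {x. \<not> lyap lam b x \<le> ennreal (real c)}"
  proof (intro Collect_cong)
    show "rate (real c) R' x \<le> 0 \<longleftrightarrow> \<not> lyap lam b x \<le> ennreal (real c)" for x
      using eta_range[OF R', of "x 0"] by (simp add: rate_def)
  qed
  obtain n0 where n0: "\<And>n. n \<ge> n0 \<Longrightarrow>
      (\<integral>x. ?s n x \<partial>L) \<le> measure L {x. rate (real c) R' x \<le> 0} + \<gamma> / 3"
    using expectation_surv[OF prob_L sets_L L_inv rate_measurable[OF R'] rate_bounds[OF R'], of "\<gamma> / 3" "real c"]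
      assms by auto
  show ?thesis
  proof (intro exI[of _ n0] allI impI)
    fix n :: nat and \<rho> and f :: "'e \<times> (int \<Rightarrow> 'f) \<Rightarrow> ennreal"
    assume n: "n0 \<le> n" and rho: "env_dominated \<rho>" and f: "f \<in> borel_measurable pair_env"
      and f1: "\<forall>z. f z \<le> 1"
    note f1' = f1[rule_format]
    have s: "sets \<rho> = sets pair_env" using rho by (simp add: env_dominated_def)
    note [measurable_cong] = s
    note [measurable] = f sm
    interpret rho: finite_measure \<rho> by (rule env_dominated_finite[OF rho])
    have sp [simp]: "space \<rho> = UNIV" by (rule env_dominated_finite[OF rho])
    have m0: "(\<lambda>z. transop_iter f n (y0, snd z)) \<in> borel_measurable \<rho>"
    proof (rule measurable_compose[OF _ transop_iter_measurable[OF f]])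
      show "(\<lambda>z. (y0, snd z)) \<in> \<rho> \<rightarrow>\<^sub>M pair_env" by measurable
    qed
    have i1: "integrable \<rho> (transop_iter f n)"
      by (rule rho.integrable_const_bound[of _ 1]) (use transop_iter_le_1[of f, OF f1'] transop_iter_nonneg in auto)
    have i0: "integrable \<rho> (\<lambda>z. transop_iter f n (y0, snd z))"
      by (rule rho.integrable_const_bound[of _ 1]) (use m0 transop_iter_le_1[of f, OF f1'] transop_iter_nonneg in auto)
    let ?d = "\<lambda>z. \<bar>transop_iter f n z - transop_iter f n (y0, snd z)\<bar>"
    have V: "{z. R < V (fst z)} \<in> sets \<rho>"
    proof -
      have "{z\<in>space \<rho>. R < V (fst z)} \<in> sets \<rho>" by measurable
      then show ?thesis by simp
    qed
    let ?I = "indicator {x. lyap lam b x = \<infinity>} :: (int \<Rightarrow> 'f) \<Rightarrow> ennreal"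
    have I: "{x. lyap lam b x = \<infinity>} \<in> sets env_space"
    proof -
      have "{x\<in>space env_space. lyap lam b x = \<infinity>} \<in> sets env_space" by measurable
      then show ?thesis by simp
    qed
    have pt: "ennreal (?d z) \<le> indicator {z. R < V (fst z)} z + ?I (snd z) + ennreal (?s n (snd z)) + ennreal (\<gamma> / 3)" for z
    proof (cases "R < V (fst z) \<or> lyap lam b (snd z) = \<infinity>")
      case True
      have "?d z \<le> 1"
        using transop_iter_le_1[of f n z, OF f1'] transop_iter_nonneg[of f n z]
          transop_iter_le_1[of f n "(y0, snd z)", OF f1'] transop_iter_nonneg[of f n "(y0, snd z)"]
        by (simp add: abs_le_iff)
      then have "ennreal (?d z) \<le> 1" by simp
      also have "1 \<le> indicator {z. R < V (fst z)} z + ?I (snd z)"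
        using True by (auto simp: indicator_def)
      also have "\<dots> \<le> \<dots> + (ennreal (?s n (snd z)) + ennreal (\<gamma> / 3))"
        by (rule add_increasing2) simp_all
      finally show ?thesis by (simp only: add.assoc)
    next
      case False
      then have "?d z \<le> ?s n (snd z) + 2 * K * real c / R'"
        using quenched_diff[OF f f1' R', where x = "snd z" and y = "fst z" and K = K and n = n and c = "real c"] K
        by (auto simp: less_top[symmetric])
      also have "\<dots> \<le> ?s n (snd z) + \<gamma> / 3" using tail by simp
      finally have "ennreal (?d z) \<le> ennreal (?s n (snd z)) + ennreal (\<gamma> / 3)"
        using sb[of n "snd z"] assms by (simp add: ennreal_plus[symmetric] ennreal_leI del: ennreal_plus)
      then show ?thesis by (simp add: add_increasing add.assoc)
    qed
    have "ennreal \<bar>(\<integral>z. transop_iter f n z \<partial>\<rho>) - (\<integral>z. transop_iter f n (y0, snd z) \<partial>\<rho>)\<bar> =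
        ennreal \<bar>\<integral>z. transop_iter f n z - transop_iter f n (y0, snd z) \<partial>\<rho>\<bar>"
      by (simp add: Bochner_Integration.integral_diff[OF i1 i0])
    also have "\<dots> \<le> ennreal (\<integral>z. ?d z \<partial>\<rho>)"
      by (intro ennreal_leI integral_abs_bound)
    also have "\<dots> = (\<integral>\<^sup>+z. ennreal (?d z) \<partial>\<rho>)"
      by (intro nn_integral_eq_integral[symmetric] integrable_abs Bochner_Integration.integrable_diff i1 i0) simp
    also have "\<dots> \<le> (\<integral>\<^sup>+z. indicator {z. R < V (fst z)} z + ?I (snd z) + ennreal (?s n (snd z)) + ennreal (\<gamma> / 3) \<partial>\<rho>)"
      by (intro nn_integral_mono pt)
    also have "\<dots> = emeasure \<rho> {z. R < V (fst z)} + (\<integral>\<^sup>+z. ?I (snd z) \<partial>\<rho>) + (\<integral>\<^sup>+z. ennreal (?s n (snd z)) \<partial>\<rho>)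
        + ennreal (\<gamma> / 3) * emeasure \<rho> UNIV"
      using V I by (simp add: nn_integral_add)
    also have "\<dots> \<le> ennreal (measure \<rho> {z. R < V (fst z)}) + 0 + ennreal (2 * \<gamma> / 3) + ennreal (\<gamma> / 3)"
    proof (intro add_mono)
      show "emeasure \<rho> {z. R < V (fst z)} \<le> ennreal (measure \<rho> {z. R < V (fst z)})"
        by (simp add: rho.emeasure_eq_measure)
      have "(\<integral>\<^sup>+z. ?I (snd z) \<partial>\<rho>) \<le> (\<integral>\<^sup>+x. ?I x \<partial>L)"
        using I by (intro env_dominated_nn_integral[OF rho]) simp
      also have "\<dots> = emeasure L {x. lyap lam b x = \<infinity>}" using I by simp
      also have "\<dots> = 0"
        using lyap_finite I AE_iff_measurable[of "{x. lyap lam b x = \<infinity>}" L "\<lambda>x. lyap lam b x < \<infinity>"]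
        by (auto simp: less_top[symmetric])
      finally show "(\<integral>\<^sup>+z. ?I (snd z) \<partial>\<rho>) \<le> 0" by simp
      have "(\<integral>\<^sup>+z. ennreal (?s n (snd z)) \<partial>\<rho>) \<le> (\<integral>\<^sup>+x. ennreal (?s n x) \<partial>L)"
        by (intro env_dominated_nn_integral[OF rho]) measurable
      also have "\<dots> = ennreal (\<integral>x. ?s n x \<partial>L)"
        by (intro nn_integral_eq_integral L.integrable_bounded_by[of _ 1]) (simp_all add: sb)
      also have "\<dots> \<le> ennreal (2 * \<gamma> / 3)"
        using n0[OF n] c by (intro ennreal_leI) (simp add: le0)
      finally show "(\<integral>\<^sup>+z. ennreal (?s n (snd z)) \<partial>\<rho>) \<le> ennreal (2 * \<gamma> / 3)" .
      have "ennreal (\<gamma> / 3) * emeasure \<rho> UNIV \<le> ennreal (\<gamma> / 3) * 1"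
        using env_dominated_finite(2)[OF rho] by (intro mult_left_mono) (simp_all add: rho.emeasure_eq_measure)
      then show "ennreal (\<gamma> / 3) * emeasure \<rho> UNIV \<le> ennreal (\<gamma> / 3)" by simp
    qed
    also have "\<dots> = ennreal (measure \<rho> {z. R < V (fst z)} + \<gamma>)"
      using assms by (simp add: ennreal_plus[symmetric] add.assoc del: ennreal_plus)
    finally show "\<bar>(\<integral>z. transop_iter f n z \<partial>\<rho>) - (\<integral>z. transop_iter f n (y0, snd z) \<partial>\<rho>)\<bar> \<le> measure \<rho> {z. R < V (fst z)} + \<gamma>"
      using assms by (subst (asm) ennreal_le_iff) auto
  qed
qed

end

section \<open>The invariant law\<close>

text \<open>Because the convergence is uniform over the sets, the limit is close to one fixed
  \<open>\<mu> n\<close> on all of them and inherits from it continuity at the empty set, which is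
  what turns additivity into countable additivity.\<close>

lemma uniform_cauchy_measure_limit:
  fixes \<mu> :: "nat \<Rightarrow> 'a measure"
  assumes prob: "\<And>n. prob_space (\<mu> n)" and sets: "\<And>n. sets (\<mu> n) = sets N"
    and cauchy: "\<And>\<gamma>. 0 < \<gamma> \<Longrightarrow> \<exists>n0. \<forall>n\<ge>n0. \<forall>m\<ge>n. \<forall>C\<in>sets N. \<bar>measure (\<mu> m) C - measure (\<mu> n) C\<bar> \<le> \<gamma>"
  shows "\<exists>\<nu>. prob_space \<nu> \<and> sets \<nu> = sets N \<and> (\<forall>C\<in>sets N. (\<lambda>n. measure (\<mu> n) C) \<longlonglongrightarrow> measure \<nu> C)"
proof -
  interpret mu: prob_space "\<mu> n" for n by (rule prob)
  have space: "space (\<mu> n) = space N" for n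
    using sets_eq_imp_space_eq[OF sets] .
  define l where "l C = lim (\<lambda>n. measure (\<mu> n) C)" for C
  have conv: "(\<lambda>n. measure (\<mu> n) C) \<longlonglongrightarrow> l C" if C: "C \<in> sets N" for C
  proof -
    have "Cauchy (\<lambda>n. measure (\<mu> n) C)"
    proof (rule metric_CauchyI)
      fix e :: real assume "0 < e"
      then have "0 < e / 2" by simp
      from cauchy[OF this] obtain n0 where n0: "\<And>n m. n \<ge> n0 \<Longrightarrow> m \<ge> n \<Longrightarrow> \<bar>measure (\<mu> m) C - measure (\<mu> n) C\<bar> \<le> e / 2"
        using C by blast
      have "dist (measure (\<mu> m) C) (measure (\<mu> n) C) < e" if "m \<ge> n0" "n \<ge> n0" for m n
        using n0[of n m] n0[of m n] that \<open>0 < e\<close> by (cases "n \<le> m") (auto simp: dist_real_def abs_minus_commute)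
      then show "\<exists>M. \<forall>m\<ge>M. \<forall>n\<ge>M. dist (measure (\<mu> m) C) (measure (\<mu> n) C) < e" by blast
    qed
    then show ?thesis
      unfolding l_def by (simp add: Cauchy_convergent_iff convergent_LIMSEQ_iff)
  qed
  have l_nonneg: "0 \<le> l C" if "C \<in> sets N" for C
    using conv[OF that] by (rule LIMSEQ_le_const) simp
  have l_add: "l (A \<union> B) = l A + l B" if "A \<in> sets N" "B \<in> sets N" "A \<inter> B = {}" for A B
  proof (rule LIMSEQ_unique)
    show "(\<lambda>n. measure (\<mu> n) (A \<union> B)) \<longlonglongrightarrow> l (A \<union> B)" using that by (intro conv) auto
    have "(\<lambda>n. measure (\<mu> n) A + measure (\<mu> n) B) \<longlonglongrightarrow> l A + l B" using that by (intro tendsto_add conv)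
    moreover have "measure (\<mu> n) (A \<union> B) = measure (\<mu> n) A + measure (\<mu> n) B" for n
      using that sets by (intro mu.finite_measure_Union) auto
    ultimately show "(\<lambda>n. measure (\<mu> n) (A \<union> B)) \<longlonglongrightarrow> l A + l B" by simp
  qed
  have l_cont: "(\<lambda>i. l (A i)) \<longlonglongrightarrow> 0"
    if A: "range A \<subseteq> sets N" "decseq A" "(\<Inter>i. A i) = {}" for A
  proof (rule LIMSEQ_I)
    fix e :: real assume "0 < e"
    then have "0 < e / 2" by simp
    from cauchy[OF this] obtain n where n: "\<And>m C. m \<ge> n \<Longrightarrow> C \<in> sets N \<Longrightarrow> \<bar>measure (\<mu> m) C - measure (\<mu> n) C\<bar> \<le> e / 2"
      by blast
    have close: "l C \<le> measure (\<mu> n) C + e / 2" if "C \<in> sets N" for C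
    proof (rule LIMSEQ_le_const2[OF conv[OF that]])
      show "\<exists>N. \<forall>m\<ge>N. measure (\<mu> m) C \<le> measure (\<mu> n) C + e / 2"
      proof (intro exI[of _ n] allI impI)
        fix m assume "n \<le> m"
        from n[OF this that] show "measure (\<mu> m) C \<le> measure (\<mu> n) C + e / 2" by linarith
      qed
    qed
    have "(\<lambda>i. measure (\<mu> n) (A i)) \<longlonglongrightarrow> measure (\<mu> n) (\<Inter>i. A i)"
      using A sets by (intro mu.finite_Lim_measure_decseq) auto
    then have "(\<lambda>i. measure (\<mu> n) (A i)) \<longlonglongrightarrow> 0" using A by simp
    then obtain i0 where i0: "\<And>i. i \<ge> i0 \<Longrightarrow> measure (\<mu> n) (A i) < e / 2"
      using order_tendstoD(2)[of _ 0 sequentially "e / 2"] \<open>0 < e\<close> by (auto simp: eventually_sequentially)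
    have "norm (l (A i) - 0) < e" if "i \<ge> i0" for i
      using close[of "A i"] i0[OF that] l_nonneg[of "A i"] A by (auto simp: range_subsetD)
    then show "\<exists>no. \<forall>i\<ge>no. norm (l (A i) - 0) < e" by blast
  qed
  define \<nu> where "\<nu> = measure_of (space N) (sets N) (\<lambda>C. ennreal (l C))"
  have sets_nu: "sets \<nu> = sets N" by (simp add: \<nu>_def)
  have l_empty: "l {} = 0" unfolding l_def by simp
  have em: "emeasure \<nu> C = ennreal (l C)" if "C \<in> sets N" for C
  proof (rule emeasure_measure_of[OF \<nu>_def])
    show "sets N \<subseteq> Pow (space N)" by (rule sets.space_closed)
    show "C \<in> sets \<nu>" using that sets_nu by simp
    show pos: "positive (sets \<nu>) (\<lambda>C. ennreal (l C))" by (simp add: positive_def l_empty)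
    have "countably_additive (sets N) (\<lambda>C. ennreal (l C))"
    proof (rule sets.empty_continuous_imp_countably_additive)
      show "positive (sets N) (\<lambda>C. ennreal (l C))" using pos sets_nu by simp
      show "additive (sets N) (\<lambda>C. ennreal (l C))"
        by (auto simp: additive_def l_add l_nonneg ennreal_plus)
      show "(\<lambda>i. ennreal (l (A i))) \<longlonglongrightarrow> 0"
        if "range A \<subseteq> sets N" "decseq A" "(\<Inter>i. A i) = {}" for A
        using tendsto_ennrealI[OF l_cont[OF that]] by simp
    qed simp
    then show "countably_additive (sets \<nu>) (\<lambda>C. ennreal (l C))" using sets_nu by simp
  qed
  have "l (space N) = 1"
    using conv[of "space N"] mu.prob_space by (simp add: space LIMSEQ_const_iff)
  then have "prob_space \<nu>"
    using em[of "space N"] sets_eq_imp_space_eq[OF sets_nu] by (intro prob_spaceI) simp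
  moreover have "measure \<nu> C = l C" if "C \<in> sets N" for C
    using em[OF that] l_nonneg[OF that] by (simp add: measure_def)
  ultimately show ?thesis using sets_nu conv by (intro exI[of _ \<nu>]) simp
qed

text \<open>At each point the sum counts the levels j / k below u, so divided by k it is floor (k *
  u) / k, which differs from u by at most 1 / k.\<close>

lemma (in prob_space) integral_level_sets:
  fixes u :: "'a \<Rightarrow> real"
  assumes u [measurable]: "u \<in> borel_measurable M" and u0: "\<And>x. 0 \<le> u x" and u1: "\<And>x. u x \<le> 1"
    and k: "0 < k"
  shows "\<bar>(\<integral>x. u x \<partial>M) - (\<Sum>j=1..k. measure M {x\<in>space M. real j \<le> real k * u x}) / real k\<bar> \<le> 1 / real k"
proof -
  define s where "s x = (\<Sum>j=1..k. indicator {x\<in>space M. real j \<le> real k * u x} x) / real k" for x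
  have s: "s x = real_of_int \<lfloor>real k * u x\<rfloor> / real k" if "x \<in> space M" for x
  proof -
    have fl: "\<lfloor>real k * u x\<rfloor> \<le> int k"
      using mult_left_le[OF u1[of x], of "real k"] by linarith
    have nn: "0 \<le> \<lfloor>real k * u x\<rfloor>" using u0[of x] by simp
    have eq: "{1..k} \<inter> {j. real j \<le> real k * u x} = {1..nat \<lfloor>real k * u x\<rfloor>}"
      using fl nn by (auto simp: le_nat_iff le_floor_iff) linarith+
    have "(\<Sum>j=1..k. indicator {x\<in>space M. real j \<le> real k * u x} x) =
        (\<Sum>j=1..k. if real j \<le> real k * u x then 1 else (0::real))"
      using that by (intro sum.cong) (auto simp: indicator_def)
    also have "\<dots> = real (card ({1..k} \<inter> {j. real j \<le> real k * u x}))"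
      by (subst sum.If_cases) auto
    also have "\<dots> = real_of_int \<lfloor>real k * u x\<rfloor>" using nn by (subst eq) simp
    finally show ?thesis by (simp add: s_def)
  qed
  have close: "\<bar>u x - s x\<bar> \<le> 1 / real k" if "x \<in> space M" for x
  proof -
    have "u x - s x = (real k * u x - real_of_int \<lfloor>real k * u x\<rfloor>) / real k"
      using k by (simp add: s[OF that] field_simps)
    moreover have "\<bar>real k * u x - real_of_int \<lfloor>real k * u x\<rfloor>\<bar> \<le> 1"
      by linarith
    ultimately show ?thesis using k by (simp add: divide_right_mono abs_divide)
  qed
  have int_u: "integrable M u" using assms by (intro integrable_bounded_by[of _ 1]) auto
  have int_s: "integrable M s"
    unfolding s_def by (intro integrable_divide_zero Bochner_Integration.integrable_sum)
      (auto simp: integrable_indicator_iff less_top[symmetric])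
  have "(\<integral>x. s x \<partial>M) = (\<Sum>j=1..k. measure M {x\<in>space M. real j \<le> real k * u x}) / real k"
    unfolding s_def by (subst integral_divide_zero, subst Bochner_Integration.integral_sum)
      (auto simp: integrable_indicator_iff less_top[symmetric] intro!: sum.cong arg_cong2[where f="(/)"] arg_cong[where f=prob])
  then have "\<bar>(\<integral>x. u x \<partial>M) - (\<Sum>j=1..k. measure M {x\<in>space M. real j \<le> real k * u x}) / real k\<bar> = \<bar>\<integral>x. u x - s x \<partial>M\<bar>"
    by (simp add: Bochner_Integration.integral_diff[OF int_u int_s])
  also have "\<dots> \<le> (\<integral>x. \<bar>u x - s x\<bar> \<partial>M)" by (rule integral_abs_bound)
  also have "\<dots> \<le> (\<integral>x. 1 / real k \<partial>M)"
    using close by (intro integral_mono integrable_abs Bochner_Integration.integrable_diff int_u int_s) auto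
  finally show ?thesis by (simp add: prob_space)
qed

text \<open>Level sets reduce the integral to finitely many measures of sets, with an error 1 / k
  that is the same for all n and for the limit.\<close>

lemma setwise_tendsto_integral:
  fixes u :: "'a \<Rightarrow> real"
  assumes prob: "\<And>n. prob_space (\<mu> n)" "prob_space \<nu>"
    and sets: "\<And>n. sets (\<mu> n) = sets N" "sets \<nu> = sets N"
    and conv: "\<And>C. C \<in> sets N \<Longrightarrow> (\<lambda>n. measure (\<mu> n) C) \<longlonglongrightarrow> measure \<nu> C"
    and u: "u \<in> borel_measurable N" and u0: "\<And>x. 0 \<le> u x" and u1: "\<And>x. u x \<le> 1"
  shows "(\<lambda>n. \<integral>x. u x \<partial>\<mu> n) \<longlonglongrightarrow> (\<integral>x. u x \<partial>\<nu>)"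
proof (rule LIMSEQ_I)
  fix e :: real assume e: "0 < e"
  obtain k where k: "3 / e < real k" using reals_Archimedean2 by blast
  then have k0: "0 < k" using e by (cases k) (auto simp: field_simps)
  then have ke: "1 / real k < e / 3" using k e by (simp add: field_simps)
  define S where "S \<rho> = (\<Sum>j=1..k. measure \<rho> {x\<in>space N. real j \<le> real k * u x}) / real k" for \<rho>
  have um: "u \<in> borel_measurable (\<mu> n)" "u \<in> borel_measurable \<nu>" for n
    using u sets by (simp_all cong: measurable_cong_sets)
  have sp: "space (\<mu> n) = space N" "space \<nu> = space N" for n
    using sets_eq_imp_space_eq[OF sets(1)] sets_eq_imp_space_eq[OF sets(2)] by auto
  have c: "\<bar>(\<integral>x. u x \<partial>\<mu> n) - S (\<mu> n)\<bar> \<le> 1 / real k" "\<bar>(\<integral>x. u x \<partial>\<nu>) - S \<nu>\<bar> \<le> 1 / real k" for n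
    using prob_space.integral_level_sets[OF prob(1) um(1) u0 u1 k0, of n]
      prob_space.integral_level_sets[OF prob(2) um(2) u0 u1 k0]
    by (simp_all add: S_def sp)
  have "{x\<in>space N. real j \<le> real k * u x} \<in> sets N" for j
    using u by measurable
  then have "(\<lambda>n. S (\<mu> n)) \<longlonglongrightarrow> S \<nu>"
    unfolding S_def using k0 by (intro tendsto_divide tendsto_sum conv tendsto_const) auto
  then obtain n0 where n0: "\<And>n. n \<ge> n0 \<Longrightarrow> \<bar>S (\<mu> n) - S \<nu>\<bar> < e / 3"
    using LIMSEQ_D[of "\<lambda>n. S (\<mu> n)" "S \<nu>" "e / 3"] e by (auto simp: real_norm_def)
  have "norm ((\<integral>x. u x \<partial>\<mu> n) - (\<integral>x. u x \<partial>\<nu>)) < e" if "n \<ge> n0" for n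
    using c(1)[of n] c(2) n0[OF that] ke unfolding real_norm_def by linarith
  then show "\<exists>no. \<forall>n\<ge>no. norm ((\<integral>x. u x \<partial>\<mu> n) - (\<integral>x. u x \<partial>\<nu>)) < e" by blast
qed

section \<open>The chain started at a fixed point and its limit law\<close>

context drift_kernel
begin

text \<open>As \<open>L\<close> is shift-invariant, this is also the law at time 0 of a chain that
  left \<open>y0\<close> at time -n. Increasing n moves the start into the remote past, which is why
  a limit can be expected.\<close>

primrec start_law :: "nat \<Rightarrow> ('e \<times> (int \<Rightarrow> 'f)) measure" where
  "start_law 0 = distr L pair_env (\<lambda>x. (y0, x))"
| "start_law (Suc n) = start_law n \<bind> trans"

lemma start_0_measurable: "(\<lambda>x. (y0, x)) \<in> L \<rightarrow>\<^sub>M pair_env"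
  by measurable

lemma prob_bind_trans:
  assumes "prob_space \<mu>" and s: "sets \<mu> = sets pair_env"
  shows "prob_space (\<mu> \<bind> trans)" "sets (\<mu> \<bind> trans) = sets pair_env"
proof -
  interpret mu: prob_space \<mu> by fact
  have "trans \<in> \<mu> \<rightarrow>\<^sub>M subprob_algebra pair_env"
    using trans_kernel s by (simp cong: measurable_cong_sets)
  then show "prob_space (\<mu> \<bind> trans)"
    by (intro mu.prob_space_bind) (auto simp: prob_trans)
  show "sets (\<mu> \<bind> trans) = sets pair_env"
    using mu.not_empty by (intro sets_bind) simp_all
qed

lemma start_law_prob: "prob_space (start_law n) \<and> sets (start_law n) = sets pair_env"
proof (induction n)
  case 0
  show ?case using L.prob_space_distr[OF start_0_measurable] by simp
next
  case (Suc n)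
  then show ?case using prob_bind_trans[of "start_law n"] by simp
qed

lemma start_law_space: "space (start_law n) = UNIV"
  using start_law_prob[of n] sets_eq_imp_space_eq[of "start_law n" pair_env] by simp

lemma nn_integral_start_law_add:
  "f \<in> borel_measurable pair_env \<Longrightarrow>
    (\<integral>\<^sup>+z. f z \<partial>start_law (m + n)) = (\<integral>\<^sup>+z. (transop ^^ n) f z \<partial>start_law m)"
proof (induction n arbitrary: f)
  case (Suc n)
  have "(\<integral>\<^sup>+z. f z \<partial>start_law (m + Suc n)) = (\<integral>\<^sup>+z. transop f z \<partial>start_law (m + n))"
    using start_law_prob Suc.prems by (simp add: nn_integral_bind_trans)
  also have "\<dots> = (\<integral>\<^sup>+z. (transop ^^ n) (transop f) z \<partial>start_law m)"
    using Suc.prems by (intro Suc.IH transop_measurable)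
  finally show ?case by (simp add: funpow_swap1)
qed simp

lemma nn_integral_L_shift:
  assumes g: "g \<in> borel_measurable env_space"
  shows "(\<integral>\<^sup>+x. g (path_shift x) \<partial>L) = (\<integral>\<^sup>+x. g x \<partial>L)"
proof -
  have "(\<integral>\<^sup>+x. g x \<partial>distr L env_space path_shift) = (\<integral>\<^sup>+x. g (path_shift x) \<partial>L)"
    using g by (intro nn_integral_distr) measurable
  then show ?thesis by (simp add: L_inv)
qed

text \<open>On functions of the environment alone \<open>transop\<close> acts as composition with
  the shift, and \<open>L\<close> is invariant under it.\<close>

lemma start_law_env:
  "g \<in> borel_measurable env_space \<Longrightarrow> (\<integral>\<^sup>+z. g (snd z) \<partial>start_law n) = (\<integral>\<^sup>+x. g x \<partial>L)"
proof (induction n arbitrary: g)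
  case 0
  note [measurable] = 0
  show ?case by (simp add: nn_integral_distr[OF start_0_measurable])
next
  case (Suc n)
  note [measurable] = Suc.prems
  have "(\<integral>\<^sup>+z. g (snd z) \<partial>start_law (Suc n)) = (\<integral>\<^sup>+z. transop (\<lambda>z. g (snd z)) z \<partial>start_law n)"
    using start_law_prob by (simp add: nn_integral_bind_trans)
  also have "\<dots> = (\<integral>\<^sup>+z. g (path_shift (snd z)) \<partial>start_law n)"
    using prob_space.emeasure_space_1[OF prob_P] by (simp add: transop_def)
  also have "\<dots> = (\<integral>\<^sup>+x. g (path_shift x) \<partial>L)"
    by (rule Suc.IH) measurable
  also have "\<dots> = (\<integral>\<^sup>+x. g x \<partial>L)"
    by (rule nn_integral_L_shift[OF Suc.prems])
  finally show ?case .
qed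

lemma emeasure_start_law_env:
  assumes B: "B \<in> sets env_space"
  shows "emeasure (start_law n) (UNIV \<times> B) = emeasure L B"
proof -
  have m: "UNIV \<times> B \<in> sets (start_law n)" using B start_law_prob[of n] sets.top[of "borel :: 'e measure"] by simp
  have "emeasure (start_law n) (UNIV \<times> B) = (\<integral>\<^sup>+z. indicator (UNIV \<times> B) z \<partial>start_law n)"
    using m by simp
  also have "\<dots> = (\<integral>\<^sup>+z. indicator B (snd z) \<partial>start_law n)"
    by (intro nn_integral_cong) (auto simp: indicator_def)
  also have "\<dots> = emeasure L B" using B by (subst start_law_env) auto
  finally show ?thesis .
qed

lemma env_dominated_start_law: "env_dominated (start_law n)"
  using start_law_prob by (simp add: env_dominated_def emeasure_start_law_env)

text \<open>The weight \<open>\<phi>\<close> makes the induction close: a step of the chain replaces \<open>\<phi> x\<close> by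
  \<open>lam (x 0) * \<phi> (path_shift x)\<close>.\<close>

lemma start_law_lyap:
  "\<phi> \<in> borel_measurable env_space \<Longrightarrow>
    (\<integral>\<^sup>+z. ennreal (V (fst z)) * \<phi> (snd z) \<partial>start_law n) \<le> (\<integral>\<^sup>+x. lyap lam b x * \<phi> x \<partial>L)"
proof (induction n arbitrary: \<phi>)
  case 0
  note [measurable] = 0
  have "(\<integral>\<^sup>+z. ennreal (V (fst z)) * \<phi> (snd z) \<partial>start_law 0) = (\<integral>\<^sup>+x. ennreal (V y0) * \<phi> x \<partial>L)"
    by (simp add: nn_integral_distr[OF start_0_measurable])
  also have "\<dots> \<le> (\<integral>\<^sup>+x. lyap lam b x * \<phi> x \<partial>L)"
    by (intro nn_integral_mono mult_right_mono order_trans[OF ennreal_leI[OF b_ge] lyap_ge[of b _ lam]]) simp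
  finally show ?case .
next
  case (Suc n)
  note [measurable] = Suc.prems
  note [measurable_cong] = start_law_prob[of n, THEN conjunct2]
  have "(\<integral>\<^sup>+z. ennreal (V (fst z)) * \<phi> (snd z) \<partial>start_law (Suc n)) =
      (\<integral>\<^sup>+z. transop (\<lambda>z. ennreal (V (fst z)) * \<phi> (snd z)) z \<partial>start_law n)"
    using start_law_prob by (simp add: nn_integral_bind_trans)
  also have "\<dots> \<le> (\<integral>\<^sup>+z. ennreal (V (fst z)) * (ennreal (lam (snd z 0)) * \<phi> (path_shift (snd z)))
      + ennreal (b (snd z 0)) * \<phi> (path_shift (snd z)) \<partial>start_law n)"
  proof (rule nn_integral_mono)
    fix z
    have "transop (\<lambda>z. ennreal (V (fst z)) * \<phi> (snd z)) z =
        (\<integral>\<^sup>+y. ennreal (V y) \<partial>P (snd z 0) (fst z)) * \<phi> (path_shift (snd z))"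
      by (simp add: transop_def nn_integral_multc)
    also have "\<dots> \<le> ennreal (lam (snd z 0) * V (fst z) + b (snd z 0)) * \<phi> (path_shift (snd z))"
      by (intro mult_right_mono drift) simp
    also have "\<dots> = ennreal (V (fst z)) * (ennreal (lam (snd z 0)) * \<phi> (path_shift (snd z)))
      + ennreal (b (snd z 0)) * \<phi> (path_shift (snd z))"
      using lam_nn b_nn V_pos by (simp add: ennreal_plus ennreal_mult less_imp_le algebra_simps)
    finally show "transop (\<lambda>z. ennreal (V (fst z)) * \<phi> (snd z)) z \<le> \<dots>" .
  qed
  also have "\<dots> = (\<integral>\<^sup>+z. ennreal (V (fst z)) * (ennreal (lam (snd z 0)) * \<phi> (path_shift (snd z))) \<partial>start_law n)
      + (\<integral>\<^sup>+z. ennreal (b (snd z 0)) * \<phi> (path_shift (snd z)) \<partial>start_law n)"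
    by (rule nn_integral_add) measurable
  also have "\<dots> \<le> (\<integral>\<^sup>+x. lyap lam b x * (ennreal (lam (x 0)) * \<phi> (path_shift x)) \<partial>L)
      + (\<integral>\<^sup>+x. ennreal (b (x 0)) * \<phi> (path_shift x) \<partial>L)"
  proof (rule add_mono)
    show "(\<integral>\<^sup>+z. ennreal (V (fst z)) * (ennreal (lam (snd z 0)) * \<phi> (path_shift (snd z))) \<partial>start_law n)
      \<le> (\<integral>\<^sup>+x. lyap lam b x * (ennreal (lam (x 0)) * \<phi> (path_shift x)) \<partial>L)"
      by (rule Suc.IH) measurable
    show "(\<integral>\<^sup>+z. ennreal (b (snd z 0)) * \<phi> (path_shift (snd z)) \<partial>start_law n)
      \<le> (\<integral>\<^sup>+x. ennreal (b (x 0)) * \<phi> (path_shift x) \<partial>L)"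
      by (rule eq_refl, rule start_law_env) measurable
  qed
  also have "\<dots> = (\<integral>\<^sup>+x. lyap lam b (path_shift x) * \<phi> (path_shift x) \<partial>L)"
    by (subst nn_integral_add[symmetric])
      (auto intro!: nn_integral_cong simp: lyap_shift lam_nn b_nn algebra_simps)
  also have "\<dots> = (\<integral>\<^sup>+x. lyap lam b x * \<phi> x \<partial>L)"
    by (rule nn_integral_L_shift) measurable
  finally show ?case .
qed

definition tail_le :: "real \<Rightarrow> real \<Rightarrow> ('e \<times> (int \<Rightarrow> 'f)) measure \<Rightarrow> bool" where
  "tail_le R \<gamma> \<rho> \<longleftrightarrow> measure \<rho> {z. R < V (fst z)} \<le> \<gamma>"

text \<open>\<open>V\<close> need not be integrable, because the series may have infinite mean.
  Markov's inequality is therefore applied only on the environments where the series is at most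
  \<open>c\<close>, by taking their indicator as the weight in \<open>start_law_lyap\<close>; the
  other environments have small probability.\<close>

lemma start_law_tight:
  assumes "0 < \<gamma>"
  shows "\<exists>R. \<forall>n. tail_le R \<gamma> (start_law n)"
proof -
  have "eventually (\<lambda>k. measure L {x. \<not> lyap lam b x \<le> ennreal (real k)} < \<gamma> / 2) sequentially"
    using order_tendstoD(2)[OF level_measure_tendsto, of "\<gamma> / 2"] assms by simp
  then obtain c where c: "measure L {x. \<not> lyap lam b x \<le> ennreal (real c)} < \<gamma> / 2"
    by (auto simp: eventually_sequentially)
  \<comment> \<open>Makes the bound c / R from Markov's inequality at most \<gamma> / 2.\<close>
  define R where "R = 2 * (real c + 1) / \<gamma>"
  have R: "0 < R" using assms by (simp add: R_def)
  have cR: "\<gamma> / 2 + real c / R \<le> \<gamma>"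
    using assms by (simp add: R_def field_simps)
  let ?B = "{x. lyap lam b x \<le> ennreal (real c)}"
  have B: "?B \<in> sets env_space"
  proof -
    have "{x\<in>space env_space. lyap lam b x \<le> ennreal (real c)} \<in> sets env_space" by measurable
    then show ?thesis by simp
  qed
  then have B': "- ?B \<in> sets env_space" using sets.compl_sets[OF B] by (simp add: Compl_eq_Diff_UNIV)
  have "tail_le R \<gamma> (start_law n)" for n
  proof -
    interpret rho: prob_space "start_law n" using start_law_prob by simp
    note [measurable_cong] = start_law_prob[of n, THEN conjunct2]
    note [measurable] = B B'
    have "{z\<in>space (start_law n). R < V (fst z)} \<in> sets (start_law n)" by measurable
    then have m: "{z. R < V (fst z)} \<in> sets (start_law n)" by (simp add: start_law_space)
    have "ennreal (measure (start_law n) {z. R < V (fst z)}) = (\<integral>\<^sup>+z. indicator {z. R < V (fst z)} z \<partial>start_law n)"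
      using m by (simp add: rho.emeasure_eq_measure)
    also have "\<dots> \<le> (\<integral>\<^sup>+z. indicator (- ?B) (snd z) + ennreal (1 / R) * (ennreal (V (fst z)) * indicator ?B (snd z)) \<partial>start_law n)"
    proof (rule nn_integral_mono)
      fix z :: "'e \<times> (int \<Rightarrow> 'f)"
      show "indicator {z. R < V (fst z)} z \<le> indicator (- ?B) (snd z) + ennreal (1 / R) * (ennreal (V (fst z)) * indicator ?B (snd z))"
      proof (cases "snd z \<in> ?B \<and> R < V (fst z)")
        case True
        then have "1 \<le> 1 / R * V (fst z)" using R by (simp add: field_simps)
        then have "ennreal 1 \<le> ennreal (1 / R * V (fst z))" by (rule ennreal_leI)
        then show ?thesis using True R V_pos by (simp add: ennreal_mult[symmetric] less_imp_le)
      qed (auto simp: indicator_def)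
    qed
    also have "\<dots> = (\<integral>\<^sup>+z. indicator (- ?B) (snd z) \<partial>start_law n)
        + ennreal (1 / R) * (\<integral>\<^sup>+z. ennreal (V (fst z)) * indicator ?B (snd z) \<partial>start_law n)"
      by (subst nn_integral_add, measurable, subst nn_integral_cmult, measurable)
    also have "\<dots> \<le> (\<integral>\<^sup>+x. indicator (- ?B) x \<partial>L) + ennreal (1 / R) * (\<integral>\<^sup>+x. lyap lam b x * indicator ?B x \<partial>L)"
      by (intro add_mono eq_refl[OF start_law_env] mult_left_mono start_law_lyap) (auto simp: B B')
    also have "\<dots> \<le> ennreal (\<gamma> / 2) + ennreal (1 / R) * ennreal (real c)"
    proof (intro add_mono mult_left_mono)
      have "(\<integral>\<^sup>+x. indicator (- ?B) x \<partial>L) = ennreal (measure L (- ?B))"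
        using B' by (simp add: L.emeasure_eq_measure)
      also have "\<dots> \<le> ennreal (\<gamma> / 2)"
        using c by (intro ennreal_leI) (simp add: Collect_neg_eq[symmetric])
      finally show "(\<integral>\<^sup>+x. indicator (- ?B) x \<partial>L) \<le> ennreal (\<gamma> / 2)" .
      have "(\<integral>\<^sup>+x. lyap lam b x * indicator ?B x \<partial>L) \<le> (\<integral>\<^sup>+x. ennreal (real c) \<partial>L)"
        by (intro nn_integral_mono) (auto simp: indicator_def)
      then show "(\<integral>\<^sup>+x. lyap lam b x * indicator ?B x \<partial>L) \<le> ennreal (real c)"
        using L.emeasure_space_1 by simp
    qed simp
    also have "\<dots> \<le> ennreal \<gamma>"
      using cR R assms by (simp add: ennreal_mult[symmetric] ennreal_plus[symmetric] ennreal_leI del: ennreal_plus)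
    finally show ?thesis using assms by (simp add: tail_le_def)
  qed
  then show ?thesis by blast
qed

lemma integral_transop_iter_eq:
  assumes "finite_measure \<rho>" and s: "sets \<rho> = sets pair_env"
    and f: "f \<in> borel_measurable pair_env" and f1: "\<And>z. f z \<le> 1"
  shows "(\<integral>\<^sup>+z. (transop ^^ n) f z \<partial>\<rho>) = ennreal (\<integral>z. transop_iter f n z \<partial>\<rho>)"
proof -
  interpret finite_measure \<rho> by fact
  note [measurable_cong] = s
  note [measurable] = f
  have "integrable \<rho> (transop_iter f n)"
    by (rule integrable_const_bound[of _ 1]) (use transop_iter_le_1[of f, OF f1] transop_iter_nonneg in auto)
  then have "(\<integral>\<^sup>+z. ennreal (transop_iter f n z) \<partial>\<rho>) = ennreal (\<integral>z. transop_iter f n z \<partial>\<rho>)"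
    by (intro nn_integral_eq_integral) (simp_all add: transop_iter_nonneg)
  then show ?thesis by (simp add: ennreal_transop_iter f1)
qed

text \<open>Times m and n are both reached by n steps, from \<open>start_law (m - n)\<close> and
  from \<open>start_law 0\<close>. After n steps the first start may be replaced by
  \<open>y0\<close> at a small cost, and then only the environment marginal matters, which is
  \<open>L\<close> in both cases. Uniformity over the sets is the uniformity of
  \<open>contraction\<close> over the functions.\<close>

lemma start_law_cauchy:
  assumes "0 < \<gamma>"
  shows "\<exists>n0. \<forall>n\<ge>n0. \<forall>m\<ge>n. \<forall>C\<in>sets pair_env.
    \<bar>measure (start_law m) C - measure (start_law n) C\<bar> \<le> \<gamma>"
proof -
  obtain R where R: "\<And>n. measure (start_law n) {z. R < V (fst z)} \<le> \<gamma> / 2"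
    using start_law_tight[of "\<gamma> / 2"] assms by (auto simp: tail_le_def)
  obtain n0 where n0: "\<And>n \<rho> f. n \<ge> n0 \<Longrightarrow> env_dominated \<rho> \<Longrightarrow> f \<in> borel_measurable pair_env \<Longrightarrow> (\<And>z. f z \<le> 1) \<Longrightarrow>
    \<bar>(\<integral>z. transop_iter f n z \<partial>\<rho>) - (\<integral>z. transop_iter f n (y0, snd z) \<partial>\<rho>)\<bar> \<le> measure \<rho> {z. R < V (fst z)} + \<gamma> / 2"
    using contraction[of "\<gamma> / 2" R] assms by (metis half_gt_zero)
  show ?thesis
  proof (intro exI[of _ n0] allI impI ballI)
    fix n m C assume n: "n0 \<le> n" and m: "n \<le> m" and C: "C \<in> sets (pair_env :: ('e \<times> (int \<Rightarrow> 'f)) measure)"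
    let ?f = "indicator C :: 'e \<times> (int \<Rightarrow> 'f) \<Rightarrow> ennreal"
    have f: "?f \<in> borel_measurable pair_env" and f1: "?f z \<le> 1" for z
      using C by (auto simp: indicator_def)
    have me: "measure (start_law (k + n)) C = (\<integral>z. transop_iter ?f n z \<partial>start_law k)" for k
    proof -
      interpret rho: prob_space "start_law (k + n)" using start_law_prob by simp
      have "ennreal (measure (start_law (k + n)) C) = (\<integral>\<^sup>+z. ?f z \<partial>start_law (k + n))"
        using C start_law_prob[of "k + n"] by (simp add: rho.emeasure_eq_measure)
      also have "\<dots> = ennreal (\<integral>z. transop_iter ?f n z \<partial>start_law k)"
        using start_law_prob[of k]
        by (subst nn_integral_start_law_add[OF f], subst integral_transop_iter_eq) (auto simp: f f1 prob_space.finite_measure)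
      finally show ?thesis
        by (simp add: integral_nonneg_AE transop_iter_nonneg)
    qed
    have "(\<integral>z. transop_iter ?f n (y0, snd z) \<partial>start_law k) = (\<integral>x. transop_iter ?f n (y0, x) \<partial>L)" for k
    proof -
      have mm: "(\<lambda>x. transop_iter ?f n (y0, x)) \<in> borel_measurable env_space"
        by (rule measurable_compose[OF _ transop_iter_measurable[OF f]]) measurable
      note [measurable_cong] = start_law_prob[of k, THEN conjunct2]
      have "(\<integral>z. transop_iter ?f n (y0, snd z) \<partial>start_law k) = enn2real (\<integral>\<^sup>+z. ennreal (transop_iter ?f n (y0, snd z)) \<partial>start_law k)"
        by (rule integral_eq_nn_integral) (use mm transop_iter_nonneg in \<open>auto intro: measurable_compose[of snd]\<close>)
      also have "\<dots> = enn2real (\<integral>\<^sup>+x. ennreal (transop_iter ?f n (y0, x)) \<partial>L)"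
        using mm by (subst start_law_env[of "\<lambda>x. ennreal (transop_iter ?f n (y0, x))"]) auto
      also have "\<dots> = (\<integral>x. transop_iter ?f n (y0, x) \<partial>L)"
        by (rule integral_eq_nn_integral[symmetric]) (use mm transop_iter_nonneg in auto)
      finally show ?thesis .
    qed
    moreover have "(\<integral>z. transop_iter ?f n z \<partial>start_law 0) = (\<integral>x. transop_iter ?f n (y0, x) \<partial>L)"
      using transop_iter_measurable[OF f] by (simp add: integral_distr[OF start_0_measurable])
    ultimately have "\<bar>measure (start_law ((m - n) + n)) C - measure (start_law (0 + n)) C\<bar> \<le> \<gamma> / 2 + \<gamma> / 2"
      unfolding me using n0[OF n env_dominated_start_law f f1, of "m - n"] R[of "m - n"] by simp
    then show "\<bar>measure (start_law m) C - measure (start_law n) C\<bar> \<le> \<gamma>"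
      using m by simp
  qed
qed

text \<open>The operator maps an indicator to a function that is merely bounded and measurable.
  Convergence on all measurable sets, in contrast to weak convergence, is enough to pass to the
  limit with such a function in
  \<open>start_law (Suc n) = start_law n \<bind> trans\<close>.\<close>

lemma invariant_law_exists:
  "\<exists>\<mu>. prob_space \<mu> \<and> sets \<mu> = sets pair_env \<and> \<mu> \<bind> trans = \<mu> \<and>
    (\<forall>B\<in>sets env_space. emeasure \<mu> (UNIV \<times> B) = emeasure L B)"
proof -
  obtain \<mu> where mu: "prob_space \<mu>" and s: "sets \<mu> = sets pair_env"
    and conv: "\<And>C. C \<in> sets pair_env \<Longrightarrow> (\<lambda>n. measure (start_law n) C) \<longlonglongrightarrow> measure \<mu> C"
    using uniform_cauchy_measure_limit[of start_law pair_env, OF _ _ start_law_cauchy] start_law_prob by blast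
  interpret mu: prob_space \<mu> by (rule mu)
  interpret nu: prob_space "\<mu> \<bind> trans" by (rule prob_bind_trans[OF mu s])
  have "\<mu> \<bind> trans = \<mu>"
  proof (rule measure_eqI)
    show "sets (\<mu> \<bind> trans) = sets \<mu>" using prob_bind_trans[OF mu s] s by simp
    fix C assume "C \<in> sets (\<mu> \<bind> trans)"
    then have C: "C \<in> sets pair_env" using prob_bind_trans[OF mu s] by simp
    let ?f = "indicator C :: 'e \<times> (int \<Rightarrow> 'f) \<Rightarrow> ennreal"
    have f: "?f \<in> borel_measurable pair_env" and f1: "?f z \<le> 1" for z
      using C by (auto simp: indicator_def)
    have step: "measure (\<rho> \<bind> trans) C = (\<integral>z. transop_iter ?f 1 z \<partial>\<rho>)"
      if "prob_space \<rho>" "sets \<rho> = sets pair_env" for \<rho>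
    proof -
      interpret prob_space "\<rho> \<bind> trans" by (rule prob_bind_trans[OF that])
      have "ennreal (measure (\<rho> \<bind> trans) C) = (\<integral>\<^sup>+z. ?f z \<partial>(\<rho> \<bind> trans))"
        using C prob_bind_trans(2)[OF that] by (simp add: emeasure_eq_measure)
      also have "\<dots> = (\<integral>\<^sup>+z. (transop ^^ 1) ?f z \<partial>\<rho>)"
        by (simp add: nn_integral_bind_trans[OF that(2) f])
      also have "\<dots> = ennreal (\<integral>z. transop_iter ?f 1 z \<partial>\<rho>)"
        using that by (intro integral_transop_iter_eq) (auto simp: f f1 prob_space.finite_measure)
      finally show ?thesis by (simp add: integral_nonneg_AE transop_iter_nonneg)
    qed
    have "(\<lambda>n. \<integral>z. transop_iter ?f 1 z \<partial>start_law n) \<longlonglongrightarrow> (\<integral>z. transop_iter ?f 1 z \<partial>\<mu>)"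
      using start_law_prob conv f1
      by (intro setwise_tendsto_integral[where N = pair_env] mu s transop_iter_measurable f transop_iter_nonneg transop_iter_le_1) auto
    then have "(\<lambda>n. measure (start_law (Suc n)) C) \<longlonglongrightarrow> measure (\<mu> \<bind> trans) C"
      using start_law_prob by (simp add: step mu s)
    moreover have "(\<lambda>n. measure (start_law (Suc n)) C) \<longlonglongrightarrow> measure \<mu> C"
      by (rule LIMSEQ_Suc[OF conv[OF C]])
    ultimately have "measure (\<mu> \<bind> trans) C = measure \<mu> C" by (rule LIMSEQ_unique)
    then show "emeasure (\<mu> \<bind> trans) C = emeasure \<mu> C"
      by (simp add: mu.emeasure_eq_measure nu.emeasure_eq_measure)
  qed
  moreover have "emeasure \<mu> (UNIV \<times> B) = emeasure L B" if B: "B \<in> sets env_space" for B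
  proof -
    have "measure (start_law n) (UNIV \<times> B) = measure L B" for n
      using emeasure_start_law_env[OF B] by (simp add: measure_def)
    then have "(\<lambda>n. measure L B) \<longlonglongrightarrow> measure \<mu> (UNIV \<times> B)"
      using conv[of "UNIV \<times> B"] B sets.top[of "borel :: 'e measure"] by simp
    then show ?thesis by (simp add: LIMSEQ_const_iff mu.emeasure_eq_measure L.emeasure_eq_measure)
  qed
  ultimately show ?thesis using mu s by blast
qed

end

section \<open>The Markov property on path space\<close>

abbreviation chain_space :: "(int \<Rightarrow> 'e::polish_space \<times> 'f::polish_space) measure" where
  "chain_space \<equiv> path_space (borel \<Otimes>\<^sub>M borel)"

lemma space_chain_space [simp]: "space chain_space = UNIV"
  by (simp add: space_PiM space_pair_measure)

lemma UNIV_chain_space [simp]: "UNIV \<in> sets chain_space"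
  using sets.top[of "chain_space :: (int \<Rightarrow> 'a::polish_space \<times> 'b::polish_space) measure"] by simp

lemma UNIV_pair_env [simp]: "UNIV \<in> sets pair_env"
  using sets.top[of "pair_env :: ('a::polish_space \<times> (int \<Rightarrow> 'b::polish_space)) measure"] by simp

definition env_view :: "int \<Rightarrow> (int \<Rightarrow> 'e \<times> 'f) \<Rightarrow> 'e \<times> (int \<Rightarrow> 'f)" where
  "env_view t \<omega> = (fst (\<omega> t), \<lambda>s. snd (\<omega> (s + t)))"

lemma env_view_simps [simp]:
  "fst (env_view t \<omega>) = fst (\<omega> t)" "snd (env_view t \<omega>) s = snd (\<omega> (s + t))"
  by (simp_all add: env_view_def)

lemma path_shift_env_view: "path_shift (snd (env_view (t - 1) \<omega>)) = snd (env_view t \<omega>)"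
  by (simp add: env_view_def path_shift_def add.assoc)

lemma env_view_path_shift: "env_view t (path_shift \<omega>) = env_view (t + 1) \<omega>"
  by (simp add: env_view_def path_shift_def add.assoc)

section \<open>Past events and cylinders on path space\<close>

definition past :: "int \<Rightarrow> (int \<Rightarrow> 'e::polish_space \<times> 'f::polish_space) measure" where
  "past t = past_sigma chain_space (\<lambda>t \<omega>. fst (\<omega> t)) (\<lambda>t \<omega>. snd (\<omega> t)) t"

lemma space_past [simp]: "space (past t) = UNIV"
  by (simp add: past_def past_sigma_def space_measure_of_conv)

lemma sets_past: "sets (past t) = sigma_sets UNIV
   ({(\<lambda>\<omega>. snd (\<omega> s)) -` B | s B. B \<in> sets borel} \<union> {(\<lambda>\<omega>. fst (\<omega> s)) -` B | s B. s < t \<and> B \<in> sets borel})"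
  unfolding past_def past_sigma_def by (subst sets_measure_of) auto

lemma past_snd: "(\<lambda>\<omega>. snd (\<omega> s)) \<in> past t \<rightarrow>\<^sub>M borel"
proof (rule measurableI)
  fix B :: "'b set" assume "B \<in> sets borel"
  then have "(\<lambda>\<omega>::int \<Rightarrow> 'a \<times> 'b. snd (\<omega> s)) -` B \<in> sets (past t)"
    unfolding sets_past by (intro sigma_sets.Basic) blast
  then show "(\<lambda>\<omega>::int \<Rightarrow> 'a \<times> 'b. snd (\<omega> s)) -` B \<inter> space (past t) \<in> sets (past t)" by simp
qed simp

lemma past_fst: assumes "s < t" shows "(\<lambda>\<omega>. fst (\<omega> s)) \<in> past t \<rightarrow>\<^sub>M borel"
proof (rule measurableI)
  fix B :: "'a set" assume "B \<in> sets borel"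
  with assms have "(\<lambda>\<omega>::int \<Rightarrow> 'a \<times> 'b. fst (\<omega> s)) -` B \<in> sets (past t)"
    unfolding sets_past by (intro sigma_sets.Basic) blast
  then show "(\<lambda>\<omega>::int \<Rightarrow> 'a \<times> 'b. fst (\<omega> s)) -` B \<inter> space (past t) \<in> sets (past t)" by simp
qed simp

lemma measurable_into_env:
  assumes "\<And>s. (\<lambda>w. g w s) \<in> M \<rightarrow>\<^sub>M borel" shows "g \<in> M \<rightarrow>\<^sub>M env_space"
proof -
  have "(\<lambda>w s. g w s) \<in> M \<rightarrow>\<^sub>M env_space"
    by (rule measurable_PiM_single') (auto simp: assms)
  then show ?thesis by simp
qed

text \<open>No restriction on \<open>s\<close>: the conditioning field contains the entire
  environment, its future included.\<close>

lemma past_snd_env_view: "(\<lambda>\<omega>. snd (env_view s \<omega>)) \<in> past t \<rightarrow>\<^sub>M env_space"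
  by (rule measurable_into_env) (simp add: past_snd)

lemma past_env_view: assumes "s < t" shows "env_view s \<in> past t \<rightarrow>\<^sub>M pair_env"
proof -
  have "(\<lambda>\<omega>. (fst (env_view s \<omega>), snd (env_view s \<omega>))) \<in> past t \<rightarrow>\<^sub>M pair_env"
    using past_fst[OF assms] past_snd_env_view by (intro measurable_Pair) simp_all
  then show ?thesis unfolding prod.collapse .
qed

lemma chain_coord: "(\<lambda>\<omega>. \<omega> t) \<in> chain_space \<rightarrow>\<^sub>M borel \<Otimes>\<^sub>M borel"
  by (rule measurable_component_singleton) simp

lemma chain_fst [measurable]: "(\<lambda>\<omega>. fst (\<omega> t)) \<in> chain_space \<rightarrow>\<^sub>M borel"
  by (rule measurable_compose[OF chain_coord measurable_fst])

lemma chain_snd [measurable]: "(\<lambda>\<omega>. snd (\<omega> t)) \<in> chain_space \<rightarrow>\<^sub>M borel"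
  by (rule measurable_compose[OF chain_coord measurable_snd])

lemma chain_fst_set: "A \<in> sets borel \<Longrightarrow> {\<omega>. fst (\<omega> t) \<in> A} \<in> sets chain_space"
  using measurable_sets[OF chain_fst, of A t] by (simp add: vimage_def)

lemma env_view_measurable [measurable]: "env_view s \<in> chain_space \<rightarrow>\<^sub>M pair_env"
proof -
  have "(\<lambda>\<omega>. (fst (env_view s \<omega>), snd (env_view s \<omega>))) \<in> chain_space \<rightarrow>\<^sub>M pair_env"
    by (intro measurable_Pair measurable_into_env) simp_all
  then show ?thesis unfolding prod.collapse .
qed

lemma env_view_indicator_measurable:
  assumes "f \<in> borel_measurable pair_env" "S \<in> sets chain_space"
  shows "(\<lambda>\<omega>. f (env_view t \<omega>) * indicator S \<omega> :: ennreal) \<in> borel_measurable chain_space"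
  using assms
  by (intro borel_measurable_times_ennreal measurable_compose[OF env_view_measurable] borel_measurable_indicator)

lemma sets_past_subset: "sets (past t) \<subseteq> sets chain_space"
proof -
  have "(\<lambda>\<omega>. fst (\<omega> s)) -` B \<in> sets chain_space" if "B \<in> sets borel" for s and B :: "'a set"
    using measurable_sets[OF chain_fst that, of s] by simp
  moreover have "(\<lambda>\<omega>. snd (\<omega> s)) -` B \<in> sets chain_space" if "B \<in> sets borel" for s and B :: "'b set"
    using measurable_sets[OF chain_snd that, of s] by simp
  ultimately have "sigma_sets (space chain_space)
     ({(\<lambda>\<omega>. snd (\<omega> s)) -` B | s B. B \<in> sets borel} \<union> {(\<lambda>\<omega>. fst (\<omega> s)) -` B | s B. s < t \<and> B \<in> sets borel})
     \<subseteq> sets (chain_space :: (int \<Rightarrow> 'a \<times> 'b) measure)"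
    by (intro sets.sigma_sets_subset) blast
  then show ?thesis by (simp add: sets_past)
qed

lemma sets_past_mono: "s \<le> t \<Longrightarrow> sets (past s) \<subseteq> sets (past t)"
  unfolding sets_past by (intro sigma_sets_mono') (use order.strict_trans2 in blast)

text \<open>Each condition concerns the state together with the re-centred environment, thus
  possibly infinitely many environment coordinates. In this form a cylinder is evaluated by applying
  the transition operator once per time.\<close>

definition cylinders :: "(int \<Rightarrow> 'e::polish_space \<times> 'f::polish_space) set set" where
  "cylinders = {{\<omega>. \<forall>t. env_view t \<omega> \<in> C t} | C. (\<forall>t. C t \<in> sets pair_env) \<and> finite {t. C t \<noteq> UNIV}}"

lemma Int_stable_cylinders: "Int_stable cylinders"
proof (rule Int_stableI)
  fix a b :: "(int \<Rightarrow> 'a \<times> 'b) set" assume "a \<in> cylinders" "b \<in> cylinders"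
  then obtain C D where C: "a = {\<omega>. \<forall>t. env_view t \<omega> \<in> C t}" "\<And>t. C t \<in> sets pair_env" "finite {t. C t \<noteq> UNIV}"
    and D: "b = {\<omega>. \<forall>t. env_view t \<omega> \<in> D t}" "\<And>t. D t \<in> sets pair_env" "finite {t. D t \<noteq> UNIV}"
    unfolding cylinders_def by blast
  have "a \<inter> b = {\<omega>. \<forall>t. env_view t \<omega> \<in> C t \<inter> D t}" using C D by auto
  moreover have "finite {t. C t \<inter> D t \<noteq> UNIV}"
    by (rule finite_subset[OF _ finite_UnI[OF C(3) D(3)]]) auto
  ultimately show "a \<inter> b \<in> cylinders"
    unfolding cylinders_def using C(2) D(2) by (intro CollectI exI[of _ "\<lambda>t. C t \<inter> D t"]) auto
qed

lemma UNIV_cylinders: "UNIV \<in> cylinders"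
  unfolding cylinders_def by (intro CollectI exI[of _ "\<lambda>_. UNIV"]) simp

lemma cylinder_window:
  assumes "D \<in> cylinders"
  obtains n :: nat and C where "\<And>t. C t \<in> sets pair_env" "D = {\<omega>. \<forall>t\<in>{- int n..int n}. env_view t \<omega> \<in> C t}"
proof -
  obtain C where C: "D = {\<omega>. \<forall>t. env_view t \<omega> \<in> C t}" "\<And>t. C t \<in> sets pair_env" "finite {t. C t \<noteq> UNIV}"
    using assms unfolding cylinders_def by blast
  have "finite ((\<lambda>t. nat \<bar>t\<bar>) ` {t. C t \<noteq> UNIV})" using C(3) by simp
  then obtain n where n: "\<And>t. C t \<noteq> UNIV \<Longrightarrow> nat \<bar>t\<bar> \<le> n"
    unfolding finite_nat_set_iff_bounded_le by auto
  have "D = {\<omega>. \<forall>t\<in>{- int n..int n}. env_view t \<omega> \<in> C t}"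
    unfolding C(1)
  proof (intro Collect_cong iffI allI ballI)
    fix \<omega> t assume *: "\<forall>t\<in>{- int n..int n}. env_view t \<omega> \<in> C t"
    show "env_view t \<omega> \<in> C t"
    proof (cases "C t = UNIV")
      case False
      then have "t \<in> {- int n..int n}" using n[of t] by auto
      then show ?thesis using * by blast
    qed simp
  qed blast
  with C(2) that show ?thesis by blast
qed

lemma env_view_set:
  assumes "C \<in> sets pair_env" shows "{\<omega>. env_view t \<omega> \<in> C} \<in> sets chain_space"
  using measurable_sets[OF env_view_measurable assms, of t] by (simp add: vimage_def)

lemma window_set:
  assumes "\<And>t. C t \<in> sets pair_env" "finite T"
  shows "{\<omega>. \<forall>t\<in>T. env_view t \<omega> \<in> C t} \<in> sets chain_space"
proof -
  have "{\<omega>. \<forall>t\<in>T. env_view t \<omega> \<in> C t} = (\<Inter>t\<in>T. {\<omega>. env_view t \<omega> \<in> C t}) \<inter> space chain_space" by auto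
  also have "\<dots> \<in> sets chain_space"
    using assms env_view_set by (cases "T = {}") (auto intro!: sets.finite_INT simp: UNIV_chain_space)
  finally show ?thesis .
qed

lemma sets_chain_space_cylinders: "sets chain_space = sigma_sets UNIV cylinders"
proof
  have "cylinders \<subseteq> sets (chain_space :: (int \<Rightarrow> 'a \<times> 'b) measure)"
  proof
    fix D :: "(int \<Rightarrow> 'a \<times> 'b) set" assume "D \<in> cylinders"
    then show "D \<in> sets chain_space"
      by (rule cylinder_window) (auto intro!: window_set)
  qed
  then show "sigma_sets UNIV cylinders \<subseteq> sets (chain_space :: (int \<Rightarrow> 'a \<times> 'b) measure)"
    using sets.sigma_sets_subset[of cylinders "chain_space :: (int \<Rightarrow> 'a \<times> 'b) measure"] by simp
  have "sigma_sets UNIV {{f\<in>UNIV. f i \<in> A} | i A. A \<in> sets (borel \<Otimes>\<^sub>M borel)} \<subseteq> sigma_sets UNIV (cylinders :: (int \<Rightarrow> 'a \<times> 'b) set set)"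
  proof (rule sigma_sets_mono', safe)
    fix i :: int and A :: "('a \<times> 'b) set" assume A: "A \<in> sets (borel \<Otimes>\<^sub>M borel)"
    define C where "C t = (if t = i then {z :: 'a \<times> (int \<Rightarrow> 'b). (fst z, snd z 0) \<in> A} else UNIV)" for t
    have "(\<lambda>z::'a \<times> (int \<Rightarrow> 'b). (fst z, snd z 0)) \<in> pair_env \<rightarrow>\<^sub>M borel \<Otimes>\<^sub>M borel" by measurable
    from measurable_sets[OF this A] have "C t \<in> sets pair_env" for t
      using sets.top[of "pair_env :: ('a \<times> (int \<Rightarrow> 'b)) measure"] by (simp add: C_def vimage_def)
    moreover have "finite {t. C t \<noteq> UNIV}"
      by (rule finite_subset[of _ "{i}"]) (auto simp: C_def)
    moreover have "{f\<in>UNIV. f i \<in> A} = {\<omega>. \<forall>t. env_view t \<omega> \<in> C t}"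
      by (auto simp: C_def)
    ultimately show "{f\<in>UNIV. f i \<in> A} \<in> cylinders"
      unfolding cylinders_def by blast
  qed
  then show "sets (chain_space :: (int \<Rightarrow> 'a \<times> 'b) measure) \<subseteq> sigma_sets UNIV cylinders"
    by (simp add: sets_PiM_single space_pair_measure)
qed

section \<open>The Markov property as an integral identity\<close>

context random_kernel
begin

text \<open>The conditional distribution identity, integrated over past events. Unlike a conditional
  expectation it makes sense for a measure of any mass, and so for the restriction of a process to
  an event. The test functions also see the environment, which is what iteration of
  \<open>transop\<close> requires.\<close>

definition markov_at :: "(int \<Rightarrow> 'e \<times> 'f) measure \<Rightarrow> int \<Rightarrow> bool" where
  "markov_at \<rho> t \<longleftrightarrow> (\<forall>S\<in>sets (past t). \<forall>f\<in>borel_measurable pair_env.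
     (\<integral>\<^sup>+\<omega>. f (env_view t \<omega>) * indicator S \<omega> \<partial>\<rho>) =
     (\<integral>\<^sup>+\<omega>. transop f (env_view (t - 1) \<omega>) * indicator S \<omega> \<partial>\<rho>))"

lemma markov_atD:
  assumes "markov_at \<rho> t" "S \<in> sets (past t)" "f \<in> borel_measurable pair_env"
  shows "(\<integral>\<^sup>+\<omega>. f (env_view t \<omega>) * indicator S \<omega> \<partial>\<rho>) =
     (\<integral>\<^sup>+\<omega>. transop f (env_view (t - 1) \<omega>) * indicator S \<omega> \<partial>\<rho>)"
  using assms unfolding markov_at_def by blast

lemma P_emeasure_coord [measurable]:
  assumes "A \<in> sets borel"
  shows "(\<lambda>\<omega>. emeasure (P (snd (\<omega> t)) (fst (\<omega> t))) A) \<in> borel_measurable chain_space"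
proof -
  have "(\<lambda>\<omega>. emeasure (P (snd (env_view t \<omega>) 0) (fst (env_view t \<omega>))) A) \<in> borel_measurable chain_space"
    by (rule measurable_compose[OF measurable_compose[OF env_view_measurable P_kernel]
        measurable_emeasure_subprob_algebra[OF assms]])
  then show ?thesis by simp
qed

text \<open>The environment belongs to the past, so in a rectangle A x B the condition on B can be
  absorbed into the past event \<open>S\<close>. This leaves the hypothesis for A, and rectangles
  determine finite measures on the state space.\<close>

lemma markov_atI:
  assumes fin: "finite_measure \<rho>" and s: "sets \<rho> = sets chain_space"
    and step: "\<And>S A. S \<in> sets (past t) \<Longrightarrow> A \<in> sets borel \<Longrightarrow>
      emeasure \<rho> (S \<inter> {\<omega>. fst (\<omega> t) \<in> A}) =
      (\<integral>\<^sup>+\<omega>. emeasure (P (snd (\<omega> (t - 1))) (fst (\<omega> (t - 1)))) A * indicator S \<omega> \<partial>\<rho>)"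
  shows "markov_at \<rho> t"
  unfolding markov_at_def
proof (intro ballI)
  fix S :: "(int \<Rightarrow> 'e \<times> 'f) set" and f :: "'e \<times> (int \<Rightarrow> 'f) \<Rightarrow> ennreal"
  assume S: "S \<in> sets (past t)" and f: "f \<in> borel_measurable pair_env"
  interpret finite_measure \<rho> by fact
  have space: "space \<rho> = UNIV" using sets_eq_imp_space_eq[OF s] by simp
  note [measurable_cong] = s
  have S': "S \<in> sets chain_space" using S sets_past_subset by blast
  note [measurable] = S'
  define d where "d = density \<rho> (indicator S)"
  have sd: "sets d = sets chain_space" by (simp add: d_def s)
  note [measurable_cong] = sd
  define m1 where "m1 = distr d pair_env (env_view t)"
  define m2 where "m2 = distr d pair_env (env_view (t - 1)) \<bind> trans"
  have int1: "(\<integral>\<^sup>+z. g z \<partial>m1) = (\<integral>\<^sup>+\<omega>. g (env_view t \<omega>) * indicator S \<omega> \<partial>\<rho>)"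
    if [measurable]: "g \<in> borel_measurable pair_env" for g
    unfolding m1_def d_def
    by (subst nn_integral_distr, measurable, subst nn_integral_density) (auto simp: mult.commute)
  have int2: "(\<integral>\<^sup>+z. g z \<partial>m2) = (\<integral>\<^sup>+\<omega>. transop g (env_view (t - 1) \<omega>) * indicator S \<omega> \<partial>\<rho>)"
    if [measurable]: "g \<in> borel_measurable pair_env" for g
    unfolding m2_def
    by (subst nn_integral_bind_trans, simp, measurable, subst nn_integral_distr, measurable,
        unfold d_def, subst nn_integral_density) (auto simp: mult.commute)
  have s1: "sets m1 = sets pair_env" by (simp add: m1_def)
  have s2: "sets m2 = sets pair_env"
    unfolding m2_def by (rule sets_bind) simp_all
  let ?G = "{A \<times> B | A B. A \<in> sets (borel :: 'e measure) \<and> B \<in> sets (env_space :: (int \<Rightarrow> 'f) measure)}"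
  have "m1 = m2"
  proof (rule measure_eqI_generator_eq)
    show "Int_stable ?G" by (rule Int_stable_pair_measure_generator)
    show "?G \<subseteq> Pow UNIV" by auto
    show "sets m1 = sigma_sets UNIV ?G" "sets m2 = sigma_sets UNIV ?G"
      by (simp_all add: s1 s2 sets_pair_measure)
    have "UNIV \<in> sets (env_space :: (int \<Rightarrow> 'f) measure)"
      using sets.top[of "env_space :: (int \<Rightarrow> 'f) measure"] by simp
    then have "UNIV \<in> ?G"
      by (intro CollectI exI[of _ UNIV] conjI) simp_all
    then show "range (\<lambda>_::nat. UNIV) \<subseteq> ?G" by (rule image_subsetI)
    have "emeasure m1 UNIV = (\<integral>\<^sup>+z. indicator UNIV z \<partial>m1)"
      using s1 by (intro nn_integral_indicator[symmetric]) simp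
    also have "\<dots> = (\<integral>\<^sup>+\<omega>. indicator S \<omega> \<partial>\<rho>)"
      by (subst int1) simp_all
    also have "\<dots> = emeasure \<rho> S" using S' s by simp
    finally show "emeasure m1 ((\<lambda>_::nat. UNIV) i) \<noteq> \<infinity>" for i by simp
    fix X assume "X \<in> ?G"
    then obtain A B where X: "X = A \<times> B" and A: "A \<in> sets borel" and B: "B \<in> sets env_space" by blast
    have Xs: "X \<in> sets pair_env" using A B X by simp
    define S1 where "S1 = S \<inter> {\<omega>. snd (env_view t \<omega>) \<in> B}"
    have "{\<omega>. snd (env_view t \<omega>) \<in> B} \<in> sets (past t)"
      using measurable_sets[OF past_snd_env_view B, of t t] by (simp add: vimage_def)
    then have S1: "S1 \<in> sets (past t)" unfolding S1_def using S by (intro sets.Int)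
    have "emeasure m1 X = (\<integral>\<^sup>+z. indicator X z \<partial>m1)"
      using Xs s1 by simp
    also have "\<dots> = (\<integral>\<^sup>+\<omega>. indicator X (env_view t \<omega>) * indicator S \<omega> \<partial>\<rho>)"
      using Xs by (intro int1) simp
    also have "\<dots> = (\<integral>\<^sup>+\<omega>. indicator (S1 \<inter> {\<omega>. fst (\<omega> t) \<in> A}) \<omega> \<partial>\<rho>)"
      by (intro nn_integral_cong) (auto simp: indicator_def X S1_def mem_Times_iff)
    also have "\<dots> = emeasure \<rho> (S1 \<inter> {\<omega>. fst (\<omega> t) \<in> A})"
    proof (rule nn_integral_indicator)
      show "S1 \<inter> {\<omega>. fst (\<omega> t) \<in> A} \<in> sets \<rho>"
        unfolding s using S1 sets_past_subset chain_fst_set[OF A] by (intro sets.Int) auto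
    qed
    also have "\<dots> = (\<integral>\<^sup>+\<omega>. emeasure (P (snd (\<omega> (t - 1))) (fst (\<omega> (t - 1)))) A * indicator S1 \<omega> \<partial>\<rho>)"
      by (rule step[OF S1 A])
    also have "\<dots> = (\<integral>\<^sup>+\<omega>. transop (indicator X) (env_view (t - 1) \<omega>) * indicator S \<omega> \<partial>\<rho>)"
    proof (rule nn_integral_cong)
      fix \<omega>
      have "transop (indicator X) (env_view (t - 1) \<omega>) =
          (\<integral>\<^sup>+y. indicator B (snd (env_view t \<omega>)) * indicator A y \<partial>P (snd (\<omega> (t - 1))) (fst (\<omega> (t - 1))))"
        by (auto simp: transop_def path_shift_env_view X indicator_def intro!: nn_integral_cong)
      also have "\<dots> = indicator B (snd (env_view t \<omega>)) * emeasure (P (snd (\<omega> (t - 1))) (fst (\<omega> (t - 1)))) A"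
        using A by (simp add: nn_integral_cmult)
      finally show "emeasure (P (snd (\<omega> (t - 1))) (fst (\<omega> (t - 1)))) A * indicator S1 \<omega> =
          transop (indicator X) (env_view (t - 1) \<omega>) * indicator S \<omega>"
        by (auto simp: indicator_def S1_def)
    qed
    also have "\<dots> = (\<integral>\<^sup>+z. indicator X z \<partial>m2)"
      using Xs by (intro int2[symmetric]) simp
    also have "\<dots> = emeasure m2 X" using Xs s2 by simp
    finally show "emeasure m1 X = emeasure m2 X" .
  qed simp
  then show "(\<integral>\<^sup>+\<omega>. f (env_view t \<omega>) * indicator S \<omega> \<partial>\<rho>) =
     (\<integral>\<^sup>+\<omega>. transop f (env_view (t - 1) \<omega>) * indicator S \<omega> \<partial>\<rho>)"
    using int1[OF f] int2[OF f] by simp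
qed

lemma markov_at_emeasure:
  assumes s: "sets \<rho> = sets chain_space" and m: "markov_at \<rho> t"
    and S: "S \<in> sets (past t)" and A: "A \<in> sets borel"
  shows "emeasure \<rho> (S \<inter> {\<omega>. fst (\<omega> t) \<in> A}) =
    (\<integral>\<^sup>+\<omega>. emeasure (P (snd (\<omega> (t - 1))) (fst (\<omega> (t - 1)))) A * indicator S \<omega> \<partial>\<rho>)"
proof -
  have AU: "A \<times> UNIV \<in> sets (pair_env :: ('e \<times> (int \<Rightarrow> 'f)) measure)"
    using A sets.top[of "env_space :: (int \<Rightarrow> 'f) measure"] by simp
  have "S \<inter> {\<omega>. fst (\<omega> t) \<in> A} \<in> sets \<rho>"
    unfolding s using S sets_past_subset chain_fst_set[OF A] by (intro sets.Int) auto
  then have "emeasure \<rho> (S \<inter> {\<omega>. fst (\<omega> t) \<in> A}) = (\<integral>\<^sup>+\<omega>. indicator (S \<inter> {\<omega>. fst (\<omega> t) \<in> A}) \<omega> \<partial>\<rho>)"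
    by simp
  also have "\<dots> = (\<integral>\<^sup>+\<omega>. indicator (A \<times> UNIV) (env_view t \<omega>) * indicator S \<omega> \<partial>\<rho>)"
    by (intro nn_integral_cong) (auto simp: indicator_def mem_Times_iff)
  also have "\<dots> = (\<integral>\<^sup>+\<omega>. transop (indicator (A \<times> UNIV)) (env_view (t - 1) \<omega>) * indicator S \<omega> \<partial>\<rho>)"
    using AU by (intro markov_atD[OF m S]) simp
  also have "\<dots> = (\<integral>\<^sup>+\<omega>. emeasure (P (snd (\<omega> (t - 1))) (fst (\<omega> (t - 1)))) A * indicator S \<omega> \<partial>\<rho>)"
  proof (rule nn_integral_cong)
    fix \<omega>
    have "transop (indicator (A \<times> UNIV)) (env_view (t - 1) \<omega>) =
        (\<integral>\<^sup>+y. indicator A y \<partial>P (snd (\<omega> (t - 1))) (fst (\<omega> (t - 1))))"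
      by (auto simp: transop_def indicator_def intro!: nn_integral_cong)
    then show "transop (indicator (A \<times> UNIV)) (env_view (t - 1) \<omega>) * indicator S \<omega> =
        emeasure (P (snd (\<omega> (t - 1))) (fst (\<omega> (t - 1)))) A * indicator S \<omega>"
      using A by simp
  qed
  finally show ?thesis .
qed

text \<open>The latest time is integrated out first: its condition is multiplied into the test
  function, and the Markov property replaces the product by its image under \<open>transop\<close>
  one time earlier. The quantifier over \<rho> stands behind that over \<open>g\<close>, since one
  and the same \<open>g\<close> has to serve two measures that are to be compared.\<close>

lemma cylinder_representation:
  assumes C: "\<And>t. C t \<in> sets pair_env" and h: "h \<in> borel_measurable pair_env"
  shows "\<exists>g\<in>borel_measurable pair_env. ((\<forall>z. h z \<le> 1) \<longrightarrow> (\<forall>z. g z \<le> 1)) \<and>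
    (\<forall>\<rho>. sets \<rho> = sets chain_space \<longrightarrow> (\<forall>t\<in>{a<..a + int N}. markov_at \<rho> t) \<longrightarrow>
      (\<integral>\<^sup>+\<omega>. h (env_view (a + int N) \<omega>) * indicator {\<omega>. \<forall>t\<in>{a..a + int N}. env_view t \<omega> \<in> C t} \<omega> \<partial>\<rho>)
      = (\<integral>\<^sup>+\<omega>. g (env_view a \<omega>) \<partial>\<rho>))"
  using h
proof (induction N arbitrary: h)
  case 0
  note [measurable] = 0 C
  have "(\<lambda>z. h z * indicator (C a) z) \<in> borel_measurable pair_env" by measurable
  moreover have "h (env_view (a + int 0) \<omega>) * indicator {\<omega>. \<forall>t\<in>{a..a + int 0}. env_view t \<omega> \<in> C t} \<omega>
      = h (env_view a \<omega>) * indicator (C a) (env_view a \<omega>)" for \<omega>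
    by (simp add: indicator_def)
  ultimately show ?case
    by (intro bexI[of _ "\<lambda>z. h z * indicator (C a) z"]) (auto simp: indicator_def)
next
  case (Suc N)
  let ?t = "a + int (Suc N)"
  define h1 where "h1 = (\<lambda>z. h z * indicator (C ?t) z)"
  note [measurable] = Suc.prems C
  have h1: "h1 \<in> borel_measurable pair_env" unfolding h1_def by measurable
  obtain g where g: "g \<in> borel_measurable pair_env" "(\<forall>z. transop h1 z \<le> 1) \<Longrightarrow> (\<forall>z. g z \<le> 1)"
    and rep: "\<And>\<rho>. sets \<rho> = sets chain_space \<Longrightarrow> (\<forall>t\<in>{a<..a + int N}. markov_at \<rho> t) \<Longrightarrow>
      (\<integral>\<^sup>+\<omega>. transop h1 (env_view (a + int N) \<omega>) * indicator {\<omega>. \<forall>t\<in>{a..a + int N}. env_view t \<omega> \<in> C t} \<omega> \<partial>\<rho>)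
      = (\<integral>\<^sup>+\<omega>. g (env_view a \<omega>) \<partial>\<rho>)"
    using Suc.IH[OF transop_measurable[OF h1]] by blast
  show ?case
  proof (intro bexI[of _ g] conjI impI allI g(1))
    fix z assume "\<forall>z. h z \<le> 1"
    then have "h1 z \<le> 1" for z by (cases z) (auto simp: h1_def indicator_def)
    then show "g z \<le> 1" using g(2) transop_le_1 by blast
  next
    fix \<rho> :: "(int \<Rightarrow> 'e \<times> 'f) measure"
    assume s: "sets \<rho> = sets chain_space" and m: "\<forall>t\<in>{a<..?t}. markov_at \<rho> t"
    let ?S = "{\<omega>. \<forall>t\<in>{a..a + int N}. env_view t \<omega> \<in> C t}"
    have "?S = (\<Inter>t\<in>{a..a + int N}. env_view t -` C t \<inter> space (past ?t))" by auto
    also have "\<dots> \<in> sets (past ?t)"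
    proof (rule sets.finite_INT)
      fix t assume "t \<in> {a..a + int N}"
      then show "env_view t -` C t \<inter> space (past ?t) \<in> sets (past ?t)"
        by (intro measurable_sets[OF past_env_view C]) simp
    qed auto
    finally have S: "?S \<in> sets (past ?t)" .
    have "{a..?t} = insert ?t {a..a + int N}" by auto
    then have "(\<integral>\<^sup>+\<omega>. h (env_view ?t \<omega>) * indicator {\<omega>. \<forall>t\<in>{a..?t}. env_view t \<omega> \<in> C t} \<omega> \<partial>\<rho>)
        = (\<integral>\<^sup>+\<omega>. h1 (env_view ?t \<omega>) * indicator ?S \<omega> \<partial>\<rho>)"
      by (intro nn_integral_cong) (auto simp: h1_def indicator_def)
    also have "\<dots> = (\<integral>\<^sup>+\<omega>. transop h1 (env_view (?t - 1) \<omega>) * indicator ?S \<omega> \<partial>\<rho>)"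
      using m S h1 by (intro markov_atD) auto
    also have "?t - 1 = a + int N" by simp
    also have "(\<integral>\<^sup>+\<omega>. transop h1 (env_view (a + int N) \<omega>) * indicator ?S \<omega> \<partial>\<rho>) = (\<integral>\<^sup>+\<omega>. g (env_view a \<omega>) \<partial>\<rho>)"
      using m by (intro rep s) auto
    finally show "(\<integral>\<^sup>+\<omega>. h (env_view ?t \<omega>) * indicator {\<omega>. \<forall>t\<in>{a..?t}. env_view t \<omega> \<in> C t} \<omega> \<partial>\<rho>)
        = (\<integral>\<^sup>+\<omega>. g (env_view a \<omega>) \<partial>\<rho>)" .
  qed
qed

lemma emeasure_window:
  assumes C: "\<And>t. C t \<in> sets pair_env"
  shows "\<exists>g\<in>borel_measurable pair_env. (\<forall>z. g z \<le> 1) \<and>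
    (\<forall>\<rho>. sets \<rho> = sets chain_space \<longrightarrow> (\<forall>t\<in>{- int n<..int n}. markov_at \<rho> t) \<longrightarrow>
      emeasure \<rho> {\<omega>. \<forall>t\<in>{- int n..int n}. env_view t \<omega> \<in> C t} = (\<integral>\<^sup>+z. g z \<partial>distr \<rho> pair_env (env_view (- int n))))"
proof -
  obtain g where g: "g \<in> borel_measurable pair_env" "\<forall>z. g z \<le> 1"
    and rep: "\<And>\<rho>. sets \<rho> = sets chain_space \<Longrightarrow> (\<forall>t\<in>{- int n<..int n}. markov_at \<rho> t) \<Longrightarrow>
      (\<integral>\<^sup>+\<omega>. 1 * indicator {\<omega>. \<forall>t\<in>{- int n..int n}. env_view t \<omega> \<in> C t} \<omega> \<partial>\<rho>)
      = (\<integral>\<^sup>+\<omega>. g (env_view (- int n) \<omega>) \<partial>\<rho>)"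
    using cylinder_representation[of C "\<lambda>_. 1" "- int n" "2 * n", OF C] by auto
  show ?thesis
  proof (intro bexI[of _ g] conjI allI impI g(1))
    fix \<rho> :: "(int \<Rightarrow> 'e \<times> 'f) measure"
    assume s: "sets \<rho> = sets chain_space" and m: "\<forall>t\<in>{- int n<..int n}. markov_at \<rho> t"
    note [measurable_cong] = s
    show "emeasure \<rho> {\<omega>. \<forall>t\<in>{- int n..int n}. env_view t \<omega> \<in> C t} =
        (\<integral>\<^sup>+z. g z \<partial>distr \<rho> pair_env (env_view (- int n)))"
      using rep[OF s m] g(1) window_set[of C, OF C] s by (subst nn_integral_distr) auto
  qed (use g in blast)
qed

lemma markov_iterate:
  assumes s: "sets \<rho> = sets chain_space" and m: "\<And>t. markov_at \<rho> t"
  shows "f \<in> borel_measurable pair_env \<Longrightarrow>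
    (\<integral>\<^sup>+z. f z \<partial>distr \<rho> pair_env (env_view t)) = (\<integral>\<^sup>+z. (transop ^^ k) f z \<partial>distr \<rho> pair_env (env_view (t - int k)))"
proof (induction k arbitrary: f)
  case (Suc k)
  note [measurable_cong] = s
  have tm: "(transop ^^ k) f \<in> borel_measurable pair_env" using Suc.prems by simp
  have "(\<integral>\<^sup>+z. (transop ^^ k) f z \<partial>distr \<rho> pair_env (env_view (t - int k)))
      = (\<integral>\<^sup>+\<omega>. (transop ^^ k) f (env_view (t - int k) \<omega>) * indicator UNIV \<omega> \<partial>\<rho>)"
    using tm by (subst nn_integral_distr) auto
  also have "\<dots> = (\<integral>\<^sup>+\<omega>. transop ((transop ^^ k) f) (env_view (t - int k - 1) \<omega>) * indicator UNIV \<omega> \<partial>\<rho>)"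
    using sets.top[of "past (t - int k) :: (int \<Rightarrow> 'e \<times> 'f) measure"] by (intro markov_atD m tm) simp
  also have "\<dots> = (\<integral>\<^sup>+z. (transop ^^ Suc k) f z \<partial>distr \<rho> pair_env (env_view (t - int (Suc k))))"
    using transop_measurable[OF tm] by (subst nn_integral_distr) (auto simp: algebra_simps)
  finally show ?case using Suc by simp
qed simp

end

section \<open>Uniqueness of measures with the Markov property and tight states\<close>

context drift_kernel
begin

text \<open>The hypotheses of \<open>contraction\<close> at every time. The tail bound must be
  uniform in time because it is used at times receding to minus infinity.\<close>

definition controlled :: "(int \<Rightarrow> 'e \<times> 'f) measure \<Rightarrow> bool" where
  "controlled \<rho> \<longleftrightarrow> sets \<rho> = sets chain_space \<and> (\<forall>t. markov_at \<rho> t) \<and>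
     (\<forall>t. env_dominated (distr \<rho> pair_env (env_view t))) \<and>
     (\<forall>\<gamma>>0. \<exists>R. \<forall>t. tail_le R \<gamma> (distr \<rho> pair_env (env_view t)))"

text \<open>The mass of a cylinder is the integral of a k-step iterate against the law at a time k
  steps before the window. For large k the state at that time may be replaced by \<open>y0\<close>,
  and what is left depends on the environment marginal alone.\<close>

lemma controlled_unique:
  assumes c1: "controlled \<rho>1" and c2: "controlled \<rho>2"
    and env: "\<And>t. distr \<rho>1 env_space (\<lambda>\<omega>. snd (env_view t \<omega>)) = distr \<rho>2 env_space (\<lambda>\<omega>. snd (env_view t \<omega>))"
  shows "\<rho>1 = \<rho>2"
proof (rule measure_eqI_generator_eq)
  have s: "sets \<rho>1 = sets chain_space" "sets \<rho>2 = sets chain_space"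
    using c1 c2 by (auto simp: controlled_def)
  note [measurable_cong] = s
  show "Int_stable (cylinders :: (int \<Rightarrow> 'e \<times> 'f) set set)" by (rule Int_stable_cylinders)
  show "cylinders \<subseteq> Pow (UNIV :: (int \<Rightarrow> 'e \<times> 'f) set)" by simp
  show "sets \<rho>1 = sigma_sets UNIV cylinders" "sets \<rho>2 = sigma_sets UNIV cylinders"
    using s sets_chain_space_cylinders by simp_all
  show "range (\<lambda>_::nat. UNIV :: (int \<Rightarrow> 'e \<times> 'f) set) \<subseteq> cylinders"
    using UNIV_cylinders by auto
  have fin: "finite_measure \<rho>" if "controlled \<rho>" for \<rho>
  proof -
    have sr: "sets \<rho> = sets chain_space" using that by (simp add: controlled_def)
    note [measurable_cong] = sr
    have "finite_measure (distr \<rho> pair_env (env_view 0))"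
      using that by (intro env_dominated_finite) (simp add: controlled_def)
    then have "emeasure (distr \<rho> pair_env (env_view 0)) UNIV \<noteq> \<infinity>"
      using finite_measure.emeasure_finite by auto
    moreover have "emeasure (distr \<rho> pair_env (env_view 0)) UNIV = emeasure \<rho> (space \<rho>)"
      using sets.top[of "pair_env :: ('e \<times> (int \<Rightarrow> 'f)) measure"] by (subst emeasure_distr) auto
    ultimately show ?thesis by (intro finite_measureI) simp
  qed
  interpret r1: finite_measure \<rho>1 by (rule fin[OF c1])
  interpret r2: finite_measure \<rho>2 by (rule fin[OF c2])
  show "emeasure \<rho>1 ((\<lambda>_::nat. UNIV) i) \<noteq> \<infinity>" for i by simp
  fix D :: "(int \<Rightarrow> 'e \<times> 'f) set" assume "D \<in> cylinders"
  then obtain n :: nat and C where C: "\<And>t. C t \<in> sets pair_env"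
    and D: "D = {\<omega>. \<forall>t\<in>{- int n..int n}. env_view t \<omega> \<in> C t}"
    by (rule cylinder_window) blast
  obtain g where g: "g \<in> borel_measurable pair_env" and g1: "\<And>z. g z \<le> 1"
    and rep: "\<And>\<rho>. sets \<rho> = sets chain_space \<Longrightarrow> (\<forall>t\<in>{- int n<..int n}. markov_at \<rho> t) \<Longrightarrow>
      emeasure \<rho> D = (\<integral>\<^sup>+z. g z \<partial>distr \<rho> pair_env (env_view (- int n)))"
    using emeasure_window[of C n, OF C] unfolding D by blast
  let ?nu = "\<lambda>\<rho> k. distr \<rho> pair_env (env_view (- int n - int k))"
  have val: "emeasure \<rho> D = ennreal (\<integral>z. transop_iter g k z \<partial>?nu \<rho> k)" if "controlled \<rho>" for \<rho> k
  proof -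
    have b: "env_dominated (?nu \<rho> k)" and sr: "sets \<rho> = sets chain_space" and mr: "\<And>t. markov_at \<rho> t"
      using that by (auto simp: controlled_def)
    have "emeasure \<rho> D = (\<integral>\<^sup>+z. (transop ^^ k) g z \<partial>?nu \<rho> k)"
      using rep[OF sr] mr markov_iterate[OF sr mr g, of "- int n" k] by simp
    then show ?thesis
      using env_dominated_finite(1)[OF b] g g1 by (simp add: integral_transop_iter_eq)
  qed
  have int_env: "(\<integral>z. transop_iter g k (y0, snd z) \<partial>?nu \<rho>1 k) = (\<integral>z. transop_iter g k (y0, snd z) \<partial>?nu \<rho>2 k)" for k
  proof -
    have mm: "(\<lambda>x. transop_iter g k (y0, x)) \<in> borel_measurable env_space"
      by (rule measurable_compose[OF _ transop_iter_measurable[OF g]]) measurable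
    have se: "(\<lambda>\<omega>. snd (env_view t \<omega>)) \<in> chain_space \<rightarrow>\<^sub>M env_space" for t by measurable
    have *: "(\<integral>z. transop_iter g k (y0, snd z) \<partial>?nu \<rho> k) =
        (\<integral>x. transop_iter g k (y0, x) \<partial>distr \<rho> env_space (\<lambda>\<omega>. snd (env_view (- int n - int k) \<omega>)))"
      if [measurable_cong]: "sets \<rho> = sets chain_space" for \<rho>
    proof -
      have "(\<integral>z. transop_iter g k (y0, snd z) \<partial>?nu \<rho> k) = (\<integral>\<omega>. transop_iter g k (y0, snd (env_view (- int n - int k) \<omega>)) \<partial>\<rho>)"
        by (rule integral_distr) (use mm in \<open>auto intro: measurable_compose[OF measurable_snd]\<close>)
      also have "\<dots> = (\<integral>x. transop_iter g k (y0, x) \<partial>distr \<rho> env_space (\<lambda>\<omega>. snd (env_view (- int n - int k) \<omega>)))"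
        by (rule integral_distr[symmetric, OF _ mm]) measurable
      finally show ?thesis .
    qed
    show ?thesis unfolding *[OF s(1)] *[OF s(2)] env ..
  qed
  have "\<bar>measure \<rho>1 D - measure \<rho>2 D\<bar> \<le> \<gamma>" if "0 < \<gamma>" for \<gamma>
  proof -
    \<comment> \<open>For each of the two measures one quarter covers the tail of \<open>V\<close>
      and one the contraction; the values with state \<open>y0\<close> coincide.\<close>
    have g4: "0 < \<gamma> / 4" using that by simp
    obtain R1 where R1: "\<And>t. tail_le R1 (\<gamma> / 4) (distr \<rho>1 pair_env (env_view t))"
      using c1 g4 unfolding controlled_def by blast
    obtain R2 where R2: "\<And>t. tail_le R2 (\<gamma> / 4) (distr \<rho>2 pair_env (env_view t))"
      using c2 g4 unfolding controlled_def by blast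
    have main: "\<exists>k0. \<forall>k\<ge>k0. \<bar>measure \<rho> D - (\<integral>z. transop_iter g k (y0, snd z) \<partial>?nu \<rho> k)\<bar> \<le> \<gamma> / 4 + \<gamma> / 4"
      if c: "controlled \<rho>" and R: "\<And>t. tail_le R (\<gamma> / 4) (distr \<rho> pair_env (env_view t))" for \<rho> R
    proof -
      obtain k0 where k0: "\<And>k \<rho> f. k \<ge> k0 \<Longrightarrow> env_dominated \<rho> \<Longrightarrow> f \<in> borel_measurable pair_env \<Longrightarrow> (\<And>z. f z \<le> 1) \<Longrightarrow>
        \<bar>(\<integral>z. transop_iter f k z \<partial>\<rho>) - (\<integral>z. transop_iter f k (y0, snd z) \<partial>\<rho>)\<bar> \<le> measure \<rho> {z. R < V (fst z)} + \<gamma> / 4"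
        using contraction[OF g4, of R] by blast
      have "\<bar>measure \<rho> D - (\<integral>z. transop_iter g k (y0, snd z) \<partial>?nu \<rho> k)\<bar> \<le> \<gamma> / 4 + \<gamma> / 4" if "k \<ge> k0" for k
      proof -
        have b: "env_dominated (?nu \<rho> k)" using c by (simp add: controlled_def)
        have "measure \<rho> D = (\<integral>z. transop_iter g k z \<partial>?nu \<rho> k)"
          using val[OF c, of k] by (simp add: measure_def integral_nonneg_AE transop_iter_nonneg)
        then show ?thesis
          using k0[OF that b g g1] R[of "- int n - int k"] by (simp add: tail_le_def)
      qed
      then show ?thesis by blast
    qed
    obtain k1 where k1: "\<And>k. k \<ge> k1 \<Longrightarrow> \<bar>measure \<rho>1 D - (\<integral>z. transop_iter g k (y0, snd z) \<partial>?nu \<rho>1 k)\<bar> \<le> \<gamma> / 4 + \<gamma> / 4"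
      using main[OF c1 R1] by blast
    obtain k2 where k2: "\<And>k. k \<ge> k2 \<Longrightarrow> \<bar>measure \<rho>2 D - (\<integral>z. transop_iter g k (y0, snd z) \<partial>?nu \<rho>2 k)\<bar> \<le> \<gamma> / 4 + \<gamma> / 4"
      using main[OF c2 R2] by blast
    show ?thesis
      using k1[OF max.cobounded1[of k1 k2]] k2[OF max.cobounded2[of k2 k1]] int_env[of "max k1 k2"]
      by (simp only:) linarith
  qed
  then have "\<bar>measure \<rho>1 D - measure \<rho>2 D\<bar> \<le> 0"
    by (rule field_le_epsilon[of _ 0, simplified])
  then show "emeasure \<rho>1 D = emeasure \<rho>2 D"
    by (simp add: r1.emeasure_eq_measure r2.emeasure_eq_measure)
qed simp

end

section \<open>Two-sided chains\<close>

text \<open>The extension theorem asks for Polish coordinates; here the coordinates are the pairs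
  (Y_t, X_t).\<close>

instance prod :: (polish_space, polish_space) polish_space ..

text \<open>The chain is grown by overwriting one state of a complete two-sided path. All finite
  stages then live on the same space and carry the whole environment from the beginning.\<close>

definition path_put :: "int \<Rightarrow> (int \<Rightarrow> 'e \<times> 'f) \<Rightarrow> 'e \<Rightarrow> int \<Rightarrow> 'e \<times> 'f" where
  "path_put t \<omega> y = fun_upd \<omega> t (y, snd (\<omega> t))"

lemma path_put_simps [simp]:
  "fst (path_put t \<omega> y s) = (if s = t then y else fst (\<omega> s))" "snd (path_put t \<omega> y s) = snd (\<omega> s)"
  by (simp_all add: path_put_def)

lemma env_view_put: "s \<noteq> t \<Longrightarrow> env_view s (path_put t \<omega> y) = env_view s \<omega>"
  "env_view t (path_put t \<omega> y) = (y, snd (env_view t \<omega>))"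
  by (simp_all add: env_view_def)

lemma path_put_measurable:
  "case_prod (path_put t) \<in> chain_space \<Otimes>\<^sub>M borel \<rightarrow>\<^sub>M chain_space"
proof -
  have "(\<lambda>p s. path_put t (fst p) (snd p) s) \<in> chain_space \<Otimes>\<^sub>M borel \<rightarrow>\<^sub>M chain_space"
  proof (rule measurable_PiM_single')
    fix s :: int
    have "(\<lambda>p. (if s = t then snd p else fst (fst p s), snd (fst p s))) \<in> chain_space \<Otimes>\<^sub>M borel \<rightarrow>\<^sub>M borel \<Otimes>\<^sub>M borel"
      by (intro measurable_Pair measurable_If) (auto intro: measurable_compose[OF measurable_fst])
    also have "(\<lambda>p. (if s = t then snd p else fst (fst p s), snd (fst p s))) = (\<lambda>p. path_put t (fst p) (snd p) s)"
      by (auto simp: path_put_def)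
    finally show "(\<lambda>p. path_put t (fst p) (snd p) s) \<in> chain_space \<Otimes>\<^sub>M borel \<rightarrow>\<^sub>M borel \<Otimes>\<^sub>M borel" .
  qed (auto simp: space_pair_measure)
  then show ?thesis by (simp add: case_prod_beta')
qed

lemma path_put_measurable2: "path_put t \<omega> \<in> borel \<rightarrow>\<^sub>M chain_space"
  using measurable_compose[OF measurable_Pair1'[of \<omega> chain_space borel] path_put_measurable[of t]] by simp

text \<open>The generators of \<open>past s\<close> read states strictly before s <= t, and
  overwriting leaves the environment alone.\<close>

lemma path_put_past:
  assumes "S \<in> sets (past s)" "s \<le> t"
  shows "path_put t \<omega> y \<in> S \<longleftrightarrow> \<omega> \<in> S"
  using assms(1) unfolding sets_past
  by (induction S rule: sigma_sets.induct) (use \<open>s \<le> t\<close> in auto)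

section \<open>Kolmogorov extension along symmetric windows\<close>

lemma restrict_window_measurable:
  "(\<lambda>\<omega>. restrict \<omega> J) \<in> path_space S \<rightarrow>\<^sub>M PiM J (\<lambda>_. S)"
  by (rule measurable_restrict_subset) simp

text \<open>Each \<open>q n\<close> lives on full paths but is meaningful only on the window
  [-n, n]. The law for a finite index set J is read off from any \<open>q n\<close> whose window
  contains J; agreement on rectangles makes the choice immaterial and yields a projective
  family.\<close>

lemma kolmogorov_int:
  fixes q :: "nat \<Rightarrow> (int \<Rightarrow> 'a::polish_space) measure"
  assumes prob: "\<And>n. prob_space (q n)" and sets: "\<And>n. sets (q n) = sets (path_space borel)"
    and consistent: "\<And>n m A. n \<le> m \<Longrightarrow> (\<And>t. A t \<in> sets borel) \<Longrightarrow>
      emeasure (q m) {\<omega>. \<forall>t\<in>{- int n..int n}. \<omega> t \<in> A t} = emeasure (q n) {\<omega>. \<forall>t\<in>{- int n..int n}. \<omega> t \<in> A t}"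
  shows "\<exists>Q. prob_space Q \<and> sets Q = sets (path_space borel) \<and>
    (\<forall>n. distr Q (PiM {- int n..int n} (\<lambda>_. borel)) (\<lambda>\<omega>. restrict \<omega> {- int n..int n}) =
      distr (q n) (PiM {- int n..int n} (\<lambda>_. borel)) (\<lambda>\<omega>. restrict \<omega> {- int n..int n}))"
proof -
  interpret q: prob_space "q n" for n by (rule prob)
  have space: "space (q n) = UNIV" for n
    using sets_eq_imp_space_eq[OF sets[of n]] by (simp add: space_PiM)
  have rm: "(\<lambda>\<omega>. restrict \<omega> J) \<in> q n \<rightarrow>\<^sub>M PiM J (\<lambda>_. borel)" for n J
    using restrict_window_measurable sets by (simp cong: measurable_cong_sets)
  have agree: "distr (q m) (PiM J (\<lambda>_. borel)) (\<lambda>\<omega>. restrict \<omega> J) = distr (q n) (PiM J (\<lambda>_. borel)) (\<lambda>\<omega>. restrict \<omega> J)"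
    if J: "J \<subseteq> {- int n..int n}" and nm: "n \<le> m" for J n m
  proof (rule measure_eqI_PiM_infinite)
    show "finite_measure (distr (q m) (PiM J (\<lambda>_. borel)) (\<lambda>\<omega>. restrict \<omega> J))"
      by (intro prob_space.finite_measure q.prob_space_distr rm)
    fix A :: "int \<Rightarrow> 'a set" and J' assume J': "finite J'" "J' \<subseteq> J" and A: "\<And>i. i \<in> J' \<Longrightarrow> A i \<in> sets borel"
    \<comment> \<open>Padding with \<open>UNIV\<close> turns a rectangle over \<open>J'\<close> into
      one over the whole window.\<close>
    define A' where "A' t = (if t \<in> J' then A t else UNIV)" for t
    let ?X = "prod_emb J (\<lambda>_. borel) J' (Pi\<^sub>E J' A)"
    have X: "?X \<in> sets (PiM J (\<lambda>_. borel))"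
      using J' A by (intro measurable_prod_emb sets_PiM_I_finite) auto
    have "(\<lambda>\<omega>. restrict \<omega> J) -` ?X = {\<omega>. \<forall>t\<in>{- int n..int n}. \<omega> t \<in> A' t}"
      using J J' by (force simp: prod_emb_def space_PiM A'_def PiE_iff restrict_def extensional_def)
    then show "emeasure (distr (q m) (PiM J (\<lambda>_. borel)) (\<lambda>\<omega>. restrict \<omega> J)) ?X =
        emeasure (distr (q n) (PiM J (\<lambda>_. borel)) (\<lambda>\<omega>. restrict \<omega> J)) ?X"
      using A consistent[OF nm, of A'] by (simp add: emeasure_distr[OF rm X] space A'_def)
  qed simp_all
  \<comment> \<open>Half-width of a symmetric window around \<open>J\<close>; the inserted 0 covers
    the empty index set.\<close>
  define k where "k J = Max (insert 0 ((\<lambda>j. nat \<bar>j\<bar>) ` J))" for J :: "int set"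
  have kJ: "J \<subseteq> {- int (k J)..int (k J)}" if "finite J" for J
  proof
    fix j assume "j \<in> J"
    then have "nat \<bar>j\<bar> \<le> k J" unfolding k_def using that by (intro Max_ge) auto
    then show "j \<in> {- int (k J)..int (k J)}" by auto
  qed
  have k_mono: "k J \<le> k H" if "J \<subseteq> H" "finite H" for J H
    unfolding k_def using that by (intro Max_mono) auto
  define P where "P J = distr (q (k J)) (PiM J (\<lambda>_. borel)) (\<lambda>\<omega>. restrict \<omega> J)" for J
  have P_restrict: "P J = distr (P H) (PiM J (\<lambda>_. borel)) (\<lambda>f. restrict f J)"
    if JH: "J \<subseteq> H" "finite H" for J H
  proof -
    have "distr (P H) (PiM J (\<lambda>_. borel)) (\<lambda>f. restrict f J) =
        distr (q (k H)) (PiM J (\<lambda>_. borel)) ((\<lambda>f. restrict f J) \<circ> (\<lambda>\<omega>. restrict \<omega> H))"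
      unfolding P_def by (rule distr_distr[OF measurable_restrict_subset[OF JH(1)] rm])
    also have "(\<lambda>f. restrict f J) \<circ> (\<lambda>\<omega>. restrict \<omega> H) = (\<lambda>\<omega>. restrict \<omega> J :: int \<Rightarrow> 'a)"
      using JH(1) by (auto simp: fun_eq_iff restrict_def)
    also have "distr (q (k H)) (PiM J (\<lambda>_. borel)) (\<lambda>\<omega>. restrict \<omega> J) = P J"
      unfolding P_def using JH by (intro agree kJ k_mono) (auto intro: finite_subset)
    finally show ?thesis by (rule sym)
  qed
  have P_prob: "prob_space (P J)" for J
    unfolding P_def by (intro q.prob_space_distr rm)
  interpret polish_projective UNIV P
    by (intro polish_projective.intro projective_family.intro P_restrict P_prob)
  have rl: "(\<lambda>\<omega>. restrict \<omega> J) \<in> lim \<rightarrow>\<^sub>M PiM J (\<lambda>_. borel)" for J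
    using restrict_window_measurable by (simp cong: measurable_cong_sets)
  show ?thesis
  proof (intro exI[of _ lim] conjI allI)
    show "prob_space lim" by (rule P.prob_space_axioms)
    show "sets lim = sets (path_space borel)" by simp
    fix n :: nat
    let ?J = "{- int n..int n}"
    have "distr lim (PiM ?J (\<lambda>_. borel)) (\<lambda>\<omega>. restrict \<omega> ?J) = P ?J"
    proof (rule measure_eqI)
      show "sets (distr lim (PiM ?J (\<lambda>_. borel)) (\<lambda>\<omega>. restrict \<omega> ?J)) = sets (P ?J)" by (simp add: P_def)
      fix X assume "X \<in> sets (distr lim (PiM ?J (\<lambda>_. borel)) (\<lambda>\<omega>. restrict \<omega> ?J))"
      then have X: "X \<in> sets (PiM ?J (\<lambda>_. borel))" by simp
      have "emeasure (distr lim (PiM ?J (\<lambda>_. borel)) (\<lambda>\<omega>. restrict \<omega> ?J)) X = emeasure lim (emb UNIV ?J X)"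
        by (simp add: emeasure_distr[OF rl X] prod_emb_def space_PiM)
      also have "\<dots> = emeasure (P ?J) X" using X by (intro emeasure_lim_emb) auto
      finally show "emeasure (distr lim (PiM ?J (\<lambda>_. borel)) (\<lambda>\<omega>. restrict \<omega> ?J)) X = emeasure (P ?J) X" .
    qed
    also have "\<dots> = distr (q n) (PiM ?J (\<lambda>_. borel)) (\<lambda>\<omega>. restrict \<omega> ?J)"
    proof -
      have "k ?J \<le> n" unfolding k_def by (subst Max_le_iff) auto
      then show ?thesis unfolding P_def by (intro agree[symmetric] kJ) auto
    qed
    finally show "distr lim (PiM ?J (\<lambda>_. borel)) (\<lambda>\<omega>. restrict \<omega> ?J) =
      distr (q n) (PiM ?J (\<lambda>_. borel)) (\<lambda>\<omega>. restrict \<omega> ?J)" .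
  qed
qed

lemma pair_env_cylinder:
  assumes A [measurable]: "A \<in> sets borel" and K: "finite K" and B [measurable]: "\<And>s. B s \<in> sets borel"
  shows "{z. fst z \<in> A \<and> (\<forall>s\<in>K. snd z s \<in> B s)} \<in> sets (pair_env :: ('e::polish_space \<times> (int \<Rightarrow> 'f::polish_space)) measure)"
proof -
  have "{z\<in>space pair_env. snd z s \<in> B s} \<in> sets (pair_env :: ('e \<times> (int \<Rightarrow> 'f)) measure)" for s
    by measurable
  then have "{z\<in>space pair_env. \<forall>s\<in>K. snd z s \<in> B s} \<in> sets (pair_env :: ('e \<times> (int \<Rightarrow> 'f)) measure)"
    using K by (intro sets.sets_Collect_finite_All)
  moreover have "{z\<in>space pair_env. fst z \<in> A} \<in> sets (pair_env :: ('e \<times> (int \<Rightarrow> 'f)) measure)" by measurable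
  ultimately have "{z\<in>space pair_env. fst z \<in> A} \<inter> {z\<in>space pair_env. \<forall>s\<in>K. snd z s \<in> B s}
      \<in> sets (pair_env :: ('e \<times> (int \<Rightarrow> 'f)) measure)" by blast
  also have "{z\<in>space pair_env. fst z \<in> A} \<inter> {z\<in>space pair_env. \<forall>s\<in>K. snd z s \<in> B s} =
      {z. fst z \<in> A \<and> (\<forall>s\<in>K. snd z s \<in> B s)}" by auto
  finally show ?thesis .
qed

text \<open>The law of \<open>env_view t\<close> involves the entire environment, which no finite
  window sees. The sets used here depend on finitely many coordinates, so each of them is visible in
  some window.\<close>

lemma pair_env_eqI:
  fixes M N :: "('e::polish_space \<times> (int \<Rightarrow> 'f::polish_space)) measure"
  assumes M: "finite_measure M" "sets M = sets pair_env" and N: "sets N = sets pair_env"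
    and eq: "\<And>A K B. A \<in> sets borel \<Longrightarrow> finite K \<Longrightarrow> (\<And>s. B s \<in> sets borel) \<Longrightarrow>
      emeasure M {z. fst z \<in> A \<and> (\<forall>s\<in>K. snd z s \<in> B s)} = emeasure N {z. fst z \<in> A \<and> (\<forall>s\<in>K. snd z s \<in> B s)}"
  shows "M = N"
proof -
  define G where "G = {{z :: 'e \<times> (int \<Rightarrow> 'f). fst z \<in> A \<and> (\<forall>s\<in>K. snd z s \<in> B s)} | A K B.
    A \<in> sets borel \<and> finite K \<and> (\<forall>s. B s \<in> sets borel)}"
  have GI: "{z. fst z \<in> A \<and> (\<forall>s\<in>K. snd z s \<in> B s)} \<in> G"
    if "A \<in> sets borel" "finite K" "\<And>s. B s \<in> sets borel" for A K B
    using that unfolding G_def by blast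
  have G_sets: "G \<subseteq> sets pair_env"
    unfolding G_def using pair_env_cylinder by blast
  define S where "S = sigma UNIV G"
  have sets_S: "sets S = sigma_sets UNIV G" by (simp add: S_def sets_measure_of)
  have space_S: "space S = UNIV" by (simp add: S_def space_measure_of_conv)
  have "(\<lambda>z. (fst z, snd z)) \<in> S \<rightarrow>\<^sub>M pair_env"
  proof (intro measurable_Pair measurable_into_env)
    show "fst \<in> S \<rightarrow>\<^sub>M borel"
    proof (rule measurableI)
      fix A :: "'e set" assume "A \<in> sets borel"
      then have "{z. fst z \<in> A \<and> (\<forall>s\<in>{}. snd z s \<in> UNIV)} \<in> sigma_sets UNIV G"
        by (intro sigma_sets.Basic GI) auto
      then show "fst -` A \<inter> space S \<in> sets S" by (simp add: sets_S space_S vimage_def)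
    qed simp
    show "(\<lambda>z. snd z s) \<in> S \<rightarrow>\<^sub>M borel" for s
    proof (rule measurableI)
      fix B :: "'f set" assume "B \<in> sets borel"
      then have "{z. fst z \<in> UNIV \<and> (\<forall>s\<in>{s}. snd z s \<in> B)} \<in> sigma_sets UNIV G"
        by (intro sigma_sets.Basic GI) auto
      then show "(\<lambda>z. snd z s) -` B \<inter> space S \<in> sets S" by (simp add: sets_S space_S vimage_def)
    qed simp
  qed
  then have id: "(\<lambda>z. z) \<in> S \<rightarrow>\<^sub>M pair_env" by simp
  have sets_eq: "sets pair_env = sigma_sets UNIV G"
  proof
    show "sets pair_env \<subseteq> sigma_sets UNIV G"
      using measurable_sets[OF id] by (auto simp: sets_S space_S)
    show "sigma_sets UNIV G \<subseteq> sets pair_env"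
      using sets.sigma_sets_subset[OF G_sets] by simp
  qed
  show ?thesis
  proof (rule measure_eqI_generator_eq)
    show "Int_stable G"
    proof (rule Int_stableI)
      fix a b assume "a \<in> G" "b \<in> G"
      then obtain A K B A' K' B' where a: "a = {z. fst z \<in> A \<and> (\<forall>s\<in>K. snd z s \<in> B s)}"
        and b: "b = {z. fst z \<in> A' \<and> (\<forall>s\<in>K'. snd z s \<in> B' s)}"
        and sets: "A \<in> sets borel" "A' \<in> sets borel" "finite K" "finite K'" "\<And>s. B s \<in> sets borel" "\<And>s. B' s \<in> sets borel"
        unfolding G_def by blast
      have "a \<inter> b = {z. fst z \<in> A \<inter> A' \<and>
          (\<forall>s\<in>K \<union> K'. snd z s \<in> (if s \<in> K then B s else UNIV) \<inter> (if s \<in> K' then B' s else UNIV))}"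
        unfolding a b by auto
      also have "\<dots> \<in> G" using sets by (intro GI) auto
      finally show "a \<inter> b \<in> G" .
    qed
    show "G \<subseteq> Pow UNIV" by simp
    show "sets M = sigma_sets UNIV G" "sets N = sigma_sets UNIV G" using M N sets_eq by simp_all
    have "{z. fst z \<in> UNIV \<and> (\<forall>s\<in>{}. snd z s \<in> UNIV)} \<in> G" by (intro GI) auto
    then have "UNIV \<in> G" by simp
    then show "range (\<lambda>_::nat. UNIV) \<subseteq> G" by auto
    show "emeasure M ((\<lambda>_::nat. UNIV) i) \<noteq> \<infinity>" for i using finite_measure.emeasure_finite[OF M(1)] by simp
    fix X assume "X \<in> G" then show "emeasure M X = emeasure N X" unfolding G_def using eq by blast
  qed simp
qed

section \<open>Construction of the chain from an invariant law\<close>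

context random_kernel
begin

definition extend :: "int \<Rightarrow> (int \<Rightarrow> 'e \<times> 'f) \<Rightarrow> (int \<Rightarrow> 'e \<times> 'f) measure" where
  "extend t \<omega> = distr (P (snd (\<omega> (t - 1))) (fst (\<omega> (t - 1)))) chain_space (path_put t \<omega>)"

lemma extend_kernel: "extend t \<in> chain_space \<rightarrow>\<^sub>M subprob_algebra chain_space"
proof -
  have "(\<lambda>\<omega>. P (snd (env_view (t - 1) \<omega>) 0) (fst (env_view (t - 1) \<omega>))) \<in> chain_space \<rightarrow>\<^sub>M subprob_algebra borel"
    by (rule measurable_compose[OF env_view_measurable P_kernel])
  then have "(\<lambda>\<omega>. P (snd (\<omega> (t - 1))) (fst (\<omega> (t - 1)))) \<in> chain_space \<rightarrow>\<^sub>M subprob_algebra borel"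
    by simp
  then show ?thesis
    unfolding extend_def[abs_def] by (rule measurable_distr2[OF path_put_measurable])
qed

lemma nn_integral_bind_extend:
  assumes s: "sets \<rho> = sets chain_space" and F: "F \<in> borel_measurable chain_space"
  shows "(\<integral>\<^sup>+\<omega>. F \<omega> \<partial>(\<rho> \<bind> extend t)) =
    (\<integral>\<^sup>+\<omega>. \<integral>\<^sup>+y. F (path_put t \<omega> y) \<partial>P (snd (\<omega> (t - 1))) (fst (\<omega> (t - 1))) \<partial>\<rho>)"
proof -
  have "extend t \<in> \<rho> \<rightarrow>\<^sub>M subprob_algebra chain_space"
    using extend_kernel s by (simp cong: measurable_cong_sets)
  moreover have "(\<integral>\<^sup>+\<omega>'. F \<omega>' \<partial>extend t \<omega>) = (\<integral>\<^sup>+y. F (path_put t \<omega> y) \<partial>P (snd (\<omega> (t - 1))) (fst (\<omega> (t - 1))))" for \<omega>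
    unfolding extend_def using F
    by (subst nn_integral_distr) (auto simp: path_put_measurable2 cong: measurable_cong_sets)
  ultimately show ?thesis by (simp add: nn_integral_bind[OF F])
qed

lemma emeasure_P_UNIV [simp]: "emeasure (P x y) UNIV = 1"
  using prob_space.emeasure_space_1[OF prob_P, of x y] by simp

text \<open>In the induction step the state at the new last time is drawn from the kernel given the
  complete path. The draw uses the path only at the preceding time, so the Markov identity holds
  against the whole past, dummy coordinates before \<open>a\<close> included. Invariance of \<mu>
  keeps the one-time law.\<close>

lemma one_sided_chain:
  assumes mu: "prob_space \<mu>" and smu: "sets \<mu> = sets pair_env" and inv: "\<mu> \<bind> trans = \<mu>"
  shows "\<exists>\<rho>. prob_space \<rho> \<and> sets \<rho> = sets chain_space \<and>
    (\<forall>t\<in>{a..a + int N}. distr \<rho> pair_env (env_view t) = \<mu>) \<and> (\<forall>t\<in>{a<..a + int N}. markov_at \<rho> t)"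
proof (induction N)
  case 0
  \<comment> \<open>The state is a dummy at all times except \<open>a\<close>; the index
    \<open>s - a\<close> undoes the re-centring in \<open>env_view a\<close>.\<close>
  let ?g = "\<lambda>z s. (fst z, snd z (s - a))"
  have g: "?g \<in> \<mu> \<rightarrow>\<^sub>M chain_space"
  proof (rule measurable_PiM_single')
    show "(\<lambda>z. (fst z, snd z (s - a))) \<in> \<mu> \<rightarrow>\<^sub>M borel \<Otimes>\<^sub>M borel" for s
      using smu by (simp cong: measurable_cong_sets)
  qed (auto simp: space_pair_measure)
  define \<rho> where "\<rho> = distr \<mu> chain_space ?g"
  have "distr \<rho> pair_env (env_view a) = distr \<mu> pair_env (env_view a \<circ> ?g)"
    unfolding \<rho>_def by (rule distr_distr[OF env_view_measurable g])
  also have "env_view a \<circ> ?g = (\<lambda>z. z)" by (auto simp: env_view_def)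
  also have "distr \<mu> pair_env (\<lambda>z. z) = \<mu>" by (rule distr_id2[OF smu[symmetric]])
  finally have "distr \<rho> pair_env (env_view a) = \<mu>" .
  moreover have "prob_space \<rho>" unfolding \<rho>_def by (rule prob_space.prob_space_distr[OF mu g])
  ultimately show ?case by (intro exI[of _ \<rho>]) (auto simp: \<rho>_def)
next
  case (Suc N)
  let ?t = "a + int (Suc N)"
  obtain \<rho> where pr: "prob_space \<rho>" and s: "sets \<rho> = sets chain_space"
    and law: "\<And>t. t \<in> {a..a + int N} \<Longrightarrow> distr \<rho> pair_env (env_view t) = \<mu>"
    and mk: "\<And>t. t \<in> {a<..a + int N} \<Longrightarrow> markov_at \<rho> t"
    using Suc by blast
  interpret pr: prob_space \<rho> by (rule pr)
  have space: "space \<rho> = UNIV" using sets_eq_imp_space_eq[OF s] by simp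
  note [measurable_cong] = s
  define \<rho>' where "\<rho>' = \<rho> \<bind> extend ?t"
  have s': "sets \<rho>' = sets chain_space"
    unfolding \<rho>'_def using pr.not_empty by (intro sets_bind) (simp_all add: extend_def)
  note [measurable_cong] = s'
  have "extend ?t \<in> \<rho> \<rightarrow>\<^sub>M subprob_algebra chain_space"
    using extend_kernel s by (simp cong: measurable_cong_sets)
  moreover have "prob_space (extend ?t \<omega>)" for \<omega>
    unfolding extend_def
    by (rule prob_space.prob_space_distr[OF prob_P]) (simp add: path_put_measurable2 cong: measurable_cong_sets)
  ultimately have pr': "prob_space \<rho>'"
    unfolding \<rho>'_def by (intro pr.prob_space_bind) auto
  note ext = nn_integral_bind_extend[OF s, of _ ?t, folded \<rho>'_def]
  have ms: "(\<lambda>\<omega>. f (env_view u \<omega>) * indicator S \<omega>) \<in> borel_measurable chain_space"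
    if "f \<in> borel_measurable pair_env" "S \<in> sets (past v)"
    for f :: "'e \<times> (int \<Rightarrow> 'f) \<Rightarrow> ennreal" and u v and S :: "(int \<Rightarrow> 'e \<times> 'f) set"
    using that sets_past_subset by (intro env_view_indicator_measurable) auto
  \<comment> \<open>Redrawing the state at \<open>?t\<close> changes neither earlier views nor
    events of the past of \<open>?t\<close>.\<close>
  have old: "(\<integral>\<^sup>+\<omega>. f (env_view u \<omega>) * indicator S \<omega> \<partial>\<rho>') = (\<integral>\<^sup>+\<omega>. f (env_view u \<omega>) * indicator S \<omega> \<partial>\<rho>)"
    if f: "f \<in> borel_measurable pair_env" and S: "S \<in> sets (past v)" and "u < ?t" "v \<le> ?t"
    for f u v and S :: "(int \<Rightarrow> 'e \<times> 'f) set"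
    using that by (subst ext[OF ms[OF f S]]) (simp add: env_view_put(1) path_put_past[OF S] indicator_def)
  have mk_t: "markov_at \<rho>' ?t"
    unfolding markov_at_def
  proof (intro ballI)
    fix S :: "(int \<Rightarrow> 'e \<times> 'f) set" and f :: "'e \<times> (int \<Rightarrow> 'f) \<Rightarrow> ennreal"
    assume S: "S \<in> sets (past ?t)" and f: "f \<in> borel_measurable pair_env"
    have fm: "(\<lambda>y. f (y, x)) \<in> borel_measurable (P x' y')" for x x' y'
      using measurable_compose[OF measurable_pair_const_env f] by (simp cong: measurable_cong_sets)
    have "(\<integral>\<^sup>+\<omega>. f (env_view ?t \<omega>) * indicator S \<omega> \<partial>\<rho>')
      = (\<integral>\<^sup>+\<omega>. (\<integral>\<^sup>+y. f (y, snd (env_view ?t \<omega>)) \<partial>P (snd (\<omega> (?t - 1))) (fst (\<omega> (?t - 1)))) * indicator S \<omega> \<partial>\<rho>)"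
      using path_put_past[OF S order_refl]
      by (subst ext[OF ms[OF f S]]) (simp add: env_view_put(2) indicator_def nn_integral_multc[OF fm] del: env_view_simps)
    also have "\<dots> = (\<integral>\<^sup>+\<omega>. transop f (env_view (?t - 1) \<omega>) * indicator S \<omega> \<partial>\<rho>)"
      by (simp add: transop_def path_shift_env_view[of ?t, simplified])
    also have "\<dots> = (\<integral>\<^sup>+\<omega>. transop f (env_view (?t - 1) \<omega>) * indicator S \<omega> \<partial>\<rho>')"
      by (rule old[symmetric, OF transop_measurable[OF f] S]) simp_all
    finally show "(\<integral>\<^sup>+\<omega>. f (env_view ?t \<omega>) * indicator S \<omega> \<partial>\<rho>') =
      (\<integral>\<^sup>+\<omega>. transop f (env_view (?t - 1) \<omega>) * indicator S \<omega> \<partial>\<rho>')" .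
  qed
  have mk_old: "markov_at \<rho>' t" if "t \<in> {a<..a + int N}" for t
    unfolding markov_at_def
  proof (intro ballI)
    fix S :: "(int \<Rightarrow> 'e \<times> 'f) set" and f :: "'e \<times> (int \<Rightarrow> 'f) \<Rightarrow> ennreal"
    assume S: "S \<in> sets (past t)" and f: "f \<in> borel_measurable pair_env"
    have "(\<integral>\<^sup>+\<omega>. f (env_view t \<omega>) * indicator S \<omega> \<partial>\<rho>') = (\<integral>\<^sup>+\<omega>. f (env_view t \<omega>) * indicator S \<omega> \<partial>\<rho>)"
      using that by (intro old[OF f S]) auto
    also have "\<dots> = (\<integral>\<^sup>+\<omega>. transop f (env_view (t - 1) \<omega>) * indicator S \<omega> \<partial>\<rho>)"
      by (rule markov_atD[OF mk[OF that] S f])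
    also have "\<dots> = (\<integral>\<^sup>+\<omega>. transop f (env_view (t - 1) \<omega>) * indicator S \<omega> \<partial>\<rho>')"
      using that by (intro old[symmetric, OF transop_measurable[OF f] S]) auto
    finally show "(\<integral>\<^sup>+\<omega>. f (env_view t \<omega>) * indicator S \<omega> \<partial>\<rho>') =
      (\<integral>\<^sup>+\<omega>. transop f (env_view (t - 1) \<omega>) * indicator S \<omega> \<partial>\<rho>')" .
  qed
  have U: "UNIV \<in> sets (past ?t :: (int \<Rightarrow> 'e \<times> 'f) measure)"
    using sets.top[of "past ?t :: (int \<Rightarrow> 'e \<times> 'f) measure"] by simp
  have em: "emeasure (distr \<rho>0 pair_env (env_view t)) E = (\<integral>\<^sup>+\<omega>. indicator E (env_view t \<omega>) * indicator UNIV \<omega> \<partial>\<rho>0)"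
    if [measurable_cong]: "sets \<rho>0 = sets chain_space" and E: "E \<in> sets pair_env" for \<rho>0 t E
  proof -
    have "emeasure (distr \<rho>0 pair_env (env_view t)) E = (\<integral>\<^sup>+z. indicator E z \<partial>distr \<rho>0 pair_env (env_view t))"
      using E by simp
    also have "\<dots> = (\<integral>\<^sup>+\<omega>. indicator E (env_view t \<omega>) \<partial>\<rho>0)"
      using E by (intro nn_integral_distr) auto
    finally show ?thesis by simp
  qed
  have law_old: "distr \<rho>' pair_env (env_view t) = \<mu>" if "t \<in> {a..a + int N}" for t
  proof (rule measure_eqI)
    fix E assume "E \<in> sets (distr \<rho>' pair_env (env_view t))"
    then have E: "E \<in> sets pair_env" by simp
    have "emeasure (distr \<rho>' pair_env (env_view t)) E = (\<integral>\<^sup>+\<omega>. indicator E (env_view t \<omega>) * indicator UNIV \<omega> \<partial>\<rho>')"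
      by (rule em[OF s' E])
    also have "\<dots> = (\<integral>\<^sup>+\<omega>. indicator E (env_view t \<omega>) * indicator UNIV \<omega> \<partial>\<rho>)"
      using that E by (intro old[OF _ U]) auto
    also have "\<dots> = emeasure \<mu> E"
      unfolding em[OF s E, symmetric] law[OF that] ..
    finally show "emeasure (distr \<rho>' pair_env (env_view t)) E = emeasure \<mu> E" .
  qed (simp add: smu)
  have law_t: "distr \<rho>' pair_env (env_view ?t) = \<mu>"
  proof (rule measure_eqI)
    fix E assume "E \<in> sets (distr \<rho>' pair_env (env_view ?t))"
    then have E: "E \<in> sets pair_env" by simp
    then have f: "indicator E \<in> borel_measurable pair_env" by simp
    have "emeasure (distr \<rho>' pair_env (env_view ?t)) E = (\<integral>\<^sup>+\<omega>. indicator E (env_view ?t \<omega>) * indicator UNIV \<omega> \<partial>\<rho>')"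
      by (rule em[OF s' E])
    also have "\<dots> = (\<integral>\<^sup>+\<omega>. transop (indicator E) (env_view (?t - 1) \<omega>) * indicator UNIV \<omega> \<partial>\<rho>')"
      by (rule markov_atD[OF mk_t U f])
    also have "\<dots> = (\<integral>\<^sup>+z. transop (indicator E) z \<partial>distr \<rho>' pair_env (env_view (a + int N)))"
      using transop_measurable[OF f] by (subst nn_integral_distr) auto
    also have "\<dots> = (\<integral>\<^sup>+z. transop (indicator E) z \<partial>\<mu>)"
      by (subst law_old) auto
    also have "\<dots> = (\<integral>\<^sup>+z. indicator E z \<partial>(\<mu> \<bind> trans))"
      by (rule nn_integral_bind_trans[OF smu f, symmetric])
    also have "\<dots> = emeasure \<mu> E" using E smu by (simp add: inv)
    finally show "emeasure (distr \<rho>' pair_env (env_view ?t)) E = emeasure \<mu> E" .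
  qed (simp add: smu)
  show ?case
  proof (intro exI[of _ \<rho>'] conjI ballI pr' s')
    fix t assume "t \<in> {a..?t}"
    then show "distr \<rho>' pair_env (env_view t) = \<mu>" using law_old[of t] law_t by (cases "t = ?t") auto
  next
    fix t assume "t \<in> {a<..?t}"
    then show "markov_at \<rho>' t" using mk_old[of t] mk_t by (cases "t = ?t") auto
  qed
qed

text \<open>The extension agrees with the finite stages on finite windows only, whereas the Markov
  property concerns the whole environment and an infinite past. For a fixed target set both sides of
  the property are finite measures of the past event, so it suffices to compare them on past events
  that some finite window decides; these generate the past.\<close>

lemma two_sided_chain:
  assumes mu: "prob_space \<mu>" and smu: "sets \<mu> = sets pair_env" and inv: "\<mu> \<bind> trans = \<mu>"
  shows "\<exists>Q. prob_space Q \<and> sets Q = sets chain_space \<and>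
    (\<forall>t. distr Q pair_env (env_view t) = \<mu>) \<and> (\<forall>t. markov_at Q t)"
proof -
  have "\<exists>\<rho>. prob_space \<rho> \<and> sets \<rho> = sets chain_space \<and>
    (\<forall>t\<in>{- int n..int n}. distr \<rho> pair_env (env_view t) = \<mu>) \<and> (\<forall>t\<in>{- int n<..int n}. markov_at \<rho> t)" for n
    using one_sided_chain[OF mu smu inv, of "- int n" "2 * n"] by simp
  then obtain q where prob_q: "\<And>n. prob_space (q n)" and sets_q: "\<And>n. sets (q n) = sets chain_space"
    and law_q: "\<And>n t. t \<in> {- int n..int n} \<Longrightarrow> distr (q n) pair_env (env_view t) = \<mu>"
    and markov_q: "\<And>n t. t \<in> {- int n<..int n} \<Longrightarrow> markov_at (q n) t"
    by metis
  have chain: "(chain_space :: (int \<Rightarrow> 'e \<times> 'f) measure) = path_space borel"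
    by (simp add: borel_prod)
  have "\<exists>Q. prob_space Q \<and> sets Q = sets (path_space borel :: (int \<Rightarrow> 'e \<times> 'f) measure) \<and>
    (\<forall>n. distr Q (PiM {- int n..int n} (\<lambda>_. borel)) (\<lambda>\<omega>. restrict \<omega> {- int n..int n}) =
      distr (q n) (PiM {- int n..int n} (\<lambda>_. borel)) (\<lambda>\<omega>. restrict \<omega> {- int n..int n}))"
  proof (rule kolmogorov_int)
    show "prob_space (q n)" for n by (rule prob_q)
    show "sets (q n) = sets (path_space borel)" for n using sets_q chain by simp
    fix n m :: nat and A :: "int \<Rightarrow> ('e \<times> 'f) set"
    assume nm: "n \<le> m" and A: "\<And>t. A t \<in> sets borel"
    define C where "C t = {z :: 'e \<times> (int \<Rightarrow> 'f). (fst z, snd z 0) \<in> A t}" for t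
    have "(\<lambda>z::'e \<times> (int \<Rightarrow> 'f). (fst z, snd z 0)) \<in> pair_env \<rightarrow>\<^sub>M borel \<Otimes>\<^sub>M borel" by measurable
    then have "(\<lambda>z::'e \<times> (int \<Rightarrow> 'f). (fst z, snd z 0)) \<in> pair_env \<rightarrow>\<^sub>M borel" by (simp add: borel_prod)
    from measurable_sets[OF this A] have C: "C t \<in> sets pair_env" for t
      by (simp add: C_def vimage_def)
    have D: "{\<omega>. \<forall>t\<in>{- int n..int n}. \<omega> t \<in> A t} = {\<omega>. \<forall>t\<in>{- int n..int n}. env_view t \<omega> \<in> C t}"
      by (simp add: C_def)
    obtain g where g: "\<And>\<rho>. sets \<rho> = sets chain_space \<Longrightarrow> (\<forall>t\<in>{- int n<..int n}. markov_at \<rho> t) \<Longrightarrow>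
      emeasure \<rho> {\<omega>. \<forall>t\<in>{- int n..int n}. env_view t \<omega> \<in> C t} = (\<integral>\<^sup>+z. g z \<partial>distr \<rho> pair_env (env_view (- int n)))"
      using emeasure_window[of C n, OF C] by blast
    have "emeasure (q m) {\<omega>. \<forall>t\<in>{- int n..int n}. env_view t \<omega> \<in> C t} = (\<integral>\<^sup>+z. g z \<partial>\<mu>)" if "n \<le> m" for m
      using that by (subst g[OF sets_q]) (auto intro: markov_q simp: law_q)
    then show "emeasure (q m) {\<omega>. \<forall>t\<in>{- int n..int n}. \<omega> t \<in> A t} = emeasure (q n) {\<omega>. \<forall>t\<in>{- int n..int n}. \<omega> t \<in> A t}"
      using nm by (simp add: D)
  qed
  then obtain Q where prob_Q: "prob_space Q" and sets_Q: "sets Q = sets chain_space"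
    and agree: "\<And>n. distr Q (PiM {- int n..int n} (\<lambda>_. borel)) (\<lambda>\<omega>. restrict \<omega> {- int n..int n}) =
      distr (q n) (PiM {- int n..int n} (\<lambda>_. borel)) (\<lambda>\<omega>. restrict \<omega> {- int n..int n})"
    unfolding chain by blast
  interpret Q: prob_space Q by (rule prob_Q)
  have space_Q: "space Q = UNIV" using sets_eq_imp_space_eq[OF sets_Q] by simp
  \<comment> \<open>Events decided by the coordinates in [-n, n].\<close>
  define F where "F n = vimage_algebra UNIV (\<lambda>\<omega>. restrict \<omega> {- int n..int n}) (PiM {- int n..int n} (\<lambda>_. borel \<Otimes>\<^sub>M borel) :: (int \<Rightarrow> 'e \<times> 'f) measure)" for n :: nat
  have space_F: "space (F n) = UNIV" for n by (simp add: F_def)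
  have restr: "(\<lambda>\<omega>. restrict \<omega> J) \<in> UNIV \<rightarrow> space (PiM J (\<lambda>_. borel \<Otimes>\<^sub>M borel) :: (int \<Rightarrow> 'e \<times> 'f) measure)" for J
    by (simp add: space_PiM space_pair_measure)
  have F_coord: "(\<lambda>\<omega>. \<omega> s) \<in> F n \<rightarrow>\<^sub>M borel \<Otimes>\<^sub>M borel" if "s \<in> {- int n..int n}" for s n
  proof -
    have "(\<lambda>\<omega>. restrict \<omega> {- int n..int n} s) \<in> F n \<rightarrow>\<^sub>M borel \<Otimes>\<^sub>M borel"
      unfolding F_def
      by (rule measurable_compose[OF measurable_vimage_algebra1[OF restr] measurable_component_singleton[OF that]])
    then show ?thesis using that by simp
  qed
  have F_mono: "sets (F n) \<subseteq> sets (F m)" if "n \<le> m" for n m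
  proof -
    have "(\<lambda>\<omega>. restrict \<omega> {- int n..int n}) \<in> F m \<rightarrow>\<^sub>M PiM {- int n..int n} (\<lambda>_. borel \<Otimes>\<^sub>M borel)"
      using that by (intro measurable_restrict F_coord) auto
    then have "(\<lambda>\<omega>. \<omega>) \<in> F m \<rightarrow>\<^sub>M F n"
      unfolding F_def[of n] by (intro measurable_vimage_algebra2) auto
    from measurable_sets[OF this] show ?thesis by (auto simp: space_F)
  qed
  have agree_sets: "emeasure Q D = emeasure (q n) D" if Dn: "D \<in> sets (F n)" for D n
  proof -
    obtain B where B: "B \<in> sets (PiM {- int n..int n} (\<lambda>_. borel \<Otimes>\<^sub>M borel))"
      and D: "D = (\<lambda>\<omega>. restrict \<omega> {- int n..int n}) -` B"
      using Dn unfolding F_def sets_vimage_algebra2[OF restr] by auto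
    have rm: "(\<lambda>\<omega>. restrict \<omega> {- int n..int n}) \<in> Q \<rightarrow>\<^sub>M PiM {- int n..int n} (\<lambda>_. borel)"
      "(\<lambda>\<omega>. restrict \<omega> {- int n..int n}) \<in> q n \<rightarrow>\<^sub>M PiM {- int n..int n} (\<lambda>_. borel)"
      using restrict_window_measurable[of "{- int n..int n}" "borel :: ('e \<times> 'f) measure"] sets_Q sets_q
      by (simp_all add: chain cong: measurable_cong_sets)
    have B': "B \<in> sets (PiM {- int n..int n} (\<lambda>_. borel))" using B by (simp add: borel_prod)
    have "space (q n) = UNIV" using sets_eq_imp_space_eq[OF sets_q] by simp
    then show ?thesis
      using arg_cong[OF agree[of n], of "\<lambda>m. emeasure m B"]
      by (simp add: emeasure_distr[OF rm(1) B'] emeasure_distr[OF rm(2) B'] space_Q D)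
  qed
  have F_sub: "sets (F n) \<subseteq> sets chain_space" for n
  proof -
    have "(\<lambda>\<omega>. \<omega>) \<in> chain_space \<rightarrow>\<^sub>M F n"
      unfolding F_def by (intro measurable_vimage_algebra2 restrict_window_measurable) auto
    from measurable_sets[OF this] show ?thesis by (auto simp: space_F)
  qed
  have agree_int: "(\<integral>\<^sup>+\<omega>. f \<omega> \<partial>Q) = (\<integral>\<^sup>+\<omega>. f \<omega> \<partial>q n)" if f: "f \<in> borel_measurable (F n)" for f n
  proof -
    have id: "(\<lambda>\<omega>. \<omega>) \<in> Q \<rightarrow>\<^sub>M F n" "(\<lambda>\<omega>. \<omega>) \<in> q n \<rightarrow>\<^sub>M F n"
      using F_sub[of n] sets_Q sets_q[of n] sets_eq_imp_space_eq[OF sets_q[of n]]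
      by (auto simp: measurable_def space_F space_Q)
    have "distr Q (F n) (\<lambda>\<omega>. \<omega>) = distr (q n) (F n) (\<lambda>\<omega>. \<omega>)"
      using agree_sets sets_eq_imp_space_eq[OF sets_q[of n]]
      by (intro measure_eqI) (auto simp: emeasure_distr id space_Q)
    then show ?thesis
      using nn_integral_distr[OF id(1), of f] nn_integral_distr[OF id(2), of f] f by simp
  qed
  have law_Q: "distr Q pair_env (env_view t) = \<mu>" for t
  proof (rule pair_env_eqI)
    have ev: "env_view t \<in> Q \<rightarrow>\<^sub>M pair_env" "env_view t \<in> q n \<rightarrow>\<^sub>M pair_env" for n
      using sets_Q sets_q by (simp_all cong: measurable_cong_sets)
    show "finite_measure (distr Q pair_env (env_view t))"
      by (intro prob_space.finite_measure Q.prob_space_distr ev)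
    show "sets (distr Q pair_env (env_view t)) = sets pair_env" "sets \<mu> = sets pair_env" by (simp_all add: smu)
    fix A :: "'e set" and K :: "int set" and B :: "int \<Rightarrow> 'f set"
    assume A: "A \<in> sets borel" and K: "finite K" and B: "\<And>s. B s \<in> sets borel"
    let ?E = "{z :: 'e \<times> (int \<Rightarrow> 'f). fst z \<in> A \<and> (\<forall>s\<in>K. snd z s \<in> B s)}"
    have "finite (insert (nat \<bar>t\<bar>) ((\<lambda>s. nat \<bar>s + t\<bar>) ` K))" using K by simp
    then obtain n where n: "\<And>u. u \<in> insert (nat \<bar>t\<bar>) ((\<lambda>s. nat \<bar>s + t\<bar>) ` K) \<Longrightarrow> u \<le> n"
      unfolding finite_nat_set_iff_bounded_le by blast
    have tn: "t \<in> {- int n..int n}" using n[of "nat \<bar>t\<bar>"] by auto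
    have sn: "s + t \<in> {- int n..int n}" if "s \<in> K" for s using n[of "nat \<bar>s + t\<bar>"] that by auto
    have E: "?E \<in> sets pair_env" using A K B by (rule pair_env_cylinder)
    have "(\<lambda>\<omega>. fst (\<omega> t)) -` A \<inter> space (F n) \<in> sets (F n)"
      by (rule measurable_sets[OF measurable_compose[OF F_coord[OF tn] measurable_fst] A])
    moreover have "(\<lambda>\<omega>. snd (\<omega> (s + t))) -` B s \<inter> space (F n) \<in> sets (F n)" if "s \<in> K" for s
      by (rule measurable_sets[OF measurable_compose[OF F_coord[OF sn[OF that]] measurable_snd] B])
    ultimately have "(\<Inter>C\<in>insert ((\<lambda>\<omega>. fst (\<omega> t)) -` A \<inter> space (F n)) ((\<lambda>s. (\<lambda>\<omega>. snd (\<omega> (s + t))) -` B s \<inter> space (F n)) ` K). C) \<in> sets (F n)"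
      using K by (intro sets.finite_INT) auto
    also have "(\<Inter>C\<in>insert ((\<lambda>\<omega>. fst (\<omega> t)) -` A \<inter> space (F n)) ((\<lambda>s. (\<lambda>\<omega>. snd (\<omega> (s + t))) -` B s \<inter> space (F n)) ` K). C) = env_view t -` ?E"
      by (auto simp: space_F)
    finally have "emeasure Q (env_view t -` ?E) = emeasure (q n) (env_view t -` ?E)" by (rule agree_sets)
    moreover have "emeasure (distr (q n) pair_env (env_view t)) ?E = emeasure \<mu> ?E" by (simp add: law_q[OF tn])
    ultimately show "emeasure (distr Q pair_env (env_view t)) ?E = emeasure \<mu> ?E"
      using sets_eq_imp_space_eq[OF sets_q[of n]] by (simp add: emeasure_distr[OF ev(1) E] emeasure_distr[OF ev(2) E] space_Q)
  qed
  have "markov_at Q t" for t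
  proof (rule markov_atI)
    show "finite_measure Q" by unfold_locales
    show "sets Q = sets chain_space" by (rule sets_Q)
    fix S :: "(int \<Rightarrow> 'e \<times> 'f) set" and A :: "'e set" assume S: "S \<in> sets (past t)" and A: "A \<in> sets borel"
    define p where "p \<omega> = emeasure (P (snd (\<omega> (t - 1))) (fst (\<omega> (t - 1)))) A" for \<omega> :: "int \<Rightarrow> 'e \<times> 'f"
    have p [measurable]: "p \<in> borel_measurable chain_space"
      unfolding p_def[abs_def] by (rule P_emeasure_coord[OF A])
    note YA = chain_fst_set[OF A, of t]
    note [measurable_cong] = sets_Q
    note [measurable] = YA
    have id: "(\<lambda>\<omega>. \<omega>) \<in> \<rho> \<rightarrow>\<^sub>M past t" if "sets \<rho> = sets chain_space" for \<rho>
      using sets_past_subset[of t] that sets_eq_imp_space_eq[OF that] by (auto simp: measurable_def)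
    \<comment> \<open>\<open>m1\<close> and \<open>m2\<close> are the two sides of the Markov
      identity, as measures of the past event.\<close>
    define m1 where "m1 = distr (density Q (indicator {\<omega>. fst (\<omega> t) \<in> A})) (past t) (\<lambda>\<omega>. \<omega>)"
    define m2 where "m2 = distr (density Q p) (past t) (\<lambda>\<omega>. \<omega>)"
    have em1: "emeasure m1 S = emeasure Q (S \<inter> {\<omega>. fst (\<omega> t) \<in> A})" if "S \<in> sets (past t)" for S
    proof -
      have [measurable]: "S \<in> sets chain_space" using that sets_past_subset by blast
      have "emeasure m1 S = emeasure (density Q (indicator {\<omega>. fst (\<omega> t) \<in> A})) S"
        unfolding m1_def using that sets_Q by (subst emeasure_distr[OF id]) (auto simp: space_Q)
      also have "\<dots> = emeasure Q ({\<omega>. fst (\<omega> t) \<in> A} \<inter> S)"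
        by (rule emeasure_restricted) measurable
      also have "{\<omega>. fst (\<omega> t) \<in> A} \<inter> S = S \<inter> {\<omega>. fst (\<omega> t) \<in> A}" by blast
      finally show ?thesis .
    qed
    have em2: "emeasure m2 S = (\<integral>\<^sup>+\<omega>. p \<omega> * indicator S \<omega> \<partial>Q)" if "S \<in> sets (past t)" for S
    proof -
      have [measurable]: "S \<in> sets chain_space" using that sets_past_subset by blast
      show ?thesis
        unfolding m2_def using that sets_Q by (subst emeasure_distr[OF id]) (auto simp: emeasure_density space_Q)
    qed
    \<comment> \<open>Closed under intersection because the fields \<open>F n\<close> increase with
      n.\<close>
    define G where "G = {S \<in> sets (past t). \<exists>n. S \<in> sets (F n)}"
    have past_G: "sets (past t) = sigma_sets UNIV G"
    proof
      have c1: "(\<lambda>\<omega>. snd (\<omega> s)) -` B \<in> G" if B: "B \<in> sets borel" for s and B :: "'f set"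
      proof -
        have "s \<in> {- int (nat \<bar>s\<bar>)..int (nat \<bar>s\<bar>)}" by auto
        from measurable_sets[OF measurable_compose[OF F_coord[OF this] measurable_snd] B] measurable_sets[OF past_snd B, of s t]
        show ?thesis by (auto simp: G_def space_F)
      qed
      have c2: "(\<lambda>\<omega>. fst (\<omega> s)) -` B \<in> G" if B: "B \<in> sets borel" "s < t" for s and B :: "'e set"
      proof -
        have "s \<in> {- int (nat \<bar>s\<bar>)..int (nat \<bar>s\<bar>)}" by auto
        from measurable_sets[OF measurable_compose[OF F_coord[OF this] measurable_fst] B(1)] measurable_sets[OF past_fst[OF B(2)] B(1)]
        show ?thesis by (auto simp: G_def space_F)
      qed
      show "sets (past t) \<subseteq> sigma_sets UNIV G"
        unfolding sets_past using c1 c2 by (intro sigma_sets_mono') blast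
      show "sigma_sets UNIV G \<subseteq> sets (past t)"
        using sets.sigma_sets_subset[of G "past t"] by (auto simp: G_def)
    qed
    have "m1 = m2"
    proof (rule measure_eqI_generator_eq)
      show "Int_stable G"
      proof (rule Int_stableI)
        fix a b assume "a \<in> G" "b \<in> G"
        then obtain n m where "a \<in> sets (F n)" "b \<in> sets (F m)" and ab: "a \<in> sets (past t)" "b \<in> sets (past t)"
          unfolding G_def by blast
        then have "a \<in> sets (F (max n m))" "b \<in> sets (F (max n m))"
          using F_mono[of n "max n m"] F_mono[of m "max n m"] by auto
        with ab show "a \<inter> b \<in> G" unfolding G_def by blast
      qed
      show "G \<subseteq> Pow UNIV" by simp
      show "sets m1 = sigma_sets UNIV G" "sets m2 = sigma_sets UNIV G"
        using past_G by (simp_all add: m1_def m2_def)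
      have U: "UNIV \<in> sets (past t)" using sets.top[of "past t"] by simp
      have "UNIV \<in> sets (F 0)" using sets.top[of "F 0"] by (simp add: space_F)
      with U show "range (\<lambda>_::nat. UNIV) \<subseteq> G" unfolding G_def by blast
      show "emeasure m1 ((\<lambda>_::nat. UNIV) i) \<noteq> \<infinity>" for i using em1[OF U] by simp
      fix S assume "S \<in> G"
      then obtain n0 where S: "S \<in> sets (past t)" and n0: "S \<in> sets (F n0)" unfolding G_def by blast
      \<comment> \<open>The window must decide \<open>S\<close> and contain both t and t - 1, since
        the kernel is evaluated at t - 1.\<close>
      define n where "n = max n0 (nat \<bar>t\<bar> + 1)"
      have Sn: "S \<in> sets (F n)" using n0 F_mono[of n0 n] by (auto simp: n_def)
      have t: "t \<in> {- int n<..int n}" "t \<in> {- int n..int n}" "t - 1 \<in> {- int n..int n}" by (auto simp: n_def)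
      have YAn: "{\<omega>. fst (\<omega> t) \<in> A} \<in> sets (F n)"
        using measurable_sets[OF measurable_compose[OF F_coord[OF t(2)] measurable_fst] A] by (simp add: space_F vimage_def)
      have pb: "(\<lambda>(y, x). emeasure (P x y) A) \<in> borel_measurable (borel \<Otimes>\<^sub>M borel)"
      proof -
        have "(\<lambda>(y, x). measure (P x y) A) \<in> borel_measurable (borel \<Otimes>\<^sub>M borel)"
          using measurable_compose[OF measurable_pair_swap' P_meas[OF A]] by (simp add: case_prod_beta')
        then show ?thesis by (simp add: emeasure_P case_prod_beta')
      qed
      have pF: "p \<in> borel_measurable (F n)"
        unfolding p_def[abs_def] using measurable_compose[OF F_coord[OF t(3)] pb] by (simp add: case_prod_beta')
      have "emeasure m1 S = emeasure (q n) (S \<inter> {\<omega>. fst (\<omega> t) \<in> A})"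
        unfolding em1[OF S] by (rule agree_sets) (intro sets.Int Sn YAn)
      also have "\<dots> = (\<integral>\<^sup>+\<omega>. p \<omega> * indicator S \<omega> \<partial>q n)"
        unfolding p_def by (rule markov_at_emeasure[OF sets_q markov_q[OF t(1)] S A])
      also have "\<dots> = (\<integral>\<^sup>+\<omega>. p \<omega> * indicator S \<omega> \<partial>Q)"
        using pF Sn by (intro agree_int[symmetric]) auto
      also have "\<dots> = emeasure m2 S" by (rule em2[OF S, symmetric])
      finally show "emeasure m1 S = emeasure m2 S" .
    qed simp
    then show "emeasure Q (S \<inter> {\<omega>. fst (\<omega> t) \<in> A}) =
        (\<integral>\<^sup>+\<omega>. emeasure (P (snd (\<omega> (t - 1))) (fst (\<omega> (t - 1)))) A * indicator S \<omega> \<partial>Q)"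
      using em1[OF S] em2[OF S] by (simp add: p_def)
  qed
  then show ?thesis using prob_Q sets_Q law_Q by blast
qed

end

section \<open>Stationarity, uniqueness and ergodicity\<close>

text \<open>In terms of densities: dN/dL is invariant, hence constant. The proof uses a positive set
  \<open>Y\<close> of the signed measure \<sigma> = N - p * L instead. \<open>Y\<close> maximises
  \<sigma>, and so do its preimages under the shift. An invariant maximiser has
  \<open>L\<close>-measure 0 or 1, and either value gives \<sigma> <= 0 there, hence everywhere. As
  \<sigma> has total mass 0, it vanishes.\<close>

lemma ergodic_dominated_invariant:
  fixes L N :: "(int \<Rightarrow> 'f::polish_space) measure"
  assumes prob_L: "prob_space L" and sets_L: "sets L = sets env_space" and erg: "ergodic_law L"
    and inv_L: "\<And>B. B \<in> sets env_space \<Longrightarrow> measure L (path_shift -` B) = measure L B"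
    and sets_N: "sets N = sets env_space" and le: "\<And>B. B \<in> sets env_space \<Longrightarrow> emeasure N B \<le> emeasure L B"
    and inv_N: "\<And>B. B \<in> sets env_space \<Longrightarrow> measure N (path_shift -` B) = measure N B"
    and C: "C \<in> sets env_space"
  shows "measure N C = measure N UNIV * measure L C"
proof -
  interpret L: prob_space L by (rule prob_L)
  have space_L: "space L = UNIV" and space_N: "space N = UNIV"
    using sets_eq_imp_space_eq[OF sets_L] sets_eq_imp_space_eq[OF sets_N] by simp_all
  have U: "UNIV \<in> sets (env_space :: (int \<Rightarrow> 'f) measure)"
    using sets.top[of "env_space :: (int \<Rightarrow> 'f) measure"] by simp
  have "emeasure N UNIV \<noteq> \<infinity>" using le[OF U] L.emeasure_space_1 by (auto simp: space_L top_unique)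
  then interpret N: finite_measure N by (intro finite_measureI) (simp add: space_N)
  define p where "p = measure N UNIV"
  define \<sigma> where "\<sigma> B = measure N B - p * measure L B" for B
  define pL where "pL = scale_measure (ennreal p) L"
  have p0: "0 \<le> p" by (simp add: p_def)
  have \<sigma>_Un: "\<sigma> (A \<union> B) = \<sigma> A + \<sigma> B" if "A \<in> sets env_space" "B \<in> sets env_space" "A \<inter> B = {}" for A B
    using that by (simp add: \<sigma>_def N.finite_measure_Union L.finite_measure_Union sets_L sets_N algebra_simps)
  have \<sigma>_split: "\<sigma> A = \<sigma> (A \<inter> B) + \<sigma> (A - B)" if "A \<in> sets env_space" "B \<in> sets env_space" for A B
    using \<sigma>_Un[of "A \<inter> B" "A - B"] that by (simp add: Int_Diff_Un Int_Diff_disjoint sets.Int sets.Diff)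
  have epL: "emeasure pL B = ennreal (p * measure L B)" if "B \<in> sets env_space" for B
    using that p0 sets_L by (simp add: pL_def L.emeasure_eq_measure ennreal_mult)
  have "\<exists>Y\<in>sets N. (\<forall>X\<in>sets N. X \<subseteq> Y \<longrightarrow> emeasure pL X \<le> emeasure N X) \<and>
      (\<forall>X\<in>sets N. X \<inter> Y = {} \<longrightarrow> emeasure N X \<le> emeasure pL X)"
  proof (rule finite_unsigned_Hahn_decomposition)
    show "sets pL = sets N" by (simp add: pL_def sets_L sets_N)
    show "finite_measure N" by unfold_locales
    have "space pL = UNIV" by (simp add: pL_def space_L space_scale_measure)
    then show "finite_measure pL" using U by (intro finite_measureI) (simp add: epL)
  qed
  then obtain Y where Y': "Y \<in> sets N" "\<forall>X\<in>sets N. X \<subseteq> Y \<longrightarrow> emeasure pL X \<le> emeasure N X"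
    "\<forall>X\<in>sets N. X \<inter> Y = {} \<longrightarrow> emeasure N X \<le> emeasure pL X"
    by (elim bexE conjE)
  have Y: "Y \<in> sets env_space" using Y'(1) by (simp only: sets_N)
  have Yp: "emeasure pL X \<le> emeasure N X" if "X \<in> sets env_space" "X \<subseteq> Y" for X
    using Y'(2)[rule_format, of X] that by (simp only: sets_N)
  have Yn: "emeasure N X \<le> emeasure pL X" if "X \<in> sets env_space" "X \<inter> Y = {}" for X
    using Y'(3)[rule_format, of X] that by (simp only: sets_N)
  have pos: "0 \<le> \<sigma> X" if "X \<in> sets env_space" "X \<subseteq> Y" for X
    using Yp[OF that] that p0 by (simp add: epL N.emeasure_eq_measure \<sigma>_def)
  have neg: "\<sigma> X \<le> 0" if "X \<in> sets env_space" "X \<inter> Y = {}" for X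
    using Yn[OF that] that p0 by (simp add: epL N.emeasure_eq_measure \<sigma>_def)
  have max: "\<sigma> X \<le> \<sigma> Y" if X: "X \<in> sets env_space" for X
  proof -
    have "\<sigma> X = \<sigma> (X \<inter> Y) + \<sigma> (X - Y)" using X Y by (rule \<sigma>_split)
    also have "\<sigma> (X - Y) \<le> 0" using X Y by (intro neg) auto
    also have "\<sigma> (X \<inter> Y) \<le> \<sigma> (Y \<inter> X) + \<sigma> (Y - X)"
      using pos[of "Y - X"] X Y by (simp add: Int_commute sets.Diff)
    also have "\<sigma> (Y \<inter> X) + \<sigma> (Y - X) = \<sigma> Y" using \<sigma>_split[OF Y X] by simp
    finally show ?thesis by simp
  qed
  \<comment> \<open>If B is a maximiser, then \<sigma> (B - A) >= 0, as otherwise its part inside A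
    would have larger charge. So the union with another maximiser loses nothing.\<close>
  have max_Un: "\<sigma> (A \<union> B) = \<sigma> Y"
    if A: "A \<in> sets env_space" "\<sigma> A = \<sigma> Y" and B: "B \<in> sets env_space" "\<sigma> B = \<sigma> Y" for A B
  proof -
    have "\<sigma> (A \<union> B) = \<sigma> A + \<sigma> (B - A)"
      using \<sigma>_Un[of A "B - A"] A B by (simp add: sets.Diff Diff_disjoint)
    moreover have "\<sigma> B = \<sigma> (B \<inter> A) + \<sigma> (B - A)" using A B by (intro \<sigma>_split)
    ultimately show ?thesis using max[of "A \<union> B"] max[of "B \<inter> A"] A B by (simp add: sets.Un sets.Int)
  qed
  have meas_shift: "path_shift -` B \<in> sets env_space" if "B \<in> sets env_space" for B :: "(int \<Rightarrow> 'f) set"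
    using measurable_sets[OF measurable_path_shift that] by simp
  have \<sigma>_shift: "\<sigma> (path_shift -` B) = \<sigma> B" if "B \<in> sets env_space" for B
    using that by (simp add: \<sigma>_def inv_L inv_N)
  define Z where "Z k = ((\<lambda>B. path_shift -` B) ^^ k) Y" for k :: nat
  have Z: "Z k \<in> sets env_space \<and> \<sigma> (Z k) = \<sigma> Y" for k
    by (induction k) (auto simp: Z_def Y meas_shift \<sigma>_shift)
  have Z_Suc: "path_shift -` Z k = Z (Suc k)" for k by (simp add: Z_def)
  have fin_Un: "(\<Union>i\<in>{a..a + n}. Z i) \<in> sets env_space \<and> \<sigma> (\<Union>i\<in>{a..a + n}. Z i) = \<sigma> Y" for a n :: nat
  proof (induction n)
    case (Suc n)
    have "{a..a + Suc n} = insert (a + Suc n) {a..a + n}" by auto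
    then show ?case using Suc Z[of "a + Suc n"] by (simp add: max_Un sets.Un)
  qed (simp add: Z)
  define W where "W a = (\<Union>n. \<Union>i\<in>{a..a + n}. Z i)" for a :: nat
  have W: "W a \<in> sets env_space" for a unfolding W_def using fin_Un by auto
  have \<sigma>_W: "\<sigma> (W a) = \<sigma> Y" for a
  proof (rule LIMSEQ_unique)
    have inc: "incseq (\<lambda>n. \<Union>i\<in>{a..a + n}. Z i)" by (intro incseq_SucI UN_mono) auto
    have "(\<lambda>n. measure N (\<Union>i\<in>{a..a + n}. Z i)) \<longlonglongrightarrow> measure N (W a)"
      unfolding W_def using fin_Un sets_N inc by (intro N.finite_Lim_measure_incseq) auto
    moreover have "(\<lambda>n. measure L (\<Union>i\<in>{a..a + n}. Z i)) \<longlonglongrightarrow> measure L (W a)"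
      unfolding W_def using fin_Un sets_L inc by (intro L.finite_Lim_measure_incseq) auto
    ultimately show "(\<lambda>n. \<sigma> (\<Union>i\<in>{a..a + n}. Z i)) \<longlonglongrightarrow> \<sigma> (W a)"
      unfolding \<sigma>_def by (intro tendsto_intros)
    show "(\<lambda>n. \<sigma> (\<Union>i\<in>{a..a + n}. Z i)) \<longlonglongrightarrow> \<sigma> Y" using fin_Un by simp
  qed
  have W_eq: "W a = (\<Union>i\<in>{a..}. Z i)" for a
  proof (intro set_eqI iffI)
    fix x assume "x \<in> (\<Union>i\<in>{a..}. Z i)"
    then obtain i where "a \<le> i" "x \<in> Z i" by auto
    then show "x \<in> W a" unfolding W_def by (intro UN_I[of "i - a"] UN_I[of i]) auto
  qed (auto simp: W_def)
  \<comment> \<open>\<open>ergodic_law\<close> speaks of strictly invariant events, and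
    \<open>Y\<close> need not be one. The limit superior of its iterated preimages is, and it is
    still a maximiser.\<close>
  define H where "H = (\<Inter>a. W a)"
  have H: "H \<in> sets env_space" unfolding H_def using W by auto
  have dec: "decseq W" unfolding W_eq by (intro decseq_SucI UN_mono) auto
  have "\<sigma> H = \<sigma> Y"
  proof (rule LIMSEQ_unique)
    have "(\<lambda>a. measure N (W a)) \<longlonglongrightarrow> measure N H"
      unfolding H_def using W sets_N dec by (intro N.finite_Lim_measure_decseq) auto
    moreover have "(\<lambda>a. measure L (W a)) \<longlonglongrightarrow> measure L H"
      unfolding H_def using W sets_L dec by (intro L.finite_Lim_measure_decseq) auto
    ultimately show "(\<lambda>a. \<sigma> (W a)) \<longlonglongrightarrow> \<sigma> H"
      unfolding \<sigma>_def by (intro tendsto_intros)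
    show "(\<lambda>a. \<sigma> (W a)) \<longlonglongrightarrow> \<sigma> Y" by (simp add: \<sigma>_W)
  qed
  have shift_W: "path_shift -` W a = W (Suc a)" for a
  proof -
    have "path_shift -` W a = (\<Union>i\<in>{a..}. Z (Suc i))" by (auto simp: W_eq Z_Suc[symmetric])
    also have "\<dots> = W (Suc a)"
    proof (intro set_eqI iffI)
      fix x assume "x \<in> W (Suc a)"
      then obtain i where "Suc a \<le> i" "x \<in> Z i" by (auto simp: W_eq)
      then show "x \<in> (\<Union>i\<in>{a..}. Z (Suc i))" by (intro UN_I[of "i - 1"]) auto
    qed (auto simp: W_eq)
    finally show ?thesis .
  qed
  have "path_shift -` H = (\<Inter>a. W (Suc a))" by (auto simp: H_def shift_W[symmetric])
  also have "\<dots> = H"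
    using decseq_SucD[OF dec] by (auto simp: H_def)
  finally have "path_shift -` H \<inter> space L = H" by (simp add: space_L)
  then consider "measure L H = 0" | "measure L H = 1"
    using erg H sets_L unfolding ergodic_law_def by blast
  then have "\<sigma> H \<le> 0"
  proof cases
    case 1
    then have "measure N H \<le> 0"
      using le[OF H] by (simp add: L.emeasure_eq_measure N.emeasure_eq_measure)
    then show ?thesis using 1 by (simp add: \<sigma>_def)
  next
    case 2
    have "measure N H \<le> p" unfolding p_def using N.finite_measure_mono[of H UNIV] U sets_N by simp
    then show ?thesis using 2 by (simp add: \<sigma>_def)
  qed
  then have le0: "\<sigma> X \<le> 0" if "X \<in> sets env_space" for X
    using max[OF that] \<open>\<sigma> H = \<sigma> Y\<close> by simp
  \<comment> \<open>With total mass zero, nonpositivity on the complement becomes nonnegativity on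
    \<open>C\<close>.\<close>
  have "\<sigma> UNIV = 0" using L.prob_space by (simp add: \<sigma>_def p_def space_L)
  then have "\<sigma> C = - \<sigma> (UNIV - C)" using \<sigma>_split[OF U C] by simp
  then have "\<sigma> C = 0" using le0[OF C] le0[of "UNIV - C"] U C by (simp add: sets.Diff)
  then show ?thesis by (simp add: \<sigma>_def p_def)
qed

text \<open>As a rewrite rule, the second equation eta-expands \<open>snd (env_view t \<omega>)\<close> under binders, after which
  facts about the environment part no longer match.\<close>

declare env_view_simps(2) [simp del]

lemma chain_shift [measurable]: "path_shift \<in> chain_space \<rightarrow>\<^sub>M chain_space"
  by (rule measurable_path_shift)

lemma past_shift_by:
  assumes "S \<in> sets (past t)" shows "(\<lambda>\<omega> s. \<omega> (s + k)) -` S \<in> sets (past (t + k))"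
  using assms unfolding sets_past[of t]
proof (induction S rule: sigma_sets.induct)
  case (Basic S)
  then consider s B where "S = (\<lambda>\<omega>. snd (\<omega> s)) -` B" "B \<in> sets borel"
    | s B where "S = (\<lambda>\<omega>. fst (\<omega> s)) -` B" "s < t" "B \<in> sets borel" by blast
  then show ?case
  proof cases
    case 1
    then show ?thesis using measurable_sets[OF past_snd 1(2), of "s + k" "t + k"]
      by (simp add: vimage_def)
  next
    case 2
    then show ?thesis using measurable_sets[OF past_fst[of "s + k" "t + k"] 2(3)]
      by (simp add: vimage_def)
  qed
next
  case (Compl S)
  have "(\<lambda>\<omega> s. \<omega> (s + k)) -` (UNIV - S) = space (past (t + k)) - (\<lambda>\<omega> s. \<omega> (s + k)) -` S" by auto
  then show ?case using Compl.IH by (simp only: sets.compl_sets)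
qed (auto simp: vimage_UN)

section \<open>Approximation of events by past events\<close>

definition path_back :: "(int \<Rightarrow> 'a) \<Rightarrow> (int \<Rightarrow> 'a)" where
  "path_back \<omega> = (\<lambda>t. \<omega> (t - 1))"

lemma path_back_shift [simp]: "path_back (path_shift \<omega>) = \<omega>" "path_shift (path_back \<omega>) = \<omega>"
  by (simp_all add: path_back_def path_shift_def)

text \<open>The events with such approximations form a sigma-field, because the pasts increase with
  time and a countable union is nearly exhausted by a finite one. It contains every coordinate
  event, the coordinate i being known at time i + 1.\<close>

lemma past_approximation:
  fixes Q :: "(int \<Rightarrow> 'e::polish_space \<times> 'f::polish_space) measure"
  assumes fin: "finite_measure Q" and sets_Q: "sets Q = sets chain_space"
    and A: "A \<in> sets chain_space" and e: "0 < (e::real)"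
  shows "\<exists>t B. B \<in> sets (past t) \<and> measure Q (sym_diff A B) < e"
proof -
  interpret finite_measure Q by (rule fin)
  have sub: "B \<in> sets Q" if "B \<in> sets (past t)" for t B
    using that sets_past_subset sets_Q by blast
  define ok where "ok A \<longleftrightarrow> A \<in> sets Q \<and> (\<forall>e>0. \<exists>t B. B \<in> sets (past t) \<and> measure Q (sym_diff A B) < e)" for A
  have ok_past: "ok B" if "B \<in> sets (past t)" for B t
    unfolding ok_def using that sub by (auto intro!: exI[of _ t] exI[of _ B])
  have ok_Un: "ok (A \<union> B)" if okA: "ok A" and okB: "ok B" for A B
    unfolding ok_def
  proof (intro conjI allI impI)
    show "A \<union> B \<in> sets Q" using okA okB by (auto simp: ok_def)
    fix e :: real assume "0 < e"
    then have e2: "0 < e / 2" by simp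
    obtain s A' where A': "A' \<in> sets (past s)" "measure Q (sym_diff A A') < e / 2" using okA e2 unfolding ok_def by blast
    obtain t B' where B': "B' \<in> sets (past t)" "measure Q (sym_diff B B') < e / 2" using okB e2 unfolding ok_def by blast
    have "A' \<in> sets (past (max s t))" "B' \<in> sets (past (max s t))"
      using A' B' sets_past_mono[of s "max s t"] sets_past_mono[of t "max s t"] by auto
    then have "A' \<union> B' \<in> sets (past (max s t))" by blast
    moreover have "measure Q (sym_diff (A \<union> B) (A' \<union> B')) < e"
    proof -
      have m: "sym_diff A A' \<in> sets Q" "sym_diff B B' \<in> sets Q"
        using okA okB sub[OF A'(1)] sub[OF B'(1)] by (auto simp: ok_def)
      have "measure Q (sym_diff (A \<union> B) (A' \<union> B')) \<le> measure Q (sym_diff A A' \<union> sym_diff B B')"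
        using m by (intro finite_measure_mono) auto
      also have "\<dots> \<le> measure Q (sym_diff A A') + measure Q (sym_diff B B')"
        using m by (rule measure_Un_le)
      finally show ?thesis using A' B' by simp
    qed
    ultimately show "\<exists>t C. C \<in> sets (past t) \<and> measure Q (sym_diff (A \<union> B) C) < e" by blast
  qed
  have "ok A" if "A \<in> sigma_sets UNIV {{f\<in>UNIV. f i \<in> A} | i A. A \<in> sets (borel \<Otimes>\<^sub>M borel)}" for A
    using that
  proof (induction A rule: sigma_sets.induct)
    case (Basic A)
    then obtain i C where A: "A = (\<lambda>\<omega>. \<omega> i) -` C" and C: "C \<in> sets (borel \<Otimes>\<^sub>M borel)" by auto
    have "(\<lambda>\<omega>. (fst (\<omega> i), snd (\<omega> i))) \<in> past (i + 1) \<rightarrow>\<^sub>M borel \<Otimes>\<^sub>M borel"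
      by (intro measurable_Pair past_fst past_snd) simp
    from measurable_sets[OF this C] show ?case
      unfolding A by (intro ok_past[of _ "i + 1"]) simp
  next
    case Empty show ?case by (rule ok_past[of _ 0]) simp
  next
    case (Compl A)
    have "sym_diff (UNIV - A) (UNIV - B) = sym_diff A B" for B by auto
    moreover have "UNIV - B \<in> sets (past t)" if "B \<in> sets (past t)" for B t
      using sets.compl_sets[OF that] by simp
    moreover have "UNIV - A \<in> sets Q"
      using Compl.IH sets.compl_sets[of A Q] sets_eq_imp_space_eq[OF sets_Q] by (simp add: ok_def)
    ultimately show ?case using Compl.IH unfolding ok_def by metis
  next
    case (Union A)
    have okU: "ok (\<Union>i<n. A i)" for n
    proof (induction n)
      case 0 show ?case using ok_past[of "{}" 0] by simp
    next
      case (Suc n) then show ?case using ok_Un[OF Union.IH[of n] Suc] by (simp add: lessThan_Suc)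
    qed
    show ?case
      unfolding ok_def
    proof (intro conjI allI impI)
      have mA: "A i \<in> sets Q" for i using Union.IH by (simp add: ok_def)
      then show U: "(\<Union>i. A i) \<in> sets Q" by blast
      fix e :: real assume "0 < e"
      have "(\<lambda>n. measure Q (\<Union>i<n. A i)) \<longlonglongrightarrow> measure Q (\<Union>n. \<Union>i<n. A i)"
      proof (rule finite_Lim_measure_incseq)
        show "range (\<lambda>n. \<Union>i<n. A i) \<subseteq> sets Q" using mA by auto
        show "incseq (\<lambda>n. \<Union>i<n. A i)" by (rule incseq_SucI) (auto simp: lessThan_Suc)
      qed
      also have "(\<Union>n. \<Union>i<n. A i) = (\<Union>i. A i)" by auto
      finally have "eventually (\<lambda>n. measure Q (\<Union>i. A i) - e / 2 < measure Q (\<Union>i<n. A i)) sequentially"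
        using \<open>0 < e\<close> by (intro order_tendstoD(1)) auto
      then obtain n where n: "measure Q (\<Union>i. A i) - e / 2 < measure Q (\<Union>i<n. A i)"
        by (auto simp: eventually_sequentially)
      obtain t B where B: "B \<in> sets (past t)" "measure Q (sym_diff (\<Union>i<n. A i) B) < e / 2"
        using okU[of n] \<open>0 < e\<close> half_gt_zero[of e] unfolding ok_def by blast
      have Un: "(\<Union>i<n. A i) \<in> sets Q" using mA by auto
      have "measure Q (sym_diff (\<Union>i. A i) B) \<le> measure Q (((\<Union>i. A i) - (\<Union>i<n. A i)) \<union> sym_diff (\<Union>i<n. A i) B)"
        using U Un sub[OF B(1)] by (intro finite_measure_mono) auto
      also have "\<dots> \<le> measure Q ((\<Union>i. A i) - (\<Union>i<n. A i)) + measure Q (sym_diff (\<Union>i<n. A i) B)"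
        using U Un sub[OF B(1)] by (intro measure_Un_le) auto
      also have "measure Q ((\<Union>i. A i) - (\<Union>i<n. A i)) = measure Q (\<Union>i. A i) - measure Q (\<Union>i<n. A i)"
        using U Un by (intro finite_measure_Diff) auto
      finally have "measure Q (sym_diff (\<Union>i. A i) B) < e" using n B by simp
      then show "\<exists>t B. B \<in> sets (past t) \<and> measure Q (sym_diff (\<Union>i. A i) B) < e" using B by blast
    qed
  qed
  then have "ok A" using A by (simp add: sets_PiM_single space_pair_measure)
  then show ?thesis using e by (simp add: ok_def)
qed

lemma env_view_comp_shift: "env_view t \<circ> path_shift = env_view (t + 1)"
  by (simp add: fun_eq_iff env_view_path_shift)

context random_kernel
begin

lemma markov_at_path_shift:
  assumes s: "sets Q = sets chain_space" and m: "markov_at Q (t + 1)"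
  shows "markov_at (distr Q chain_space path_shift) t"
  unfolding markov_at_def
proof (intro ballI)
  fix S :: "(int \<Rightarrow> 'e \<times> 'f) set" and f :: "'e \<times> (int \<Rightarrow> 'f) \<Rightarrow> ennreal"
  assume S: "S \<in> sets (past t)" and f: "f \<in> borel_measurable pair_env"
  note [measurable_cong] = s
  have S': "path_shift -` S \<in> sets (past (t + 1))"
    using past_shift_by[OF S, of 1] by (simp add: path_shift_def[abs_def])
  have Sc: "S \<in> sets chain_space" using S sets_past_subset by blast
  have int: "(\<integral>\<^sup>+\<omega>. g (env_view u \<omega>) * indicator S \<omega> \<partial>distr Q chain_space path_shift) =
      (\<integral>\<^sup>+\<omega>. g (env_view (u + 1) \<omega>) * indicator (path_shift -` S) \<omega> \<partial>Q)"
    if g: "g \<in> borel_measurable pair_env" for g :: "'e \<times> (int \<Rightarrow> 'f) \<Rightarrow> ennreal" and u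
  proof -
    have "(\<lambda>\<omega>. g (env_view u \<omega>) * indicator S \<omega>) \<in> borel_measurable chain_space"
      by (rule env_view_indicator_measurable[OF g Sc])
    then show ?thesis
      by (subst nn_integral_distr) (auto simp: env_view_path_shift indicator_def)
  qed
  show "(\<integral>\<^sup>+\<omega>. f (env_view t \<omega>) * indicator S \<omega> \<partial>distr Q chain_space path_shift) =
      (\<integral>\<^sup>+\<omega>. transop f (env_view (t - 1) \<omega>) * indicator S \<omega> \<partial>distr Q chain_space path_shift)"
    unfolding int[OF f] int[OF transop_measurable[OF f]]
    using markov_atD[OF m S' f] by simp
qed

end

section \<open>Stationary chains on path space\<close>

context drift_kernel
begin

lemma law_tight:
  assumes fin: "finite_measure \<mu>" and s: "sets \<mu> = sets pair_env" and "0 < \<gamma>"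
  shows "\<exists>R. tail_le R \<gamma> \<mu>"
proof -
  interpret finite_measure \<mu> by (rule fin)
  have space: "space \<mu> = UNIV" using sets_eq_imp_space_eq[OF s] by simp
  note [measurable_cong] = s
  have m: "{z. real n < V (fst z)} \<in> sets \<mu>" for n
  proof -
    have "{z\<in>space \<mu>. real n < V (fst z)} \<in> sets \<mu>" by measurable
    then show ?thesis by (simp add: space)
  qed
  have "(\<lambda>n. measure \<mu> {z. real n < V (fst z)}) \<longlonglongrightarrow> measure \<mu> (\<Inter>n. {z. real n < V (fst z)})"
    using m by (intro finite_Lim_measure_decseq) (auto simp: decseq_def)
  also have "(\<Inter>n. {z :: 'e \<times> (int \<Rightarrow> 'f). real n < V (fst z)}) = {}"
  proof -
    have "\<exists>n. \<not> real n < V (fst z)" for z :: "'e \<times> (int \<Rightarrow> 'f)"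
      using real_arch_simple[of "V (fst z)"] by (auto simp: not_less)
    then show ?thesis by blast
  qed
  finally have "eventually (\<lambda>n. measure \<mu> {z. real n < V (fst z)} < \<gamma>) sequentially"
    using \<open>0 < \<gamma>\<close> by (intro order_tendstoD(2)) auto
  then obtain n where "measure \<mu> {z. real n < V (fst z)} < \<gamma>" by (auto simp: eventually_sequentially)
  then show ?thesis unfolding tail_le_def by (intro exI[of _ "real n"]) simp
qed

text \<open>A single finite measure has small tails of \<open>V\<close> because \<open>V\<close> is
  finite; when the one-time law is constant, the same bound serves all times.\<close>

lemma controlledI:
  assumes s: "sets Q = sets chain_space" and m: "\<And>t. markov_at Q t"
    and law: "\<And>t. distr Q pair_env (env_view t) = \<mu>" and b: "env_dominated \<mu>"
  shows "controlled Q"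
  unfolding controlled_def law
  using s m b law_tight[OF env_dominated_finite(1)[OF b]] by (auto simp: env_dominated_def)

text \<open>Counterpart of \<open>MCRE\<close> for laws on path space;
  \<open>stationary_chain_law\<close> and \<open>stationary_chain_MCRE\<close> translate between the
  two.\<close>

definition stationary_chain :: "(int \<Rightarrow> 'e \<times> 'f) measure \<Rightarrow> bool" where
  "stationary_chain Q \<longleftrightarrow> prob_space Q \<and> sets Q = sets chain_space \<and>
     distr Q chain_space path_shift = Q \<and> distr Q env_space (\<lambda>\<omega> s. snd (\<omega> s)) = L \<and> (\<forall>t. markov_at Q t)"

lemma shift_invariant_law:
  assumes s: "sets Q = sets chain_space" and inv: "distr Q chain_space path_shift = Q"
  shows "distr Q pair_env (env_view t) = distr Q pair_env (env_view 0)"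
proof -
  note [measurable_cong] = s
  have step: "distr Q pair_env (env_view (t + 1)) = distr Q pair_env (env_view t)" for t
  proof -
    have "distr (distr Q chain_space path_shift) pair_env (env_view t) = distr Q pair_env (env_view t \<circ> path_shift)"
      by (rule distr_distr) measurable
    then show ?thesis by (simp add: inv env_view_comp_shift)
  qed
  show ?thesis
  proof (induction t rule: int_induct[where k = 0])
    case (step1 i) then show ?case using step[of i] by simp
  next
    case (step2 i) then show ?case using step[of "i - 1"] by simp
  qed simp
qed

lemma distr_env_view_snd:
  assumes [measurable_cong]: "sets Q = sets chain_space"
  shows "distr Q env_space (\<lambda>\<omega>. snd (env_view t \<omega>)) = distr (distr Q pair_env (env_view t)) env_space snd"
  by (subst distr_distr) (auto simp: o_def)

lemma snd_env_view_0: "(\<lambda>\<omega>. snd (env_view 0 \<omega>)) = (\<lambda>\<omega> s. snd (\<omega> s))"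
  by (simp add: env_view_def)

lemma stationary_chain_env:
  assumes "stationary_chain Q" shows "distr Q env_space (\<lambda>\<omega>. snd (env_view t \<omega>)) = L"
proof -
  have s: "sets Q = sets chain_space" and inv: "distr Q chain_space path_shift = Q"
    and env: "distr Q env_space (\<lambda>\<omega> s. snd (\<omega> s)) = L"
    using assms by (auto simp: stationary_chain_def)
  have "distr Q env_space (\<lambda>\<omega>. snd (env_view t \<omega>)) = distr Q env_space (\<lambda>\<omega>. snd (env_view 0 \<omega>))"
    unfolding distr_env_view_snd[OF s] by (subst shift_invariant_law[OF s inv]) simp
  then show ?thesis by (simp only: snd_env_view_0 env)
qed

lemma emeasure_distr_env_view:
  assumes [measurable_cong]: "sets Q = sets chain_space" and B: "B \<in> sets env_space"
  shows "emeasure (distr Q pair_env (env_view t)) (UNIV \<times> B) = emeasure (distr Q env_space (\<lambda>\<omega>. snd (env_view t \<omega>))) B"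
proof -
  have "emeasure (distr Q env_space (\<lambda>\<omega>. snd (env_view t \<omega>))) B =
      emeasure (distr Q pair_env (env_view t)) (snd -` B \<inter> space (distr Q pair_env (env_view t)))"
    unfolding distr_env_view_snd[OF assms(1)] using B by (intro emeasure_distr) measurable
  also have "snd -` B \<inter> space (distr Q pair_env (env_view t)) = UNIV \<times> B" by auto
  finally show ?thesis by simp
qed

lemma stationary_chain_controlled:
  assumes Q: "stationary_chain Q" shows "controlled Q"
proof (rule controlledI)
  show s: "sets Q = sets chain_space" and "markov_at Q t" for t
    using Q by (auto simp: stationary_chain_def)
  show "distr Q pair_env (env_view t) = distr Q pair_env (env_view 0)" for t
    using Q by (intro shift_invariant_law) (auto simp: stationary_chain_def)
  show "env_dominated (distr Q pair_env (env_view 0))"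
    by (simp add: env_dominated_def emeasure_distr_env_view[OF s] stationary_chain_env[OF Q])
qed

proposition stationary_chain_unique:
  assumes "stationary_chain Q1" "stationary_chain Q2" shows "Q1 = Q2"
  using assms by (intro controlled_unique stationary_chain_controlled) (simp_all add: stationary_chain_env)

text \<open>The extension only comes with constant one-time laws, not with a shift-invariant law.
  Its shift is again Markov with the same one-time laws, so the two coincide by
  \<open>controlled_unique\<close>.\<close>

proposition stationary_chain_exists: "\<exists>Q. stationary_chain Q"
proof -
  obtain \<mu> where mu: "prob_space \<mu>" "sets \<mu> = sets pair_env" "\<mu> \<bind> trans = \<mu>"
    and env: "\<And>B. B \<in> sets env_space \<Longrightarrow> emeasure \<mu> (UNIV \<times> B) = emeasure L B"
    using invariant_law_exists by blast
  obtain Q where prob_Q: "prob_space Q" and s: "sets Q = sets chain_space"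
    and law: "\<And>t. distr Q pair_env (env_view t) = \<mu>" and mk: "\<And>t. markov_at Q t"
    using two_sided_chain[OF mu] by blast
  note [measurable_cong] = s
  have env_dominated: "env_dominated \<mu>" by (simp add: env_dominated_def mu env)
  define Q' where "Q' = distr Q chain_space path_shift"
  have s': "sets Q' = sets chain_space" by (simp add: Q'_def)
  have law': "distr Q' pair_env (env_view t) = \<mu>" for t
  proof -
    have "distr Q' pair_env (env_view t) = distr Q pair_env (env_view t \<circ> path_shift)"
      unfolding Q'_def by (rule distr_distr) measurable
    then show ?thesis by (simp add: law env_view_comp_shift)
  qed
  have "Q' = Q"
  proof (rule controlled_unique)
    show "controlled Q'"
      using s' law' env_dominated by (intro controlledI) (auto simp: Q'_def intro: markov_at_path_shift[OF s mk])
    show "controlled Q" by (rule controlledI[OF s mk law env_dominated])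
    show "distr Q' env_space (\<lambda>\<omega>. snd (env_view t \<omega>)) = distr Q env_space (\<lambda>\<omega>. snd (env_view t \<omega>))" for t
      by (simp only: distr_env_view_snd[OF s] distr_env_view_snd[OF s'] law law')
  qed
  moreover have "distr Q env_space (\<lambda>\<omega> s. snd (\<omega> s)) = L"
    unfolding snd_env_view_0[symmetric]
    by (rule measure_eqI) (simp_all add: emeasure_distr_env_view[OF s, symmetric] law env)
  ultimately have "stationary_chain Q"
    using prob_Q s mk by (simp add: stationary_chain_def Q'_def)
  then show ?thesis ..
qed

text \<open>A density bounded by 1 lowers every mass, so domination of the environment marginal and
  the tail bounds carry over from \<open>Q\<close>.\<close>

lemma controlled_density:
  assumes Q: "stationary_chain Q" and g: "g \<in> borel_measurable chain_space" and g1: "\<And>\<omega>. g \<omega> \<le> 1"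
    and mk: "\<And>t. markov_at (density Q g) t"
  shows "controlled (density Q g)"
proof -
  have s: "sets Q = sets chain_space" using Q by (simp add: stationary_chain_def)
  note [measurable_cong] = s
  note [measurable] = g
  have sd: "sets (density Q g) = sets chain_space" by (simp add: s)
  have le: "emeasure (distr (density Q g) pair_env (env_view t)) E \<le> emeasure (distr Q pair_env (env_view t)) E"
    if E: "E \<in> sets pair_env" for E t
  proof -
    have D: "env_view t -` E \<inter> space Q \<in> sets Q"
      using E by (intro measurable_sets[OF _ E]) measurable
    have "emeasure (distr (density Q g) pair_env (env_view t)) E = emeasure (density Q g) (env_view t -` E \<inter> space Q)"
      using E by (subst emeasure_distr) auto
    also have "\<dots> = (\<integral>\<^sup>+\<omega>. g \<omega> * indicator (env_view t -` E \<inter> space Q) \<omega> \<partial>Q)"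
      by (rule emeasure_density[OF _ D]) measurable
    also have "\<dots> \<le> (\<integral>\<^sup>+\<omega>. 1 * indicator (env_view t -` E \<inter> space Q) \<omega> \<partial>Q)"
      by (intro nn_integral_mono mult_right_mono g1) simp
    also have "\<dots> = emeasure (distr Q pair_env (env_view t)) E"
      using D E by (subst emeasure_distr) auto
    finally show ?thesis .
  qed
  have cQ: "controlled Q" by (rule stationary_chain_controlled[OF Q])
  have env_dominated_d: "env_dominated (distr (density Q g) pair_env (env_view t))" for t
  proof -
    have "env_dominated (distr Q pair_env (env_view t))" using cQ by (simp add: controlled_def)
    then show ?thesis
      unfolding env_dominated_def using sets.top[of "borel :: 'e measure"]
      by (auto intro!: order_trans[OF le] pair_measureI)
  qed
  have "\<exists>R. \<forall>t. tail_le R \<gamma> (distr (density Q g) pair_env (env_view t))" if "0 < \<gamma>" for \<gamma>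
  proof -
    obtain R where R: "\<And>t. tail_le R \<gamma> (distr Q pair_env (env_view t))"
      using cQ \<open>0 < \<gamma>\<close> unfolding controlled_def by blast
    have "{z\<in>space pair_env. R < V (fst z)} \<in> sets (pair_env :: ('e \<times> (int \<Rightarrow> 'f)) measure)" by measurable
    then have E: "{z. R < V (fst z)} \<in> sets (pair_env :: ('e \<times> (int \<Rightarrow> 'f)) measure)" by simp
    have "tail_le R \<gamma> (distr (density Q g) pair_env (env_view t))" for t
    proof -
      have "finite_measure (distr Q pair_env (env_view t))"
        using cQ by (intro env_dominated_finite) (simp add: controlled_def)
      then interpret q: finite_measure "distr Q pair_env (env_view t)" .
      interpret d: finite_measure "distr (density Q g) pair_env (env_view t)"
        by (rule env_dominated_finite[OF env_dominated_d])
      show ?thesis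
        using R[of t] le[OF E, of t] unfolding tail_le_def
        by (simp add: q.emeasure_eq_measure d.emeasure_eq_measure)
    qed
    then show ?thesis by blast
  qed
  then show ?thesis unfolding controlled_def using sd mk env_dominated_d by blast
qed

text \<open>An approximating event may be moved back in time: \<open>path_back\<close> turns it into
  an event of an earlier past, and since both \<open>A\<close> and \<open>Q\<close> are invariant,
  the error is unchanged. Thus the time \<open>t\<close> can be prescribed.\<close>

lemma past_approximation_invariant:
  assumes s: "sets Q = sets chain_space" and inv: "distr Q chain_space path_shift = Q" and "finite_measure Q"
    and A: "A \<in> sets chain_space" and invA: "path_shift -` A = A" and "0 < e"
  shows "\<exists>B. B \<in> sets (past t) \<and> measure Q (sym_diff A B) < e"
proof -
  note [measurable_cong] = s
  have space_Q: "space Q = UNIV" using sets_eq_imp_space_eq[OF s] by simp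
  obtain u B where B: "B \<in> sets (past u)" "measure Q (sym_diff A B) < e"
    using past_approximation[OF \<open>finite_measure Q\<close> s A \<open>0 < e\<close>] by blast
  have invA': "path_back -` A = A"
  proof -
    have "path_back -` A = path_back -` (path_shift -` A)" by (simp add: invA)
    also have "\<dots> = A" by auto
    finally show ?thesis .
  qed
  have "\<exists>B. B \<in> sets (past (u - int k)) \<and> measure Q (sym_diff A B) < e" for k
  proof (induction k)
    case 0 show ?case using B by auto
  next
    case (Suc k)
    then obtain B where B: "B \<in> sets (past (u - int k))" and e: "measure Q (sym_diff A B) < e" by blast
    let ?B = "path_back -` B"
    have B': "?B \<in> sets (past (u - int (Suc k)))"
      using past_shift_by[OF B, of "-1"] by (simp add: path_back_def[abs_def] algebra_simps)
    have m: "sym_diff A ?B \<in> sets chain_space"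
      using A B' sets_past_subset by blast
    have "measure Q (sym_diff A ?B) = measure (distr Q chain_space path_shift) (sym_diff A ?B)"
      by (simp add: inv)
    also have "\<dots> = measure Q (path_shift -` (sym_diff A ?B) \<inter> space Q)"
      by (rule measure_distr[OF _ m]) measurable
    also have "path_shift -` (sym_diff A ?B) \<inter> space Q = sym_diff A B"
      using invA by (auto simp: space_Q)
    finally show ?case using B' e by auto
  qed
  from this[of "nat (u - t)"] obtain B' where B': "B' \<in> sets (past (u - int (nat (u - t))))" "measure Q (sym_diff A B') < e"
    by blast
  moreover have "u - int (nat (u - t)) \<le> t" by simp
  ultimately show ?thesis using sets_past_mono by blast
qed

text \<open>An event of the past of \<open>t\<close> could simply be absorbed into \<open>S\<close>.
  \<open>A\<close> is such an event only up to an arbitrarily small error, but replacing it by an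
  approximation \<open>B\<close> changes either side of the identity by at most the mass of the
  symmetric difference.\<close>

lemma markov_at_invariant_density:
  assumes Q: "stationary_chain Q" and A: "A \<in> sets chain_space" and invA: "path_shift -` A = A"
  shows "markov_at (density Q (indicator A)) t"
proof (rule markov_atI)
  have s: "sets Q = sets chain_space" and inv: "distr Q chain_space path_shift = Q" and pQ: "prob_space Q"
    and mk: "markov_at Q t"
    using Q by (auto simp: stationary_chain_def)
  interpret Q: prob_space Q by (rule pQ)
  note [measurable_cong] = s
  note [measurable] = A
  have space_Q: "space Q = UNIV" using sets_eq_imp_space_eq[OF s] by simp
  show "sets (density Q (indicator A)) = sets chain_space" by (simp add: s)
  have dens: "emeasure (density Q (indicator A)) X = emeasure Q (A \<inter> X)" if "X \<in> sets chain_space" for X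
    using that A by (intro emeasure_restricted) (simp_all add: s)
  show "finite_measure (density Q (indicator A))"
    using A by (intro finite_measureI) (simp add: dens space_Q)
  fix S :: "(int \<Rightarrow> 'e \<times> 'f) set" and E :: "'e set" assume S: "S \<in> sets (past t)" and E: "E \<in> sets borel"
  define p where "p \<omega> = emeasure (P (snd (\<omega> (t - 1))) (fst (\<omega> (t - 1)))) E" for \<omega> :: "int \<Rightarrow> 'e \<times> 'f"
  have p [measurable]: "p \<in> borel_measurable chain_space"
    unfolding p_def[abs_def] by (rule P_emeasure_coord[OF E])
  have p1: "p \<omega> \<le> 1" for \<omega>
    unfolding p_def using prob_space.emeasure_le_1[OF prob_P] by blast
  note YE = chain_fst_set[OF E, of t]
  have Sc [measurable]: "S \<in> sets chain_space" using S sets_past_subset by blast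
  define X where "X = S \<inter> {\<omega>. fst (\<omega> t) \<in> E}"
  have X [measurable]: "X \<in> sets chain_space" using Sc YE by (auto simp: X_def)
  have base: "emeasure Q (B \<inter> X) = (\<integral>\<^sup>+\<omega>. p \<omega> * indicator (B \<inter> S) \<omega> \<partial>Q)" if B: "B \<in> sets (past t)" for B
  proof -
    have BS: "B \<inter> S \<in> sets (past t)" using B S by (rule sets.Int)
    have "B \<inter> X = (B \<inter> S) \<inter> {\<omega>. fst (\<omega> t) \<in> E}" by (auto simp: X_def)
    then show ?thesis
      unfolding p_def using markov_at_emeasure[OF s mk BS E] by simp
  qed
  let ?I = "\<lambda>B. \<integral>\<^sup>+\<omega>. p \<omega> * indicator (B \<inter> S) \<omega> \<partial>Q"
  \<comment> \<open>Stated for both orders of \<open>A\<close> and \<open>B\<close>, because the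
    identity is proved as two inequalities.\<close>
  have ebound: "emeasure Q (B1 \<inter> X) \<le> emeasure Q (B2 \<inter> X) + emeasure Q (sym_diff A B)"
    "?I B1 \<le> ?I B2 + emeasure Q (sym_diff A B)"
    if BB: "B1 = A \<and> B2 = B \<or> B1 = B \<and> B2 = A" and B: "B \<in> sets chain_space" for B B1 B2
  proof -
    have "sym_diff A B \<in> sets chain_space" using A B by (intro sets.Un sets.Diff)
    then have m: "B1 \<in> sets Q" "B2 \<in> sets Q" "sym_diff A B \<in> sets Q" "X \<in> sets Q"
      using BB A B X by (auto simp only: s)
    have sub: "B1 \<subseteq> B2 \<union> sym_diff A B" using BB by blast
    have "emeasure Q (B1 \<inter> X) \<le> emeasure Q ((B2 \<inter> X) \<union> sym_diff A B)"
      using sub m by (intro emeasure_mono) auto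
    also have "\<dots> \<le> emeasure Q (B2 \<inter> X) + emeasure Q (sym_diff A B)"
      using m by (intro emeasure_subadditive) auto
    finally show "emeasure Q (B1 \<inter> X) \<le> emeasure Q (B2 \<inter> X) + emeasure Q (sym_diff A B)" .
    have m2 [measurable]: "B2 \<in> sets chain_space" "sym_diff A B \<in> sets chain_space" using m s by auto
    have "?I B1 \<le> (\<integral>\<^sup>+\<omega>. p \<omega> * indicator (B2 \<inter> S) \<omega> + indicator (sym_diff A B) \<omega> \<partial>Q)"
    proof (rule nn_integral_mono)
      fix \<omega>
      show "p \<omega> * indicator (B1 \<inter> S) \<omega> \<le> p \<omega> * indicator (B2 \<inter> S) \<omega> + indicator (sym_diff A B) \<omega>"
        using sub p1[of \<omega>] by (auto simp: indicator_def)
    qed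
    also have "\<dots> = ?I B2 + (\<integral>\<^sup>+\<omega>. indicator (sym_diff A B) \<omega> \<partial>Q)"
      by (rule nn_integral_add) measurable
    also have "\<dots> = ?I B2 + emeasure Q (sym_diff A B)" using m by simp
    finally show "?I B1 \<le> ?I B2 + emeasure Q (sym_diff A B)" .
  qed
  have approx: "\<exists>B. B \<in> sets (past t) \<and> emeasure Q (sym_diff A B) \<le> ennreal (e / 2)" if "0 < e" for e :: real
  proof -
    obtain B where "B \<in> sets (past t)" "measure Q (sym_diff A B) < e / 2"
      using past_approximation_invariant[OF s inv Q.finite_measure_axioms A invA, of "e / 2" t] \<open>0 < e\<close> by auto
    then show ?thesis
      by (intro exI[of _ B]) (simp add: Q.emeasure_eq_measure ennreal_leI)
  qed
  have halves: "a + ennreal (e / 2) + ennreal (e / 2) = a + ennreal e" if "0 < e" for a e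
    using that by (simp add: add.assoc ennreal_plus[symmetric] del: ennreal_plus)
  have "emeasure Q (A \<inter> X) = ?I A"
  proof (rule antisym; rule ennreal_le_epsilon)
    fix e :: real assume e: "0 < e"
    obtain B where B: "B \<in> sets (past t)" and d: "emeasure Q (sym_diff A B) \<le> ennreal (e / 2)"
      using approx[OF e] by blast
    have Bc: "B \<in> sets chain_space" using B sets_past_subset by blast
    have "emeasure Q (A \<inter> X) \<le> emeasure Q (B \<inter> X) + ennreal (e / 2)"
      using ebound(1)[of A B B] Bc d by (auto intro: order_trans add_left_mono)
    also have "emeasure Q (B \<inter> X) \<le> ?I A + ennreal (e / 2)"
      unfolding base[OF B] using ebound(2)[of B A B] Bc d by (auto intro: order_trans add_left_mono)
    finally show "emeasure Q (A \<inter> X) \<le> ?I A + ennreal e" by (simp add: halves[OF e])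
  next
    fix e :: real assume e: "0 < e"
    obtain B where B: "B \<in> sets (past t)" and d: "emeasure Q (sym_diff A B) \<le> ennreal (e / 2)"
      using approx[OF e] by blast
    have Bc: "B \<in> sets chain_space" using B sets_past_subset by blast
    have "?I A \<le> ?I B + ennreal (e / 2)"
      using ebound(2)[of A B B] Bc d by (auto intro: order_trans add_left_mono)
    also have "?I B \<le> emeasure Q (A \<inter> X) + ennreal (e / 2)"
      unfolding base[OF B, symmetric] using ebound(1)[of B A B] Bc d by (auto intro: order_trans add_left_mono)
    finally show "?I A \<le> emeasure Q (A \<inter> X) + ennreal e" by (simp add: halves[OF e])
  qed
  also have "?I A = (\<integral>\<^sup>+\<omega>. indicator A \<omega> * (p \<omega> * indicator S \<omega>) \<partial>Q)"
    by (intro nn_integral_cong) (auto simp: indicator_def)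
  also have "\<dots> = (\<integral>\<^sup>+\<omega>. p \<omega> * indicator S \<omega> \<partial>density Q (indicator A))"
    by (rule nn_integral_density[symmetric]) measurable
  finally show "emeasure (density Q (indicator A)) (S \<inter> {\<omega>. fst (\<omega> t) \<in> E}) =
      (\<integral>\<^sup>+\<omega>. emeasure (P (snd (\<omega> (t - 1))) (fst (\<omega> (t - 1)))) E * indicator S \<omega> \<partial>density Q (indicator A))"
    using X by (simp add: dens p_def X_def)
qed

proposition stationary_chain_ergodic:
  assumes Q: "stationary_chain Q" and erg: "ergodic_law L"
  shows "ergodic_law Q"
  unfolding ergodic_law_def
proof (intro ballI impI)
  have s: "sets Q = sets chain_space" and inv: "distr Q chain_space path_shift = Q" and pQ: "prob_space Q"
    and mk: "\<And>t. markov_at Q t" and env: "distr Q env_space (\<lambda>\<omega> s. snd (\<omega> s)) = L"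
    using Q by (auto simp: stationary_chain_def)
  interpret Q: prob_space Q by (rule pQ)
  note [measurable_cong] = s
  have space_Q: "space Q = UNIV" using sets_eq_imp_space_eq[OF s] by simp
  fix A assume AQ: "A \<in> sets Q" and "path_shift -` A \<inter> space Q = A"
  then have A [measurable]: "A \<in> sets chain_space" and invA: "path_shift -` A = A" by (simp_all add: s space_Q)
  define p where "p = measure Q A"
  have p: "0 \<le> p" "p \<le> 1" by (simp_all add: p_def)
  define QA where "QA = density Q (indicator A)"
  define Qp where "Qp = density Q (\<lambda>_. ennreal p)"
  have sA: "sets QA = sets chain_space" and sp: "sets Qp = sets chain_space" by (simp_all add: QA_def Qp_def s)
  have dens: "emeasure QA X = emeasure Q (A \<inter> X)" if "X \<in> sets chain_space" for X
    unfolding QA_def using that A by (intro emeasure_restricted) (simp_all add: s)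
  have densp: "emeasure Qp X = ennreal p * emeasure Q X" if X: "X \<in> sets chain_space" for X
    unfolding Qp_def using X s by (subst emeasure_density) (auto simp: nn_integral_cmult)
  have cA: "controlled QA"
    unfolding QA_def by (rule controlled_density[OF Q _ _ markov_at_invariant_density[OF Q A invA]]) (auto simp: indicator_def)
  have cp: "controlled Qp"
    unfolding Qp_def
  proof (rule controlled_density[OF Q])
    show "markov_at (density Q (\<lambda>_. ennreal p)) t" for t
      unfolding markov_at_def
    proof (intro ballI)
      fix S :: "(int \<Rightarrow> 'e \<times> 'f) set" and f :: "'e \<times> (int \<Rightarrow> 'f) \<Rightarrow> ennreal"
      assume S: "S \<in> sets (past t)" and f: "f \<in> borel_measurable pair_env"
      have Sc: "S \<in> sets chain_space" using S sets_past_subset by blast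
      have "(\<integral>\<^sup>+\<omega>. g (env_view u \<omega>) * indicator S \<omega> \<partial>density Q (\<lambda>_. ennreal p)) =
          ennreal p * (\<integral>\<^sup>+\<omega>. g (env_view u \<omega>) * indicator S \<omega> \<partial>Q)"
        if g: "g \<in> borel_measurable pair_env" for g :: "'e \<times> (int \<Rightarrow> 'f) \<Rightarrow> ennreal" and u
      proof -
        have "(\<lambda>\<omega>. g (env_view u \<omega>) * indicator S \<omega>) \<in> borel_measurable chain_space"
          by (rule env_view_indicator_measurable[OF g Sc])
        then have "(\<lambda>\<omega>. g (env_view u \<omega>) * indicator S \<omega>) \<in> borel_measurable Q"
          using s by (simp cong: measurable_cong_sets)
        then show ?thesis by (simp add: nn_integral_density nn_integral_cmult)
      qed
      note * = this
      show "(\<integral>\<^sup>+\<omega>. f (env_view t \<omega>) * indicator S \<omega> \<partial>density Q (\<lambda>_. ennreal p)) =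
          (\<integral>\<^sup>+\<omega>. transop f (env_view (t - 1) \<omega>) * indicator S \<omega> \<partial>density Q (\<lambda>_. ennreal p))"
        unfolding *[OF f] *[OF transop_measurable[OF f]] markov_atD[OF mk S f] ..
    qed
  qed (use p in auto)
  have invQA: "distr QA chain_space path_shift = QA"
  proof (rule measure_eqI)
    fix X assume "X \<in> sets (distr QA chain_space path_shift)"
    then have X: "X \<in> sets chain_space" by simp
    have X': "path_shift -` X \<in> sets chain_space" using measurable_sets[OF chain_shift X] by simp
    have "emeasure (distr QA chain_space path_shift) X = emeasure QA (path_shift -` X \<inter> space QA)"
      using X sA by (intro emeasure_distr) (simp_all cong: measurable_cong_sets)
    also have "\<dots> = emeasure Q (A \<inter> path_shift -` X)"
      using X' by (simp add: sets_eq_imp_space_eq[OF sA] dens)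
    also have "A \<inter> path_shift -` X = path_shift -` (A \<inter> X) \<inter> space Q" using invA by (auto simp: space_Q)
    also have "emeasure Q \<dots> = emeasure (distr Q chain_space path_shift) (A \<inter> X)"
      using X A by (intro emeasure_distr[symmetric]) auto
    also have "\<dots> = emeasure QA X" using X by (simp add: inv dens)
    finally show "emeasure (distr QA chain_space path_shift) X = emeasure QA X" .
  qed (simp add: sA)
  define LA where "LA = distr QA env_space (\<lambda>\<omega>. snd (env_view 0 \<omega>))"
  have sv: "(\<lambda>\<omega>. snd (env_view t \<omega>)) \<in> \<rho> \<rightarrow>\<^sub>M env_space" if [measurable_cong]: "sets \<rho> = sets chain_space" for \<rho> t
    by measurable
  have pre: "(\<lambda>\<omega>::int \<Rightarrow> 'e \<times> 'f. snd (env_view t \<omega>)) -` B \<in> sets chain_space" if "B \<in> sets env_space" for t and B :: "(int \<Rightarrow> 'f) set"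
    using measurable_sets[OF sv[OF refl] that, of t] by simp
  have eLA: "emeasure (distr QA env_space (\<lambda>\<omega>. snd (env_view t \<omega>))) B = emeasure Q (A \<inter> (\<lambda>\<omega>. snd (env_view t \<omega>)) -` B)"
    if B: "B \<in> sets env_space" for t B
    using pre[OF B] by (simp add: emeasure_distr[OF sv[OF sA] B] sets_eq_imp_space_eq[OF sA] dens)
  have eL: "emeasure L B = emeasure Q ((\<lambda>\<omega>. snd (env_view t \<omega>)) -` B)" if B: "B \<in> sets env_space" for t B
    using emeasure_distr[OF sv[OF s] B, of t] by (simp add: stationary_chain_env[OF Q] space_Q)
  have constA: "distr QA env_space (\<lambda>\<omega>. snd (env_view t \<omega>)) = LA" for t
    unfolding LA_def distr_env_view_snd[OF sA] by (subst shift_invariant_law[OF sA invQA]) simp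
  have "measure LA C = measure LA UNIV * measure L C" if C: "C \<in> sets env_space" for C
  proof (rule ergodic_dominated_invariant[OF prob_L sets_L erg _ _ _ _ C])
    fix B :: "(int \<Rightarrow> 'f) set" assume B: "B \<in> sets env_space"
    have B': "path_shift -` B \<in> sets env_space" using measurable_sets[OF measurable_path_shift B] by simp
    have "measure (distr L env_space path_shift) B = measure L (path_shift -` B \<inter> space L)"
      using B by (intro measure_distr) measurable
    then show "measure L (path_shift -` B) = measure L B" by (simp add: L_inv)
    show "emeasure LA B \<le> emeasure L B"
      unfolding LA_def eLA[OF B] eL[OF B, of 0] using pre[OF B] s by (intro emeasure_mono) auto
    have "emeasure LA (path_shift -` B) = emeasure Q (A \<inter> (\<lambda>\<omega>. snd (env_view 0 \<omega>)) -` (path_shift -` B))"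
      unfolding LA_def by (rule eLA[OF B'])
    also have "(\<lambda>\<omega>. snd (env_view 0 \<omega>)) -` (path_shift -` B) = (\<lambda>\<omega>::int \<Rightarrow> 'e \<times> 'f. snd (env_view 1 \<omega>)) -` B"
      by (simp add: vimage_def env_view_def path_shift_def)
    also have "emeasure Q (A \<inter> (\<lambda>\<omega>::int \<Rightarrow> 'e \<times> 'f. snd (env_view 1 \<omega>)) -` B) = emeasure LA B"
      unfolding eLA[OF B, symmetric] constA ..
    finally show "measure LA (path_shift -` B) = measure LA B" by (simp add: measure_def)
  qed (simp add: LA_def)
  moreover have "measure LA UNIV = p"
  proof -
    have "emeasure LA UNIV = emeasure Q A"
      unfolding LA_def using sets.top[of "env_space :: (int \<Rightarrow> 'f) measure"] by (subst eLA) auto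
    then show ?thesis by (simp add: measure_def p_def)
  qed
  ultimately have LA: "measure LA C = p * measure L C" if "C \<in> sets env_space" for C using that by simp
  have "QA = Qp"
  proof (rule controlled_unique[OF cA cp])
    fix t
    show "distr QA env_space (\<lambda>\<omega>. snd (env_view t \<omega>)) = distr Qp env_space (\<lambda>\<omega>. snd (env_view t \<omega>))"
      unfolding constA
    proof (rule measure_eqI)
      show "sets LA = sets (distr Qp env_space (\<lambda>\<omega>. snd (env_view t \<omega>)))" by (simp add: LA_def)
      fix C assume "C \<in> sets LA"
      then have C: "C \<in> sets env_space" by (simp add: LA_def)
      have "emeasure LA C \<le> 1" unfolding LA_def eLA[OF C] using Q.emeasure_le_1 by blast
      then have "emeasure LA C = ennreal (measure LA C)"
        by (intro emeasure_eq_ennreal_measure) (auto simp: top_unique)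
      also have "\<dots> = ennreal p * emeasure L C"
        using p by (simp add: LA[OF C] L.emeasure_eq_measure ennreal_mult)
      also have "\<dots> = emeasure (distr Qp env_space (\<lambda>\<omega>. snd (env_view t \<omega>))) C"
        using pre[OF C] by (simp add: emeasure_distr[OF sv[OF sp] C] sets_eq_imp_space_eq[OF sp] densp eL[OF C, of t])
      finally show "emeasure LA C = emeasure (distr Qp env_space (\<lambda>\<omega>. snd (env_view t \<omega>))) C" .
    qed
  qed
  \<comment> \<open>The two measures are compared on the event \<open>A\<close> itself, which gives
    p = p * p.\<close>
  then have "emeasure Q A = ennreal p * emeasure Q A"
    using dens[OF A] densp[OF A] by simp
  then have "p = p * p"
    using p by (simp add: Q.emeasure_eq_measure p_def[symmetric] ennreal_mult[symmetric])
  then have "p * (p - 1) = 0" by (simp add: algebra_simps)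
  then show "measure Q A = 0 \<or> measure Q A = 1" by (simp add: p_def)
qed

end

section \<open>Integrability of the environment and the conclusion\<close>

lemma nn_integral_coordinate:
  fixes L :: "(int \<Rightarrow> 'f::polish_space) measure"
  assumes s: "sets L = sets env_space" and inv: "distr L env_space path_shift = L"
    and g: "g \<in> borel_measurable borel"
  shows "(\<integral>\<^sup>+x. g (x t) \<partial>L) = (\<integral>\<^sup>+x. g (x 0) \<partial>L)"
proof -
  note [measurable_cong] = s
  note [measurable] = g
  have step: "(\<integral>\<^sup>+x. g (x (t + 1)) \<partial>L) = (\<integral>\<^sup>+x. g (x t) \<partial>L)" for t
  proof -
    have "(\<integral>\<^sup>+x. g (x t) \<partial>distr L env_space path_shift) = (\<integral>\<^sup>+x. g (path_shift x t) \<partial>L)"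
      by (rule nn_integral_distr) measurable
    then show ?thesis by (simp add: inv path_shift_def)
  qed
  show ?thesis
  proof (induction t rule: int_induct[where k = 0])
    case (step1 i) then show ?case using step[of i] by simp
  next
    case (step2 i) then show ?case using step[of "i - 1"] by simp
  qed simp
qed

text \<open>The positive indices number at most z / d; the index 0 accounts for the
  \<open>+ 1\<close>.\<close>

lemma count_multiples_le:
  fixes d z :: real
  assumes d: "0 < d" and z: "0 \<le> z"
  shows "(\<Sum>n. if real n * d < z then 1 else 0 :: ennreal) \<le> ennreal (z / d + 1)"
proof (rule suminf_le_const)
  show "summable (\<lambda>n. if real n * d < z then 1 else 0 :: ennreal)" by simp
  fix N :: nat
  have "{n \<in> {..<N}. real n * d < z} \<subseteq> {..nat \<lfloor>z / d\<rfloor>}"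
  proof safe
    fix n assume "real n * d < z"
    then have "real n \<le> z / d" using d by (simp add: field_simps)
    then show "n \<le> nat \<lfloor>z / d\<rfloor>" by (simp add: le_nat_floor)
  qed
  then have "card {n \<in> {..<N}. real n * d < z} \<le> nat \<lfloor>z / d\<rfloor> + 1"
    using card_mono[of "{..nat \<lfloor>z / d\<rfloor>}"] by simp
  then have "real (card {n \<in> {..<N}. real n * d < z}) \<le> real (nat \<lfloor>z / d\<rfloor>) + 1" by linarith
  also have "real (nat \<lfloor>z / d\<rfloor>) \<le> z / d" using d z by (simp add: of_nat_nat)
  finally have le: "real (card {n \<in> {..<N}. real n * d < z}) \<le> z / d + 1" by simp
  have "(\<Sum>n<N. if real n * d < z then 1 else 0 :: ennreal) = of_nat (card {n \<in> {..<N}. real n * d < z})"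
    by (simp add: sum.If_cases Int_def)
  also have "\<dots> = ennreal (real (card {n \<in> {..<N}. real n * d < z}))"
    by (simp add: ennreal_of_nat_eq_real_of_nat)
  also have "\<dots> \<le> ennreal (z / d + 1)" by (rule ennreal_leI[OF le])
  finally show "(\<Sum>n<N. if real n * d < z then 1 else 0 :: ennreal) \<le> ennreal (z / d + 1)" .
qed

lemma logplus_nonneg: "0 \<le> logplus u" and le_exp_logplus: "u \<le> exp (logplus u)"
  by (auto simp: logplus_def max_def)

lemma logplus_measurable [measurable]: "logplus \<in> borel_measurable borel"
  unfolding logplus_def[abs_def] by measurable

text \<open>Borel-Cantelli. By stationarity the probabilities of the exceptional events can all be
  computed at time 0, where \<open>count_multiples_le\<close> bounds their sum by the mean of
  \<open>logplus\<close> over d, plus 1.\<close>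

lemma eventually_logplus_le:
  fixes L :: "(int \<Rightarrow> 'f::polish_space) measure"
  assumes prob: "prob_space L" and s: "sets L = sets env_space" and inv: "distr L env_space path_shift = L"
    and b [measurable]: "b \<in> borel_measurable borel"
    and fin: "(\<integral>\<^sup>+x. ennreal (logplus (b (x 0))) \<partial>L) < \<infinity>" and d: "0 < d"
  shows "AE x in L. eventually (\<lambda>n. logplus (b (x (- 1 - int n))) \<le> real n * d) sequentially"
proof -
  interpret prob_space L by (rule prob)
  note [measurable_cong] = s
  have space: "space L = UNIV" using sets_eq_imp_space_eq[OF s] by simp
  define A where "A n = {x\<in>space L. real n * d < logplus (b (x (- 1 - int n)))}" for n
  have A [measurable]: "A n \<in> sets L" for n unfolding A_def by measurable
  have em: "emeasure L (A n) = (\<integral>\<^sup>+x. (if real n * d < logplus (b (x 0)) then 1 else 0) \<partial>L)" for n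
  proof -
    have "emeasure L (A n) = (\<integral>\<^sup>+x. indicator (A n) x \<partial>L)" using A by simp
    also have "\<dots> = (\<integral>\<^sup>+x. (\<lambda>u. if real n * d < logplus (b u) then 1 else 0) (x (- 1 - int n)) \<partial>L)"
      by (intro nn_integral_cong) (auto simp: A_def space indicator_def)
    also have "\<dots> = (\<integral>\<^sup>+x. (if real n * d < logplus (b (x 0)) then 1 else 0) \<partial>L)"
      by (rule nn_integral_coordinate[OF s inv]) measurable
    finally show ?thesis .
  qed
  have "(\<Sum>n. emeasure L (A n)) = (\<integral>\<^sup>+x. (\<Sum>n. if real n * d < logplus (b (x 0)) then 1 else 0) \<partial>L)"
    unfolding em by (rule nn_integral_suminf[symmetric]) measurable
  also have "\<dots> \<le> (\<integral>\<^sup>+x. ennreal (1 / d) * ennreal (logplus (b (x 0))) + 1 \<partial>L)"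
  proof (rule nn_integral_mono)
    fix x :: "int \<Rightarrow> 'f"
    have "ennreal (logplus (b (x 0)) / d + 1) = ennreal (1 / d) * ennreal (logplus (b (x 0))) + 1"
      using d logplus_nonneg by (simp add: ennreal_mult[symmetric] ennreal_plus)
    then show "(\<Sum>n. if real n * d < logplus (b (x 0)) then 1 else 0) \<le> ennreal (1 / d) * ennreal (logplus (b (x 0))) + 1"
      using count_multiples_le[OF d logplus_nonneg, of "b (x 0)"] by simp
  qed
  also have "\<dots> = ennreal (1 / d) * (\<integral>\<^sup>+x. ennreal (logplus (b (x 0))) \<partial>L) + 1"
    by (simp add: nn_integral_add nn_integral_cmult emeasure_space_1[unfolded space] space)
  also have "\<dots> < \<infinity>" using fin by (auto simp: ennreal_mult_eq_top_iff less_top[symmetric])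
  finally have "(\<Sum>n. ennreal (measure L (A n))) \<noteq> \<top>" by (simp add: emeasure_eq_measure)
  then have "summable (\<lambda>n. measure L (A n))" by (intro summable_suminf_not_top) auto
  then have "AE x in L. eventually (\<lambda>n. x \<in> space L - A n) sequentially"
    by (intro borel_cantelli_AE1 A) (auto simp: emeasure_eq_measure)
  then show ?thesis
    by eventually_elim (auto simp: A_def space not_less elim: eventually_mono)
qed

text \<open>The products decay like q ^ n for some q < 1, while \<open>b\<close> along the past
  grows more slowly than any exponential. A rate d with exp d * q < 1 gives a geometric majorant;
  the constant v adds a second geometric series.\<close>

lemma lyap_finite_of_contraction:
  assumes lam: "\<And>x. 0 \<le> lam x" and b: "\<And>x. 0 \<le> b x" and v: "0 \<le> v"
    and contr: "limsup (\<lambda>n. ereal (root n (\<Prod>i\<in>{1..n}. lam (x (- int i))))) < 1"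
    and growth: "\<And>k. eventually (\<lambda>n. logplus (b (x (- 1 - int n))) \<le> real n * (1 / real (Suc k))) sequentially"
  shows "lyap lam (\<lambda>x. b x + v) x < \<infinity>"
proof -
  let ?p = "\<lambda>n. \<Prod>i\<in>{1..n}. lam (x (- int i))"
  have p0: "0 \<le> ?p n" for n using lam by (intro prod_nonneg) auto
  obtain q0 where q0: "limsup (\<lambda>n. ereal (root n (?p n))) < ereal q0" "ereal q0 < 1"
    using ereal_dense2[OF contr] by auto
  \<comment> \<open>Makes q visibly positive, so that ln (1 / q) can be used as the admissible
    growth rate.\<close>
  define q where "q = max q0 (1 / 2)"
  have q: "0 < q" "q < 1" using q0 by (auto simp: q_def)
  have "limsup (\<lambda>n. ereal (root n (?p n))) < ereal q"
    using q0(1) by (rule order.strict_trans2) (simp add: q_def)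
  then have ev: "eventually (\<lambda>n. ereal (root n (?p n)) < ereal q) sequentially"
    by (rule Limsup_lessD)
  \<comment> \<open>\<open>root 0\<close> is 0 by convention and says nothing about the product,
    hence the restriction to positive n.\<close>
  have pq: "eventually (\<lambda>n. ?p n \<le> q ^ n) sequentially"
    using ev eventually_gt_at_top[of 0]
  proof eventually_elim
    case (elim n)
    then have "root n (?p n) ^ n \<le> q ^ n" using p0[of n] by (intro power_mono) auto
    then show ?case using elim p0[of n] by (simp add: real_root_pow_pos2)
  qed
  have "0 < ln (1 / q)" using q by simp
  then obtain k where k: "inverse (real (Suc k)) < ln (1 / q)" using reals_Archimedean by blast
  define d where "d = 1 / real (Suc k)"
  have "exp d < 1 / q" using k q by (simp add: d_def inverse_eq_divide exp_less_cancel_iff[of _ "ln (1 / q)", symmetric])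
  then have sq: "exp d * q < 1" using q by (simp add: field_simps)
  let ?f = "\<lambda>n. (b (x (- 1 - int n)) + v) * ?p n"
  have f0: "0 \<le> ?f n" for n using b v p0 by simp
  have "eventually (\<lambda>n. norm (?f n) \<le> (exp d * q) ^ n + v * q ^ n) sequentially"
    using growth[of k] pq
  proof eventually_elim
    case (elim n)
    have "b (x (- 1 - int n)) \<le> exp (logplus (b (x (- 1 - int n))))" by (rule le_exp_logplus)
    also have "\<dots> \<le> exp (real n * d)" using elim by (simp add: d_def)
    also have "\<dots> = exp d ^ n" by (rule exp_of_nat_mult)
    finally have "?f n \<le> (exp d ^ n + v) * q ^ n"
      using elim p0 v b by (intro mult_mono) auto
    then show ?case using f0[of n] by (simp add: algebra_simps power_mult_distrib)
  qed
  moreover have "summable (\<lambda>n. (exp d * q) ^ n + v * q ^ n)"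
    using q sq by (intro summable_add summable_mult summable_geometric) auto
  ultimately have "summable ?f" by (rule summable_comparison_test_ev)
  then have "(\<Sum>n. ennreal (?f n)) = ennreal (\<Sum>n. ?f n)"
    using f0 by (intro suminf_ennreal2)
  then show ?thesis by (simp add: lyap_def)
qed

section \<open>From processes to path laws and back\<close>

lemma measurable_paths:
  "(\<lambda>\<omega> t. Z t \<omega>) \<in> N \<rightarrow>\<^sub>M path_space S" if "\<And>t. Z t \<in> N \<rightarrow>\<^sub>M S"
  by (rule measurable_PiM_single') (auto simp: that intro: measurable_space[OF that])

lemma law_shift:
  assumes Z: "\<And>t. Z t \<in> N \<rightarrow>\<^sub>M S"
  shows "law N S (\<lambda>t. Z (t + 1)) = distr (law N S Z) (path_space S) path_shift"
  unfolding law_def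
  by (subst distr_distr[OF measurable_path_shift measurable_paths[of Z, OF Z]]) (simp add: o_def path_shift_def)

lemma past_sigma_subalgebra:
  assumes Y: "\<And>t. Y t \<in> N \<rightarrow>\<^sub>M borel" and X: "\<And>t. X t \<in> N \<rightarrow>\<^sub>M borel"
  shows "subalgebra N (past_sigma N Y X t)"
proof -
  have "sigma_sets (space N) ({X s -` B \<inter> space N | s B. B \<in> sets borel} \<union> {Y s -` B \<inter> space N | s B. s < t \<and> B \<in> sets borel})
      \<subseteq> sets N"
    using measurable_sets[OF X] measurable_sets[OF Y] by (intro sets.sigma_sets_subset) blast
  then show ?thesis
    unfolding subalgebra_def past_sigma_def by (auto simp: space_measure_of_conv sets_measure_of_conv split: if_splits)
qed

lemma space_past_sigma: "space (past_sigma N Y X t) = space N"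
  by (simp add: past_sigma_def space_measure_of_conv)

lemma past_preimage:
  fixes Y :: "int \<Rightarrow> 'w \<Rightarrow> 'e::polish_space" and X :: "int \<Rightarrow> 'w \<Rightarrow> 'f::polish_space"
  assumes S: "S \<in> sets (past t)"
  shows "(\<lambda>\<omega> s. (Y s \<omega>, X s \<omega>)) -` S \<inter> space N \<in> sets (past_sigma N Y X t)"
  using S unfolding sets_past
proof (induction S rule: sigma_sets.induct)
  case (Basic S)
  let ?G = "{X s -` B \<inter> space N | s B. B \<in> sets borel} \<union> {Y s -` B \<inter> space N | s B. s < t \<and> B \<in> sets borel}"
  have sets: "sets (past_sigma N Y X t) = sigma_sets (space N) ?G"
    unfolding past_sigma_def by (subst sets_measure_of) auto
  have "(\<lambda>\<omega> s. (Y s \<omega>, X s \<omega>)) -` S \<inter> space N \<in> ?G"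
  proof -
    from Basic consider s B where "S = (\<lambda>\<omega>. snd (\<omega> s)) -` B" "B \<in> sets borel"
      | s B where "S = (\<lambda>\<omega>. fst (\<omega> s)) -` B" "s < t" "B \<in> sets borel" by blast
    then show ?thesis
    proof cases
      case 1
      then have "(\<lambda>\<omega> s. (Y s \<omega>, X s \<omega>)) -` S \<inter> space N = X s -` B \<inter> space N" by auto
      then show ?thesis using 1(2) by blast
    next
      case 2
      then have "(\<lambda>\<omega> s. (Y s \<omega>, X s \<omega>)) -` S \<inter> space N = Y s -` B \<inter> space N" by auto
      then show ?thesis using 2(2,3) by blast
    qed
  qed
  then show ?case unfolding sets by (rule sigma_sets.Basic)
next
  case (Compl S)
  have "(\<lambda>\<omega> s. (Y s \<omega>, X s \<omega>)) -` (UNIV - S) \<inter> space N =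
      space (past_sigma N Y X t) - (\<lambda>\<omega> s. (Y s \<omega>, X s \<omega>)) -` S \<inter> space N"
    by (auto simp: space_past_sigma)
  then show ?case using Compl.IH by (simp only: sets.compl_sets)
next
  case (Union A)
  have "(\<lambda>\<omega> s. (Y s \<omega>, X s \<omega>)) -` (\<Union>i. A i) \<inter> space N = (\<Union>i. (\<lambda>\<omega> s. (Y s \<omega>, X s \<omega>)) -` A i \<inter> space N)" by auto
  also have "\<dots> \<in> sets (past_sigma N Y X t)" using Union.IH by (intro sets.countable_UN) auto
  finally show ?case .
qed auto

context drift_kernel
begin

text \<open>Past events of path space pull back to past events of the process. Integrating the
  conditional identity over them gives the hypothesis of \<open>markov_atI\<close>.\<close>

lemma stationary_chain_law:
  fixes Y :: "int \<Rightarrow> 'w \<Rightarrow> 'e" and X :: "int \<Rightarrow> 'w \<Rightarrow> 'f"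
  assumes mc: "MCRE P L N Y X"
  shows "stationary_chain (law N (borel \<Otimes>\<^sub>M borel) (\<lambda>t \<omega>. (Y t \<omega>, X t \<omega>)))"
proof -
  have pN: "prob_space N" and Y: "\<And>t. Y t \<in> N \<rightarrow>\<^sub>M borel" and X: "\<And>t. X t \<in> N \<rightarrow>\<^sub>M borel"
    and st: "stationary N (borel \<Otimes>\<^sub>M borel) (\<lambda>t \<omega>. (Y t \<omega>, X t \<omega>))" and lawX: "law N borel X = L"
    and cond: "\<And>t A. A \<in> sets borel \<Longrightarrow>
      AE \<omega> in N. real_cond_exp N (past_sigma N Y X t) (indicator {\<omega>\<in>space N. Y t \<omega> \<in> A}) \<omega>
        = measure (P (X (t - 1) \<omega>) (Y (t - 1) \<omega>)) A"
    using mc by (auto simp: MCRE_def)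
  interpret N: prob_space N by (rule pN)
  let ?Z = "\<lambda>\<omega> t. (Y t \<omega>, X t \<omega>)"
  have YX: "(\<lambda>\<omega>. (Y t \<omega>, X t \<omega>)) \<in> N \<rightarrow>\<^sub>M borel \<Otimes>\<^sub>M borel" for t
    using Y X by (rule measurable_Pair)
  have Z [measurable]: "?Z \<in> N \<rightarrow>\<^sub>M chain_space"
    using measurable_paths[of "\<lambda>t \<omega>. (Y t \<omega>, X t \<omega>)", OF YX] .
  define Q where "Q = law N (borel \<Otimes>\<^sub>M borel) (\<lambda>t \<omega>. (Y t \<omega>, X t \<omega>))"
  have Q: "Q = distr N chain_space ?Z" by (simp add: Q_def law_def)
  have prob_Q: "prob_space Q" unfolding Q by (rule N.prob_space_distr[OF Z])
  have sets_Q: "sets Q = sets chain_space" by (simp add: Q)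
  have shift: "distr Q chain_space path_shift = Q"
    using st unfolding stationary_def law_shift[of "\<lambda>t \<omega>. (Y t \<omega>, X t \<omega>)", OF YX] Q_def .
  have env: "distr Q env_space (\<lambda>\<omega> s. snd (\<omega> s)) = L"
  proof -
    have "(\<lambda>\<omega> s. snd (\<omega> s)) \<in> (chain_space :: (int \<Rightarrow> 'e \<times> 'f) measure) \<rightarrow>\<^sub>M env_space"
      by (rule measurable_into_env) (rule chain_snd)
    from distr_distr[OF this Z] show ?thesis
      unfolding Q lawX[symmetric] law_def by (simp add: o_def)
  qed
  have "markov_at Q t" for t
  proof (rule markov_atI[OF prob_space.finite_measure[OF prob_Q] sets_Q])
    fix S :: "(int \<Rightarrow> 'e \<times> 'f) set" and A :: "'e set" assume S: "S \<in> sets (past t)" and A: "A \<in> sets borel"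
    define F where "F = past_sigma N Y X t"
    have sub: "subalgebra N F" unfolding F_def by (rule past_sigma_subalgebra[OF Y X])
    interpret finite_measure_subalgebra N F by unfold_locales (rule sub)
    define S' where "S' = ?Z -` S \<inter> space N"
    have S'F: "S' \<in> sets F" unfolding S'_def F_def by (rule past_preimage[OF S])
    then have S' [measurable]: "S' \<in> sets N" using sub by (auto simp: subalgebra_def)
    have Sc: "S \<in> sets chain_space" using S sets_past_subset by blast
    define D where "D = {\<omega>\<in>space N. Y t \<omega> \<in> A}"
    have D [measurable]: "D \<in> sets N"
      using measurable_sets[OF Y A, of t] by (simp add: D_def vimage_def Int_def conj_commute)
    note YA = chain_fst_set[OF A, of t]
    define p where "p \<omega> = measure (P (X (t - 1) \<omega>) (Y (t - 1) \<omega>)) A" for \<omega>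
    have p [measurable]: "p \<in> borel_measurable N"
    proof -
      have "(\<lambda>\<omega>. case (X (t - 1) \<omega>, Y (t - 1) \<omega>) of (x, y) \<Rightarrow> measure (P x y) A) \<in> borel_measurable N"
        using X Y by (intro measurable_compose[OF _ P_meas[OF A]] measurable_Pair)
      then show ?thesis by (simp add: p_def[abs_def])
    qed
    have p0: "0 \<le> p \<omega>" and p1: "p \<omega> \<le> 1" for \<omega>
      using prob_space.prob_le_1[OF prob_P] by (auto simp: p_def)
    have "emeasure Q (S \<inter> {\<omega>. fst (\<omega> t) \<in> A}) = emeasure N (?Z -` (S \<inter> {\<omega>. fst (\<omega> t) \<in> A}) \<inter> space N)"
      unfolding Q using Sc YA by (intro emeasure_distr Z sets.Int)
    also have "?Z -` (S \<inter> {\<omega>. fst (\<omega> t) \<in> A}) \<inter> space N = S' \<inter> D" by (auto simp: S'_def D_def)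
    also have "emeasure N (S' \<inter> D) = ennreal (measure N (S' \<inter> D))" by (rule N.emeasure_eq_measure)
    also have "measure N (S' \<inter> D) = (\<integral>\<omega>\<in>S'. indicat_real D \<omega> \<partial>N)"
    proof -
      have "(\<integral>\<omega>\<in>S'. indicat_real D \<omega> \<partial>N) = (\<integral>\<omega>. indicat_real (S' \<inter> D) \<omega> \<partial>N)"
        unfolding set_lebesgue_integral_def
        by (intro Bochner_Integration.integral_cong) (auto simp: indicator_def)
      then show ?thesis using S' D by simp
    qed
    also have "\<dots> = (\<integral>\<omega>\<in>S'. real_cond_exp N F (indicator D) \<omega> \<partial>N)"
      using S'F D by (intro real_cond_exp_intA) (simp_all add: integrable_indicator_iff less_top[symmetric])
    also have "\<dots> = (\<integral>\<omega>\<in>S'. p \<omega> \<partial>N)"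
      unfolding set_lebesgue_integral_def
    proof (rule integral_cong_AE)
      show "AE \<omega> in N. indicat_real S' \<omega> *\<^sub>R real_cond_exp N F (indicator D) \<omega> = indicat_real S' \<omega> *\<^sub>R p \<omega>"
        using cond[OF A, of t] by eventually_elim (simp add: F_def D_def p_def)
    qed measurable
    also have "ennreal \<dots> = (\<integral>\<^sup>+\<omega>. ennreal (p \<omega>) * indicator S' \<omega> \<partial>N)"
    proof -
      have "integrable N (\<lambda>\<omega>. indicat_real S' \<omega> *\<^sub>R p \<omega>)"
        using p0 p1 by (intro N.integrable_bounded_by[of _ 1]) (auto simp: indicator_def)
      then have "ennreal (\<integral>\<omega>. indicat_real S' \<omega> *\<^sub>R p \<omega> \<partial>N) = (\<integral>\<^sup>+\<omega>. ennreal (indicat_real S' \<omega> *\<^sub>R p \<omega>) \<partial>N)"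
        using p0 by (intro nn_integral_eq_integral[symmetric]) auto
      also have "\<dots> = (\<integral>\<^sup>+\<omega>. ennreal (p \<omega>) * indicator S' \<omega> \<partial>N)"
        by (intro nn_integral_cong) (auto simp: indicator_def)
      finally show ?thesis by (simp add: set_lebesgue_integral_def)
    qed
    also have "\<dots> = (\<integral>\<^sup>+\<omega>. emeasure (P (snd (?Z \<omega> (t - 1))) (fst (?Z \<omega> (t - 1)))) A * indicator S (?Z \<omega>) \<partial>N)"
      by (intro nn_integral_cong) (auto simp: indicator_def S'_def p_def emeasure_P)
    also have "\<dots> = (\<integral>\<^sup>+\<omega>. emeasure (P (snd (\<omega> (t - 1))) (fst (\<omega> (t - 1)))) A * indicator S \<omega> \<partial>Q)"
      unfolding Q using P_emeasure_coord[OF A] Sc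
      by (intro nn_integral_distr[symmetric] Z borel_measurable_times_ennreal borel_measurable_indicator) auto
    finally show "emeasure Q (S \<inter> {\<omega>. fst (\<omega> t) \<in> A}) =
      (\<integral>\<^sup>+\<omega>. emeasure (P (snd (\<omega> (t - 1))) (fst (\<omega> (t - 1)))) A * indicator S \<omega> \<partial>Q)" .
  qed
  with prob_Q sets_Q shift env show ?thesis unfolding Q_def[symmetric] by (simp add: stationary_chain_def)
qed

text \<open>The kernel evaluated at time t - 1 is measurable with respect to the past of
  \<open>t\<close>, and \<open>markov_at\<close> supplies the integrals over past events that
  characterise it as the conditional expectation.\<close>

lemma stationary_chain_MCRE:
  assumes Q: "stationary_chain Q"
  shows "MCRE P L Q (\<lambda>t \<omega>. fst (\<omega> t)) (\<lambda>t \<omega>. snd (\<omega> t))"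
proof -
  have pQ: "prob_space Q" and s: "sets Q = sets chain_space" and inv: "distr Q chain_space path_shift = Q"
    and env: "distr Q env_space (\<lambda>\<omega> s. snd (\<omega> s)) = L" and mk: "\<And>t. markov_at Q t"
    using Q by (auto simp: stationary_chain_def)
  interpret Q: prob_space Q by (rule pQ)
  note [measurable_cong] = s
  have space_Q: "space Q = UNIV" using sets_eq_imp_space_eq[OF s] by simp
  have past: "past_sigma Q (\<lambda>t \<omega>. fst (\<omega> t)) (\<lambda>t \<omega>. snd (\<omega> t)) t = past t" for t
    by (simp add: past_def past_sigma_def space_Q)
  have st: "stationary Q (borel \<Otimes>\<^sub>M borel) (\<lambda>t \<omega>. (fst (\<omega> t), snd (\<omega> t)))"
    unfolding stationary_def law_def prod.collapse
    using inv distr_id2[OF s[symmetric]] by (simp add: path_shift_def[abs_def])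
  have cond: "AE \<omega> in Q. real_cond_exp Q (past t) (indicator {\<omega>\<in>space Q. fst (\<omega> t) \<in> A}) \<omega>
      = measure (P (snd (\<omega> (t - 1))) (fst (\<omega> (t - 1)))) A" if A: "A \<in> sets borel" for t A
  proof -
    have sub: "subalgebra Q (past t)"
      using sets_past_subset s by (auto simp: subalgebra_def space_Q)
    interpret finite_measure_subalgebra Q "past t" by unfold_locales (rule sub)
    define p where "p \<omega> = measure (P (snd (\<omega> (t - 1))) (fst (\<omega> (t - 1)))) A" for \<omega> :: "int \<Rightarrow> 'e \<times> 'f"
    have pF: "p \<in> borel_measurable (past t)"
    proof -
      have "(\<lambda>\<omega>. case (snd (\<omega> (t - 1)), fst (\<omega> (t - 1))) of (x, y) \<Rightarrow> measure (P x y) A) \<in> borel_measurable (past t)"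
        by (intro measurable_compose[OF _ P_meas[OF A]] measurable_Pair past_snd past_fst) simp
      then show ?thesis by (simp add: p_def[abs_def])
    qed
    have p [measurable]: "p \<in> borel_measurable Q" by (rule measurable_from_subalg[OF sub pF])
    have p0: "0 \<le> p \<omega>" and p1: "p \<omega> \<le> 1" for \<omega>
      using prob_space.prob_le_1[OF prob_P] by (auto simp: p_def)
    define D where "D = {\<omega>\<in>space Q. fst (\<omega> t) \<in> A}"
    have D [measurable]: "D \<in> sets Q"
      using measurable_sets[OF chain_fst A, of t] s by (simp add: D_def vimage_def space_Q)
    have "AE \<omega> in Q. real_cond_exp Q (past t) (indicator D) \<omega> = p \<omega>"
    proof (rule real_cond_exp_charact)
      show "integrable Q (indicat_real D)" by (simp add: integrable_indicator_iff less_top[symmetric])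
      show "integrable Q p" using p0 p1 by (intro Q.integrable_bounded_by[of _ 1]) auto
      show "p \<in> borel_measurable (past t)" by (rule pF)
      fix S :: "(int \<Rightarrow> 'e \<times> 'f) set" assume S: "S \<in> sets (past t)"
      have S' [measurable]: "S \<in> sets Q" using S sub by (auto simp: subalgebra_def)
      have "ennreal (\<integral>\<omega>. indicat_real S \<omega> *\<^sub>R indicat_real D \<omega> \<partial>Q) = (\<integral>\<^sup>+\<omega>. ennreal (indicat_real S \<omega> *\<^sub>R indicat_real D \<omega>) \<partial>Q)"
        by (intro nn_integral_eq_integral[symmetric] Q.integrable_bounded_by[of _ 1]) (auto simp: indicator_def)
      also have "\<dots> = (\<integral>\<^sup>+\<omega>. indicator (S \<inter> D) \<omega> \<partial>Q)"
        by (intro nn_integral_cong) (auto simp: indicator_def)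
      also have "\<dots> = emeasure Q (S \<inter> {\<omega>. fst (\<omega> t) \<in> A})"
        using D by (simp add: D_def space_Q)
      also have "\<dots> = (\<integral>\<^sup>+\<omega>. ennreal (p \<omega>) * indicator S \<omega> \<partial>Q)"
        by (simp add: markov_at_emeasure[OF s mk S A] emeasure_P p_def)
      also have "\<dots> = (\<integral>\<^sup>+\<omega>. ennreal (indicat_real S \<omega> *\<^sub>R p \<omega>) \<partial>Q)"
        by (intro nn_integral_cong) (auto simp: indicator_def)
      also have "\<dots> = ennreal (\<integral>\<omega>. indicat_real S \<omega> *\<^sub>R p \<omega> \<partial>Q)"
        using p0 p1 by (intro nn_integral_eq_integral Q.integrable_bounded_by[of _ 1]) (auto simp: indicator_def)
      finally show "(\<integral>\<omega>\<in>S. indicator D \<omega> \<partial>Q) = (\<integral>\<omega>\<in>S. p \<omega> \<partial>Q)"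
        unfolding set_lebesgue_integral_def
        using p0 by (subst (asm) ennreal_inj) (auto intro!: integral_nonneg_AE)
    qed
    then show ?thesis by (simp add: D_def p_def)
  qed
  show ?thesis
    unfolding MCRE_def past using pQ st env cond by (auto simp: law_def)
qed

end

theorem theorem1:
  fixes P :: "'f::polish_space \<Rightarrow> 'e::polish_space \<Rightarrow> 'e measure"
    and M :: "'w measure" and X :: "int \<Rightarrow> 'w \<Rightarrow> 'f"
    and V :: "'e \<Rightarrow> real" and lam b :: "'f \<Rightarrow> real"
    and eta :: "real \<Rightarrow> 'f \<Rightarrow> real"
  assumes kernel: "\<forall>x y. prob_space (P x y) \<and> sets (P x y) = sets borel"
    and kernel_meas: "\<forall>A\<in>sets borel. (\<lambda>(x, y). measure (P x y) A) \<in> borel_measurable (borel \<Otimes>\<^sub>M borel)"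
    and M: "prob_space M"
    and X_meas: "\<forall>t. X t \<in> M \<rightarrow>\<^sub>M borel"
    and A1: "stationary M borel X"
    and V_meas: "V \<in> borel_measurable borel" and V_pos: "\<forall>y. V y > 0"
    and lam_meas: "lam \<in> borel_measurable borel" and lam_nn: "\<forall>x. lam x \<ge> 0"
    and b_meas: "b \<in> borel_measurable borel" and b_nn: "\<forall>x. b x \<ge> 0"
    and lam_log: "(\<integral>\<^sup>+\<omega>. ennreal (logplus (lam (X 0 \<omega>))) \<partial>M) < \<infinity>"
    and b_log: "(\<integral>\<^sup>+\<omega>. ennreal (logplus (b (X 0 \<omega>))) \<partial>M) < \<infinity>"
    and drift: "\<forall>x y. (\<integral>\<^sup>+y'. ennreal (V y') \<partial>(P x y)) \<le> ennreal (lam x * V y + b x)"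
    and contr: "AE \<omega> in M. limsup (\<lambda>n. ereal (root n (\<Prod>i\<in>{1..n}. lam (X (- int i) \<omega>)))) < 1"
    and eta_meas: "(\<lambda>(r, x). eta r x) \<in> borel_measurable (restrict_space borel {0<..} \<Otimes>\<^sub>M borel)"
    and eta_range: "\<forall>r>0. \<forall>x. 0 < eta r x \<and> eta r x < 1"
    and A3: "\<forall>R>0. \<exists>\<nu> :: 'f \<Rightarrow> 'e measure.
               (\<forall>x. prob_space (\<nu> x) \<and> sets (\<nu> x) = sets borel) \<and>
               (\<forall>A\<in>sets borel. (\<lambda>x. measure (\<nu> x) A) \<in> borel_measurable borel) \<and>
               (\<forall>x y A. V y \<le> R \<longrightarrow> A \<in> sets borel \<longrightarrow> eta R x * measure (\<nu> x) A \<le> measure (P x y) A)"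
  shows "(\<exists>Q :: (int \<Rightarrow> 'e \<times> 'f) measure.
            MCRE P (law M borel X) Q (\<lambda>t \<omega>. fst (\<omega> t)) (\<lambda>t \<omega>. snd (\<omega> t)))
       \<and> (\<forall>(N1 :: 'v measure) Y1 X1 (N2 :: 'u measure) Y2 X2.
            MCRE P (law M borel X) N1 Y1 X1 \<and> MCRE P (law M borel X) N2 Y2 X2 \<longrightarrow>
            law N1 (borel \<Otimes>\<^sub>M borel) (\<lambda>t \<omega>. (Y1 t \<omega>, X1 t \<omega>))
              = law N2 (borel \<Otimes>\<^sub>M borel) (\<lambda>t \<omega>. (Y2 t \<omega>, X2 t \<omega>)))
       \<and> (ergodic_law (law M borel X) \<longrightarrow>
            (\<forall>(N :: 'v measure) Y X'. MCRE P (law M borel X) N Y X' \<longrightarrow>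
               ergodic_law (law N (borel \<Otimes>\<^sub>M borel) (\<lambda>t \<omega>. (Y t \<omega>, X' t \<omega>)))))"
proof -
  \<comment> \<open>Any point of the state space can serve as the starting point.\<close>
  define y0 :: 'e where "y0 = undefined"
  define L where "L = law M borel X"
  have Xm: "(\<lambda>\<omega> t. X t \<omega>) \<in> M \<rightarrow>\<^sub>M env_space"
    using X_meas by (intro measurable_paths) auto
  have L_distr: "L = distr M env_space (\<lambda>\<omega> t. X t \<omega>)" by (simp add: L_def law_def)
  have prob_L: "prob_space L" unfolding L_distr by (rule prob_space.prob_space_distr[OF M Xm])
  have sets_L: "sets L = sets env_space" by (simp add: L_distr)
  have L_inv: "distr L env_space path_shift = L"
    using A1 X_meas unfolding stationary_def L_def by (subst (asm) law_shift) auto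
  have b_log_L: "(\<integral>\<^sup>+x. ennreal (logplus (b (x 0))) \<partial>L) < \<infinity>"
    unfolding L_distr using b_log b_meas by (subst nn_integral_distr[OF Xm]) auto
  have "AE \<omega> in M. lyap lam (\<lambda>x. b x + V y0) (\<lambda>t. X t \<omega>) < \<infinity>"
  proof -
    have "AE x in L. eventually (\<lambda>n. logplus (b (x (- 1 - int n))) \<le> real n * (1 / real (Suc k))) sequentially" for k
      by (rule eventually_logplus_le[OF prob_L sets_L L_inv b_meas b_log_L]) simp
    \<comment> \<open>The growth rate that is needed depends on the path through its own contraction
      factor; a countable family of rates covers all paths outside a single null set.\<close>
    then have "AE x in L. \<forall>k. eventually (\<lambda>n. logplus (b (x (- 1 - int n))) \<le> real n * (1 / real (Suc k))) sequentially"
      by (simp add: AE_all_countable)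
    then have "AE \<omega> in M. \<forall>k. eventually (\<lambda>n. logplus (b (X (- 1 - int n) \<omega>)) \<le> real n * (1 / real (Suc k))) sequentially"
      unfolding L_distr by (rule AE_distrD[OF Xm])
    with contr show ?thesis
    proof eventually_elim
      case (elim \<omega>)
      then show ?case
        using lam_nn b_nn V_pos[rule_format, of y0]
        by (intro lyap_finite_of_contraction) (auto simp del: of_nat_Suc)
    qed
  qed
  moreover have "{x\<in>space env_space. lyap lam (\<lambda>x. b x + V y0) x < \<infinity>} \<in> sets env_space"
  proof -
    have "(\<lambda>x. b x + V y0) \<in> borel_measurable borel" using b_meas by measurable
    note [measurable] = lyap_measurable[OF lam_meas this]
    show ?thesis by measurable
  qed
  ultimately have lyap_fin: "AE x in L. lyap lam (\<lambda>x. b x + V y0) x < \<infinity>"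
    unfolding L_distr by (subst AE_distr_iff[OF Xm]) auto
  interpret drift_kernel P V lam "\<lambda>x. b x + V y0" eta L y0
  proof (intro drift_kernel.intro random_kernel.intro drift_kernel_axioms.intro)
    show "prob_space (P x y)" "sets (P x y) = sets borel" for x y using kernel by auto
    show "(\<lambda>(x, y). measure (P x y) A) \<in> borel_measurable (borel \<Otimes>\<^sub>M borel)" if "A \<in> sets borel" for A
      using kernel_meas that by blast
    show "(\<integral>\<^sup>+y'. ennreal (V y') \<partial>P x y) \<le> ennreal (lam x * V y + (b x + V y0))" for x y
    proof -
      have "ennreal (lam x * V y + b x) \<le> ennreal (lam x * V y + (b x + V y0))"
        using V_pos[rule_format, of y0] by (intro ennreal_leI) simp
      with drift[rule_format, of x y] show ?thesis by (rule order_trans)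
    qed
    show "eta R \<in> borel_measurable borel" if R: "0 < R" for R
    proof -
      have "(\<lambda>x. (R, x)) \<in> (borel :: 'f measure) \<rightarrow>\<^sub>M restrict_space borel {0<..} \<Otimes>\<^sub>M borel"
        using R by (intro measurable_Pair measurable_const) (auto simp: space_restrict_space)
      from measurable_compose[OF this eta_meas] show ?thesis by simp
    qed
    show "0 < eta R x \<and> eta R x < 1" if "0 < R" for R x using eta_range that by blast
    show "\<exists>\<nu>. prob_space \<nu> \<and> sets \<nu> = sets borel \<and>
      (\<forall>y A. V y \<le> R \<longrightarrow> A \<in> sets borel \<longrightarrow> eta R x * measure \<nu> A \<le> measure (P x y) A)" if R: "0 < R" for R x
      using A3[rule_format, OF R] by blast
    show "(\<lambda>x. b x + V y0) \<in> borel_measurable borel" using b_meas by measurable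
    show "V y0 \<le> b x + V y0" for x using b_nn by simp
  qed (use V_meas V_pos lam_meas lam_nn prob_L sets_L L_inv lyap_fin in auto)
  obtain Q where "stationary_chain Q" using stationary_chain_exists ..
  then have "MCRE P L Q (\<lambda>t \<omega>. fst (\<omega> t)) (\<lambda>t \<omega>. snd (\<omega> t))"
    by (rule stationary_chain_MCRE)
  then show ?thesis
    unfolding L_def[symmetric]
    by (intro conjI allI impI exI[of _ Q])
      (auto intro: stationary_chain_unique stationary_chain_law stationary_chain_ergodic)
qed

end
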